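(* Let $l\ge2$ and let $\mathcal D=\mathcal D(\mathcal E,\Pi,a,k,g)$ be a quasi-elliptic base system (QEBS) such that $g(\alpha)=\emptyset$ or $2\mathbb Z+1$ for every $\alpha\in\Pi$. Let $(\mathcal L,(\,,\,),\mathcal H)$ be an extended affine Lie algebra (EALA). Assume that there exists an isometric linear monomorphism $\varphi:\mathcal E\to\mathcal H^*$ such that $\varphi(R(k,g))$ coincides with the set of non-isotropic roots of $\mathcal L$. Then there exists a homomorphism $\mathcal F:\bar{\mathfrak g}_{\mathcal D}\to\mathcal L$ such that $\mathcal F(h_\sigma)=t_{\varphi(\sigma)}$ for $\sigma\in\mathcal E$ and $\mathcal F(\bar{\mathfrak g}_{\mathcal D,\mu})=\mathcal L_{\varphi(\mu)}$ for $\mu\in R(k,g)$. Here $\bar{\mathfrak g}_{\mathcal D}=\mathfrak g^q_{\mathcal D}$ for some $q\in\mathbb C\setminus\{0\}$ if $\mathcal D$ is $A_l^{(1,1)}$ (i.e. the affine Cartan matrix $A$ is of type $A_l^{(1)}$), and $\bar{\mathfrak g}_{\mathcal D}=\mathfrak g_{\mathcal D}$ otherwise.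
   Context: All vector spaces and Lie (super)algebras are over $\mathbb C$. $\mathbb N=\{1,2,\dots\}$. **Pre-elliptic base systems.** Fix $l\ge2$. $\mathcal E$ is an $(l+4)$-dimensional $\mathbb C$-vector space with a nondegenerate symmetric bilinear form $J$. Put $\mathcal E^\times=\{x\in\mathcal E\mid J(x,x)\ne0\}$; for $x\in\mathcal E^\times$ put $x^\vee=2x/J(x,x)$ and $s_x(y)=y-J(x^\vee,y)x$. Let $\{\alpha_0,\dots,\alpha_l,\Lambda_\delta,a,\Lambda_a\}$ be a basis of $\mathcal E$ such that: (B1) $A=(J(\alpha_i^\vee,\alpha_j))_{0\le i,j\le l}$ is an (indecomposable) affine type generalized Cartan matrix, numbered as in Kac's book (Tables Aff 1,2,3), i.e. of type $A_l^{(1)},B_l^{(1)},C_l^{(1)},D_l^{(1)},E_{6,7,8}^{(1)},F_4^{(1)},G_2^{(1)},A_{2l}^{(2)},A_{2l-1}^{(2)},D_{l+1}^{(2)},E_6^{(2)}$ or $D_4^{(3)}$; (B2) $J(\Lambda_\delta,\Lambda_\delta)=J(a,\alpha_i)=J(a,\Lambda_\delta)=J(a,a)=J(\Lambda_a,\alpha_i)=J(\Lambda_a,\Lambda_a)=0$, $J(\Lambda_a,a)=1$, and $J(\Lambda_\delta,\alpha_i)=\frac1r\delta_{i0}$ with $r=2$ if $A=A_{2l}^{(2)}$ (where $\alpha_0$ is the shortest simple root) and $r=1$ otherwise. Let $\Pi=\{\alpha_0,\dots,\alpha_l\}$ and $W=\langle s_\alpha\mid\alpha\in\Pi\rangle$.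 A function $f$ on $\Pi$ is $W$-invariant if $f(\alpha)=f(\beta)$ whenever $\alpha,\beta\in\Pi$, $\beta=w(\alpha)$, $w\in W$. Let $k:\Pi\to\mathbb N$ be $W$-invariant with $\gcd\{k(\alpha)\mid\alpha\in\Pi\}=1$ and $g:\Pi\to 2^{\mathbb Z}$ (subsets of $\mathbb Z$) be $W$-invariant. Then $\mathcal D=\mathcal D(\mathcal E,\Pi,a,k,g)$ is a pre-elliptic base system (PEBS). Put $$R(k,g)=\bigcup_{w\in W}w\Bigl(\bigcup_{\alpha\in\Pi}\bigl((\alpha+\mathbb Zk(\alpha)a)\cup(2\alpha+g(\alpha)k(\alpha)a)\bigr)\Bigr),$$ where $2\alpha+g(\alpha)k(\alpha)a=\{2\alpha+nk(\alpha)a\mid n\in g(\alpha)\}$ (empty if $g(\alpha)=\emptyset$). **QEBS.** For $\alpha\in\Pi$ let $\Pi_c(\alpha)=\{\beta\in\Pi\mid\beta\ne\alpha,\ J(\beta,\alpha)\ne0\}$ and $\Pi^B=\{\alpha\in\Pi\mid J(\alpha^\vee,\beta)=-2\ \forall\beta\in\Pi_c(\alpha)\}$. A PEBS is a QEBS if: (KG1) if $\alpha\in\Pi$, $\beta\in\Pi_c(\alpha)$, $J(\beta^\vee,\alpha)=-1$, then $\frac{k(\beta)}{k(\alpha)}\in\mathbb Z$ and $J(\alpha^\vee,\beta)\frac{k(\alpha)}{k(\beta)}\in\mathbb Z$; (KG2) $g(\alpha)=\emptyset$ if $\alpha\notin\Pi^B$; (KG3) if $\alpha\in\Pi^B$ and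 $\beta\in\Pi_c(\alpha)$, then the set $g(\alpha)\frac{k(\alpha)}{k(\beta)}$ is $\emptyset$, $\mathbb Z$, $2\mathbb Z$ or $2\mathbb Z+1$. **The Lie superalgebra $\mathfrak g_{\mathcal D}$.** For $\alpha\in\Pi$ let $c(\alpha)=2$ if $g(\alpha)=\mathbb Z$ or $2\mathbb Z+1$, and $c(\alpha)=1$ otherwise; $\alpha^*=c(\alpha)\alpha+k(\alpha)a$. For $\alpha\in R(k,g)$ let $p(\alpha)=1$ if $2\alpha\in R(k,g)$ and $p(\alpha)=0$ otherwise. Let $\mathcal A=\{(\alpha,\beta,y)\in\Pi\times\Pi\times\mathbb N\mid\alpha\ne\beta,\ J(\alpha,\beta^\vee)=-1,\ k(\alpha)y=k(\beta)\}$, $\Pi^*=\{\alpha^*\mid\alpha\in\Pi\}$, $\mathcal B_+=\Pi\cup\Pi^*$, $\mathcal B=\mathcal B_+\cup-\mathcal B_+$, $(\mathcal B\times\mathcal B)'=\{(\mu,\nu)\in\mathcal B\times\mathcal B\mid\mu\ne\nu,\ \mu+\nu\ne0\}$; for $(\mu,\nu)\in(\mathcal B\times\mathcal B)'$ let $x_{\mu,\nu}=1-J(\mu^\vee,\nu)$ if $J(\mu^\vee,\nu)<0$ and $x_{\mu,\nu}=1$ if $J(\mu^\vee,\nu)\ge0$. $\mathfrak g_{\mathcal D}$ is the Lie superalgebra with generators $h_\sigma$ ($\sigma\in\mathcal E$, even) and $E_\mu$ ($\mu\in\mathcal B$, parity $p(\mu)$) and relations: (SR1) $xh_\sigma+yh_\tau=h_{x\sigma+y\tau}$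 ($x,y\in\mathbb C$); (SR2) $[h_\sigma,h_\tau]=0$; (SR3) $[h_\sigma,E_\mu]=J(\sigma,\mu)E_\mu$; (SR4) $[E_\mu,E_{-\mu}]=h_{\mu^\vee}$ for $\mu\in\mathcal B_+$; (SR5) $(\mathrm{ad}E_\mu)^{x_{\mu,\nu}}E_\nu=0$ for $(\mu,\nu)\in(\mathcal B\times\mathcal B)'$; and for $(\alpha,\beta,y)\in\mathcal A$: (SR6) $c(\alpha)(\mathrm{ad}E_{\alpha^*})^yE_\beta=(\mathrm{ad}E_\alpha)^{c(\alpha)y}E_{\beta^*}$; (SR7) $(-1)^{c(\alpha)+1}c(\alpha)(\mathrm{ad}E_{-\alpha^*})^yE_{-\beta}=(\mathrm{ad}E_{-\alpha})^{c(\alpha)y}E_{-\beta^*}$; (SR8) $(\mathrm{ad}E_\alpha)^i(\mathrm{ad}E_{\alpha^*})^{y-i}E_\beta=0$ for $1\le i\le y-1$; (SR9) $(\mathrm{ad}E_{-\alpha})^i(\mathrm{ad}E_{-\alpha^*})^{y-i}E_{-\beta}=0$ for $1\le i\le y-1$. **$\mathfrak g^q_{\mathcal D}$.** If $A$ is of type $A_l^{(1)}$ (cyclic numbering; then $k\equiv1$, $g\equiv\emptyset$) and $q\in\mathbb C\setminus\{0\}$, $\mathfrak g^q_{\mathcal D}$ is defined by the same generators and relations except that the relations $[E_{\pm\alpha_0^*},E_{\pm\alpha_l}]=[E_{\pm\alpha_0},E_{\pm\alpha_l^*}]$ in (SR6)--(SR7) (arising from both $(\alpha_0,\alpha_l,1)$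 and $(\alpha_l,\alpha_0,1)$ in $\mathcal A$) are replaced by $q^{\pm1}[E_{\pm\alpha_0^*},E_{\pm\alpha_l}]=[E_{\pm\alpha_0},E_{\pm\alpha_l^*}]$. For $\bar{\mathfrak g}_{\mathcal D}$ either of these, $\bar{\mathfrak g}_{\mathcal D,\mu}=\{X\mid[h_\sigma,X]=J(\sigma,\mu)X\ \forall\sigma\in\mathcal E\}$. **EALA** (Allison--Azam--Berman--Gao--Pianzola). A triple $(\mathcal L,(\,,\,),\mathcal H)$ with $\mathcal L$ a complex Lie algebra such that: (EA1) $(\,,\,)$ is a nondegenerate invariant symmetric bilinear form on $\mathcal L$; (EA2) $\mathcal H$ is a nonzero finite-dimensional abelian subalgebra, ad-diagonalizable on $\mathcal L$ and equal to its own centralizer. Then $\mathcal L=\bigoplus_{\alpha\in\mathcal H^*}\mathcal L_\alpha$ with $\mathcal L_\alpha=\{x\mid[h,x]=\alpha(h)x\ \forall h\in\mathcal H\}$, $\mathcal L_0=\mathcal H$; the form is nondegenerate on $\mathcal H$, $t_\alpha\in\mathcal H$ is defined by $(t_\alpha,h)=\alpha(h)$, and $\mathcal H^*$ carries the form $(\alpha,\beta)=(t_\alpha,t_\beta)$. The roots are $\{\alpha\mid\mathcal L_\alpha\ne0\}$; a root is non-isotropic if $(\alpha,\alpha)\ne0$ and isotropic otherwise. (EA3) $\mathrm{ad}\,x$ is locally nilpotent for $x\in\mathcal L_\alpha$, $\alpha$ a non-isotropic root; (EA4) the set of roots is discrete in $\mathcal H^*$; (EA5) the set of non-isotropic roots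 is not a union of two nonempty mutually orthogonal subsets, and for each isotropic root $\sigma$ there is a non-isotropic root $\alpha$ such that $\alpha+\sigma$ is a root. "Isometric" means $(\varphi(x),\varphi(y))=J(x,y)$. *)

theory Defs
  imports "HOL-Analysis.Analysis" "HOL-Library.Poly_Mapping"
begin

section \<open>Affine generalized Cartan matrices\<close>

datatype affine_type =
    Aff_A1 | Aff_B1 | Aff_C1 | Aff_D1 | Aff_E61 | Aff_E71 | Aff_E81 | Aff_F41 | Aff_G21
  | Aff_A2_even | Aff_A2_odd | Aff_D2 | Aff_E62 | Aff_D43

text \<open>With nodes numbered \<open>0, \<dots>, l\<close>, these are in turn \<open>A_l^(1)\<close>, \<open>B_l^(1)\<close>, \<open>C_l^(1)\<close>, \<open>D_l^(1)\<close>,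
  \<open>E_6^(1)\<close>, \<open>E_7^(1)\<close>, \<open>E_8^(1)\<close>, \<open>F_4^(1)\<close>, \<open>G_2^(1)\<close>, \<open>A_2l^(2)\<close>, \<open>A_(2l-1)^(2)\<close>, \<open>D_(l+1)^(2)\<close>,
  \<open>E_6^(2)\<close>, \<open>D_4^(3)\<close>. The ranges of \<open>l\<close> are those of Kac's Tables Aff 1--3, restricted to
  \<open>l \<ge> 2\<close>.\<close>

fun affine_rank :: "affine_type \<Rightarrow> nat \<Rightarrow> bool" where
  "affine_rank Aff_A1 l \<longleftrightarrow> 2 \<le> l"
| "affine_rank Aff_B1 l \<longleftrightarrow> 3 \<le> l"
| "affine_rank Aff_C1 l \<longleftrightarrow> 2 \<le> l"
| "affine_rank Aff_D1 l \<longleftrightarrow> 4 \<le> l"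
| "affine_rank Aff_E61 l \<longleftrightarrow> l = 6"
| "affine_rank Aff_E71 l \<longleftrightarrow> l = 7"
| "affine_rank Aff_E81 l \<longleftrightarrow> l = 8"
| "affine_rank Aff_F41 l \<longleftrightarrow> l = 4"
| "affine_rank Aff_G21 l \<longleftrightarrow> l = 2"
| "affine_rank Aff_A2_even l \<longleftrightarrow> 2 \<le> l"
| "affine_rank Aff_A2_odd l \<longleftrightarrow> 3 \<le> l"
| "affine_rank Aff_D2 l \<longleftrightarrow> 2 \<le> l"
| "affine_rank Aff_E62 l \<longleftrightarrow> l = 4"
| "affine_rank Aff_D43 l \<longleftrightarrow> l = 2"

text \<open>A bond \<open>(i, j, p, q)\<close> stands for the matrix entries \<open>a\<^sub>i\<^sub>j = - p\<close> and \<open>a\<^sub>j\<^sub>i = - q\<close>; so \<open>p > 1\<close>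
  means an arrow pointing from \<open>j\<close> towards the shorter root \<open>i\<close>.\<close>

type_synonym bond = "nat \<times> nat \<times> int \<times> int"

definition chain :: "nat \<Rightarrow> nat \<Rightarrow> bond list" where
  "chain i j = map (\<lambda>m. (m, Suc m, 1, 1)) [i..<j]"

fun bonds :: "affine_type \<Rightarrow> nat \<Rightarrow> bond list" where
  "bonds Aff_A1 l = chain 0 l @ [(l, 0, 1, 1)]"
| "bonds Aff_B1 l = [(0, 2, 1, 1)] @ chain 1 (l - 1) @ [(l - 1, l, 1, 2)]"
| "bonds Aff_C1 l = [(0, 1, 1, 2)] @ chain 1 (l - 1) @ [(l - 1, l, 2, 1)]"
| "bonds Aff_D1 l = [(0, 2, 1, 1)] @ chain 1 (l - 1) @ [(l - 2, l, 1, 1)]"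
| "bonds Aff_E61 l = chain 1 5 @ [(3, 6, 1, 1), (6, 0, 1, 1)]"
| "bonds Aff_E71 l = chain 0 6 @ [(3, 7, 1, 1)]"
| "bonds Aff_E81 l = chain 0 7 @ [(5, 8, 1, 1)]"
| "bonds Aff_F41 l = chain 0 2 @ [(2, 3, 1, 2), (3, 4, 1, 1)]"
| "bonds Aff_G21 l = [(0, 1, 1, 1), (1, 2, 1, 3)]"
| "bonds Aff_A2_even l = [(0, 1, 2, 1)] @ chain 1 (l - 1) @ [(l - 1, l, 2, 1)]"
| "bonds Aff_A2_odd l = [(0, 2, 1, 1)] @ chain 1 (l - 1) @ [(l - 1, l, 2, 1)]"
| "bonds Aff_D2 l = [(0, 1, 2, 1)] @ chain 1 (l - 1) @ [(l - 1, l, 1, 2)]"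
| "bonds Aff_E62 l = chain 0 2 @ [(2, 3, 2, 1), (3, 4, 1, 1)]"
| "bonds Aff_D43 l = [(0, 1, 1, 1), (1, 2, 3, 1)]"

definition affine_gcm :: "affine_type \<Rightarrow> nat \<Rightarrow> nat \<Rightarrow> nat \<Rightarrow> int" where
  "affine_gcm X l i j = (if i = j then 2 else
     - (\<Sum>(i', j', p, q) \<leftarrow> bonds X l.
          if (i, j) = (i', j') then p else if (i, j) = (j', i') then q else 0))"

section \<open>Base systems\<close>

text \<open>The underlying space \<open>\<E>\<close> is the whole type \<^typ>\<open>'e\<close>, with complex scalar multiplication
  \<open>e_scale\<close> and form \<open>e_form\<close> (that is, \<open>J\<close>); \<open>e_simple i\<close> is \<open>\<alpha>\<^sub>i\<close> for \<open>i \<le> l = e_rank\<close>. Only the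
  values of \<open>e_k\<close> and \<open>e_g\<close> on the simple roots matter.\<close>

record 'e base_system =
  e_scale :: "complex \<Rightarrow> 'e \<Rightarrow> 'e"
  e_form :: "'e \<Rightarrow> 'e \<Rightarrow> complex"
  e_rank :: nat
  e_type :: affine_type
  e_simple :: "nat \<Rightarrow> 'e"
  e_Lambda_delta :: 'e
  e_a :: 'e
  e_Lambda_a :: 'e
  e_k :: "'e \<Rightarrow> nat"
  e_g :: "'e \<Rightarrow> int set"

definition simple_roots :: "'e base_system \<Rightarrow> 'e set" where
  "simple_roots D = e_simple D ` {..e_rank D}"

definition coroot :: "'e base_system \<Rightarrow> 'e \<Rightarrow> 'e" where
  "coroot D x = e_scale D (2 / e_form D x x) x"

definition reflection :: "'e::ab_group_add base_system \<Rightarrow> 'e \<Rightarrow> 'e \<Rightarrow> 'e" where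
  "reflection D x y = y - e_scale D (e_form D (coroot D x) y) x"

text \<open>The reflections are involutions, so the group they generate consists of their finite
  products.\<close>

inductive_set weyl_group :: "'e::ab_group_add base_system \<Rightarrow> ('e \<Rightarrow> 'e) set"
  for D where
  "id \<in> weyl_group D"
| "\<alpha> \<in> simple_roots D \<Longrightarrow> w \<in> weyl_group D \<Longrightarrow> reflection D \<alpha> \<circ> w \<in> weyl_group D"

definition weyl_invariant :: "'e::ab_group_add base_system \<Rightarrow> ('e \<Rightarrow> 'v) \<Rightarrow> bool" where
  "weyl_invariant D f \<longleftrightarrow>
     (\<forall>\<alpha>\<in>simple_roots D. \<forall>\<beta>\<in>simple_roots D. \<forall>w\<in>weyl_group D. \<beta> = w \<alpha> \<longrightarrow> f \<alpha> = f \<beta>)"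

definition symmetric_bilinear ::
    "(complex \<Rightarrow> 'v \<Rightarrow> 'v) \<Rightarrow> ('v::ab_group_add \<Rightarrow> 'v \<Rightarrow> complex) \<Rightarrow> bool" where
  "symmetric_bilinear sc B \<longleftrightarrow>
     (\<forall>x. Vector_Spaces.linear sc (*) (B x)) \<and> (\<forall>x y. B x y = B y x)"

definition nondegenerate :: "('v::zero \<Rightarrow> 'v \<Rightarrow> complex) \<Rightarrow> bool" where
  "nondegenerate B \<longleftrightarrow> (\<forall>x. (\<forall>y. B x y = 0) \<longrightarrow> x = 0)"

definition base_vectors :: "'e base_system \<Rightarrow> 'e set" where
  "base_vectors D = simple_roots D \<union> {e_Lambda_delta D, e_a D, e_Lambda_a D}"

definition pebs :: "'e::ab_group_add base_system \<Rightarrow> bool" where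
  "pebs D \<longleftrightarrow>
     (let J = e_form D; l = e_rank D; \<alpha> = e_simple D; L\<delta> = e_Lambda_delta D; a = e_a D;
          La = e_Lambda_a D; r = (if e_type D = Aff_A2_even then 2 else 1)
      in
        2 \<le> l \<and>
        vector_space (e_scale D) \<and> symmetric_bilinear (e_scale D) J \<and> nondegenerate J \<and>
        card (base_vectors D) = l + 4 \<and>
        \<not> module.dependent (e_scale D) (base_vectors D) \<and>
        module.span (e_scale D) (base_vectors D) = UNIV \<and>
        affine_rank (e_type D) l \<and>
        (\<forall>i\<le>l. J (\<alpha> i) (\<alpha> i) \<noteq> 0) \<and>
        (\<forall>i\<le>l. \<forall>j\<le>l. J (coroot D (\<alpha> i)) (\<alpha> j) = of_int (affine_gcm (e_type D) l i j)) \<and>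
        J L\<delta> L\<delta> = 0 \<and> (\<forall>i\<le>l. J a (\<alpha> i) = 0) \<and> J a L\<delta> = 0 \<and> J a a = 0 \<and>
        (\<forall>i\<le>l. J La (\<alpha> i) = 0) \<and> J La La = 0 \<and> J La a = 1 \<and>
        (\<forall>i\<le>l. J L\<delta> (\<alpha> i) = (if i = 0 then 1 / r else 0)) \<and>
        (\<forall>\<beta>\<in>simple_roots D. 1 \<le> e_k D \<beta>) \<and>
        weyl_invariant D (e_k D) \<and> Gcd (e_k D ` simple_roots D) = 1 \<and>
        weyl_invariant D (e_g D))"

definition R_kg :: "'e::ab_group_add base_system \<Rightarrow> 'e set" where
  "R_kg D = (\<Union>w\<in>weyl_group D. w ` (\<Union>\<alpha>\<in>simple_roots D.
      {\<alpha> + e_scale D (of_int n * of_nat (e_k D \<alpha>)) (e_a D) | n. True} \<union>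
      {e_scale D 2 \<alpha> + e_scale D (of_int n * of_nat (e_k D \<alpha>)) (e_a D) | n. n \<in> e_g D \<alpha>}))"

definition connected_to :: "'e base_system \<Rightarrow> 'e \<Rightarrow> 'e set" where
  "connected_to D \<alpha> = {\<beta> \<in> simple_roots D. \<beta> \<noteq> \<alpha> \<and> e_form D \<beta> \<alpha> \<noteq> 0}"

definition simple_roots_B :: "'e base_system \<Rightarrow> 'e set" where
  "simple_roots_B D =
     {\<alpha> \<in> simple_roots D. \<forall>\<beta>\<in>connected_to D \<alpha>. e_form D (coroot D \<alpha>) \<beta> = - 2}"

definition qebs :: "'e::ab_group_add base_system \<Rightarrow> bool" where
  "qebs D \<longleftrightarrow> pebs D \<and>
     (\<forall>\<alpha>\<in>simple_roots D. \<forall>\<beta>\<in>connected_to D \<alpha>. e_form D (coroot D \<beta>) \<alpha> = - 1 \<longrightarrow>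
        of_nat (e_k D \<beta>) / of_nat (e_k D \<alpha>) \<in> (\<int> :: complex set) \<and>
        e_form D (coroot D \<alpha>) \<beta> * (of_nat (e_k D \<alpha>) / of_nat (e_k D \<beta>)) \<in> \<int>) \<and>
     (\<forall>\<alpha>\<in>simple_roots D. \<alpha> \<notin> simple_roots_B D \<longrightarrow> e_g D \<alpha> = {}) \<and>
     (\<forall>\<alpha>\<in>simple_roots_B D. \<forall>\<beta>\<in>connected_to D \<alpha>.
        (\<lambda>n. of_int n * (of_nat (e_k D \<alpha>) / of_nat (e_k D \<beta>))) ` e_g D \<alpha> \<in>
          {{}, range of_int, of_int ` {n. even n}, of_int ` {n. odd n} :: rat set})"

section \<open>Lie superalgebras by generators and relations\<close>

text \<open>\<open>sa_part G False\<close> and \<open>sa_part G True\<close> are the even and the odd part. The field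
  \<open>sa_gen\<close> of a presented superalgebra gives the classes of the generators.\<close>

record 'x lie_superalgebra =
  sa_carrier :: "'x set"
  sa_add :: "'x \<Rightarrow> 'x \<Rightarrow> 'x"
  sa_scale :: "complex \<Rightarrow> 'x \<Rightarrow> 'x"
  sa_bracket :: "'x \<Rightarrow> 'x \<Rightarrow> 'x"
  sa_part :: "bool \<Rightarrow> 'x set"

record ('x, 'g) presented_superalgebra = "'x lie_superalgebra" +
  sa_gen :: "'g \<Rightarrow> 'x"

definition lie_superalgebra_hom ::
    "('x, 'm) lie_superalgebra_scheme \<Rightarrow> ('y, 'n) lie_superalgebra_scheme \<Rightarrow> ('x \<Rightarrow> 'y) \<Rightarrow> bool" where
  "lie_superalgebra_hom G K F \<longleftrightarrow>
     F ` sa_carrier G \<subseteq> sa_carrier K \<and> (\<forall>b. F ` sa_part G b \<subseteq> sa_part K b) \<and>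
     (\<forall>x\<in>sa_carrier G. \<forall>y\<in>sa_carrier G. F (sa_add G x y) = sa_add K (F x) (F y)) \<and>
     (\<forall>c. \<forall>x\<in>sa_carrier G. F (sa_scale G c x) = sa_scale K c (F x)) \<and>
     (\<forall>x\<in>sa_carrier G. \<forall>y\<in>sa_carrier G. F (sa_bracket G x y) = sa_bracket K (F x) (F y))"

text \<open>Nonassociative monomials, and the free nonassociative algebra of their finite complex linear
  combinations.\<close>

datatype (leaves: 'g) magma = Leaf 'g | Br "'g magma" "'g magma"

type_synonym 'g free_alg = "'g magma \<Rightarrow>\<^sub>0 complex"

definition free_alg_on :: "'g set \<Rightarrow> 'g free_alg set" where
  "free_alg_on X = {f. \<forall>t\<in>Poly_Mapping.keys f. leaves t \<subseteq> X}"

definition gen_elt :: "'g \<Rightarrow> 'g free_alg" where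
  "gen_elt x = Poly_Mapping.single (Leaf x) 1"

definition fscale :: "complex \<Rightarrow> 'g free_alg \<Rightarrow> 'g free_alg" (infixr "\<cdot>\<^sub>F" 75) where
  "c \<cdot>\<^sub>F f = Poly_Mapping.map ((*) c) f"

lift_definition fmult :: "'g free_alg \<Rightarrow> 'g free_alg \<Rightarrow> 'g free_alg" (infixl "\<star>" 70)
  is "\<lambda>f g t. case t of Leaf _ \<Rightarrow> 0 | Br u v \<Rightarrow> f u * g v"
proof -
  fix f g :: "'g magma \<Rightarrow> complex"
  assume "finite {x. f x \<noteq> 0}" "finite {x. g x \<noteq> 0}"
  then have "finite ((\<lambda>(u, v). Br u v) ` ({x. f x \<noteq> 0} \<times> {x. g x \<noteq> 0}))"
    by blast
  then show "finite {t. (case t of Leaf _ \<Rightarrow> 0 | Br u v \<Rightarrow> f u * g v) \<noteq> 0}"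
    by (rule rev_finite_subset) (force split: magma.splits)
qed

primrec odd_monomial :: "('g \<Rightarrow> bool) \<Rightarrow> 'g magma \<Rightarrow> bool" where
  "odd_monomial p (Leaf x) = p x"
| "odd_monomial p (Br u v) = (odd_monomial p u \<noteq> odd_monomial p v)"

definition homogeneous :: "('g \<Rightarrow> bool) \<Rightarrow> bool \<Rightarrow> 'g free_alg \<Rightarrow> bool" where
  "homogeneous p b f \<longleftrightarrow> (\<forall>t\<in>Poly_Mapping.keys f. odd_monomial p t = b)"

definition koszul_sign :: "bool \<Rightarrow> bool \<Rightarrow> complex" where
  "koszul_sign b b' = (if b \<and> b' then - 1 else 1)"

text \<open>The two-sided ideal generated by the relators \<open>Rel\<close> together with all instances of super
  skew-symmetry and of the super Jacobi identity.\<close>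

inductive_set lie_ideal :: "'g set \<Rightarrow> ('g \<Rightarrow> bool) \<Rightarrow> 'g free_alg set \<Rightarrow> 'g free_alg set"
  for X p Rel where
  relator: "f \<in> Rel \<Longrightarrow> f \<in> lie_ideal X p Rel"
| skew: "\<lbrakk>f \<in> free_alg_on X; g \<in> free_alg_on X; homogeneous p b f; homogeneous p b' g\<rbrakk> \<Longrightarrow>
    f \<star> g + koszul_sign b b' \<cdot>\<^sub>F (g \<star> f) \<in> lie_ideal X p Rel"
| jacobi: "\<lbrakk>f \<in> free_alg_on X; g \<in> free_alg_on X; h \<in> free_alg_on X;
     homogeneous p b f; homogeneous p b' g\<rbrakk> \<Longrightarrow>
    f \<star> (g \<star> h) - (f \<star> g) \<star> h - koszul_sign b b' \<cdot>\<^sub>F (g \<star> (f \<star> h)) \<in> lie_ideal X p Rel"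
| zero: "0 \<in> lie_ideal X p Rel"
| add: "f \<in> lie_ideal X p Rel \<Longrightarrow> g \<in> lie_ideal X p Rel \<Longrightarrow> f + g \<in> lie_ideal X p Rel"
| scale: "f \<in> lie_ideal X p Rel \<Longrightarrow> c \<cdot>\<^sub>F f \<in> lie_ideal X p Rel"
| mult_left: "f \<in> free_alg_on X \<Longrightarrow> g \<in> lie_ideal X p Rel \<Longrightarrow> f \<star> g \<in> lie_ideal X p Rel"
| mult_right: "f \<in> lie_ideal X p Rel \<Longrightarrow> g \<in> free_alg_on X \<Longrightarrow> f \<star> g \<in> lie_ideal X p Rel"

definition coset :: "'g free_alg set \<Rightarrow> 'g free_alg \<Rightarrow> 'g free_alg set" where
  "coset I f = {g. g - f \<in> I}"

text \<open>The quotient of the free algebra on \<open>X\<close> by this ideal, with the operations induced on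
  cosets (see the lemmas below): the Lie superalgebra with generators \<open>X\<close> of parity \<open>p\<close> and
  relations \<open>f = 0\<close> for \<open>f \<in> Rel\<close>.\<close>

definition presented ::
    "'g set \<Rightarrow> ('g \<Rightarrow> bool) \<Rightarrow> 'g free_alg set \<Rightarrow> ('g free_alg set, 'g) presented_superalgebra" where
  "presented X p Rel = (let I = lie_ideal X p Rel in
     \<lparr> sa_carrier = coset I ` free_alg_on X,
       sa_add = (\<lambda>A B. {h. \<exists>f\<in>A. \<exists>g\<in>B. h - (f + g) \<in> I}),
       sa_scale = (\<lambda>c A. {h. \<exists>f\<in>A. h - c \<cdot>\<^sub>F f \<in> I}),
       sa_bracket = (\<lambda>A B. {h. \<exists>f\<in>A. \<exists>g\<in>B. h - f \<star> g \<in> I}),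
       sa_part = (\<lambda>b. coset I ` {f \<in> free_alg_on X. homogeneous p b f}),
       sa_gen = (\<lambda>x. coset I (gen_elt x)) \<rparr>)"

lemma lookup_fscale [simp]: "Poly_Mapping.lookup (c \<cdot>\<^sub>F f) t = c * Poly_Mapping.lookup f t"
  by (simp add: fscale_def Poly_Mapping.map.rep_eq when_def)

lemma lookup_fmult [simp]:
  "Poly_Mapping.lookup (f \<star> g) t =
     (case t of Leaf _ \<Rightarrow> 0 | Br u v \<Rightarrow> Poly_Mapping.lookup f u * Poly_Mapping.lookup g v)"
  by (simp add: fmult.rep_eq)

lemma lie_ideal_diff:
  assumes "f \<in> lie_ideal X p Rel" "g \<in> lie_ideal X p Rel"
  shows "f - g \<in> lie_ideal X p Rel"
proof -
  have "f - g = f + (- 1) \<cdot>\<^sub>F g"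
    by (rule poly_mapping_eqI) (simp add: lookup_add lookup_minus)
  then show ?thesis
    using assms by (metis lie_ideal.add lie_ideal.scale)
qed

lemma coset_eq_iff:
  "coset (lie_ideal X p Rel) f = coset (lie_ideal X p Rel) g \<longleftrightarrow> f - g \<in> lie_ideal X p Rel"
proof
  assume "coset (lie_ideal X p Rel) f = coset (lie_ideal X p Rel) g"
  moreover have "f \<in> coset (lie_ideal X p Rel) f"
    by (simp add: coset_def lie_ideal.zero)
  ultimately show "f - g \<in> lie_ideal X p Rel"
    by (simp add: coset_def)
next
  assume fg: "f - g \<in> lie_ideal X p Rel"
  have "h - f \<in> lie_ideal X p Rel \<longleftrightarrow> h - g \<in> lie_ideal X p Rel" for h
    using lie_ideal.add[OF _ fg, of "h - f"] lie_ideal_diff[OF _ fg, of "h - g"] by auto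
  then show "coset (lie_ideal X p Rel) f = coset (lie_ideal X p Rel) g"
    by (simp add: coset_def)
qed

lemma free_alg_on_iff:
  "f \<in> free_alg_on X \<longleftrightarrow> (\<forall>t. Poly_Mapping.lookup f t \<noteq> 0 \<longrightarrow> leaves t \<subseteq> X)"
  by (auto simp: free_alg_on_def in_keys_iff)

lemma free_alg_on_add: "f \<in> free_alg_on X \<Longrightarrow> g \<in> free_alg_on X \<Longrightarrow> f + g \<in> free_alg_on X"
  by (auto simp: free_alg_on_iff lookup_add) (metis add_0 subsetD)

lemma free_alg_on_diff: "f \<in> free_alg_on X \<Longrightarrow> g \<in> free_alg_on X \<Longrightarrow> f - g \<in> free_alg_on X"
  by (auto simp: free_alg_on_iff lookup_minus) (metis subsetD)

lemma free_alg_on_scale: "f \<in> free_alg_on X \<Longrightarrow> c \<cdot>\<^sub>F f \<in> free_alg_on X"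
  by (auto simp: free_alg_on_iff)

lemma free_alg_on_mult: "f \<in> free_alg_on X \<Longrightarrow> g \<in> free_alg_on X \<Longrightarrow> f \<star> g \<in> free_alg_on X"
  by (auto simp: free_alg_on_iff split: magma.splits)

lemma lie_ideal_free:
  assumes "Rel \<subseteq> free_alg_on X" and "f \<in> lie_ideal X p Rel"
  shows "f \<in> free_alg_on X"
  using assms(2)
  by induction (use assms(1) in \<open>auto intro!: free_alg_on_add free_alg_on_diff free_alg_on_scale
      free_alg_on_mult simp: free_alg_on_iff[of 0]\<close>)

lemma presented_add_coset:
  "sa_add (presented X p Rel) (coset (lie_ideal X p Rel) f) (coset (lie_ideal X p Rel) g) =
     coset (lie_ideal X p Rel) (f + g)" (is "?L = ?R")
proof
  show "?R \<subseteq> ?L"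
    using lie_ideal.zero[of X p Rel]
    by (auto simp: presented_def Let_def coset_def) (metis cancel_comm_monoid_add_class.diff_cancel)
  show "?L \<subseteq> ?R"
  proof
    fix h assume "h \<in> ?L"
    then obtain f' g' where *: "f' - f \<in> lie_ideal X p Rel" "g' - g \<in> lie_ideal X p Rel"
        "h - (f' + g') \<in> lie_ideal X p Rel"
      by (auto simp: presented_def Let_def coset_def)
    have "h - (f + g) = (h - (f' + g')) + ((f' - f) + (g' - g))"
      by simp
    then show "h \<in> ?R"
      using * by (metis (mono_tags, lifting) coset_def lie_ideal.add mem_Collect_eq)
  qed
qed

lemma presented_scale_coset:
  "sa_scale (presented X p Rel) c (coset (lie_ideal X p Rel) f) =
     coset (lie_ideal X p Rel) (c \<cdot>\<^sub>F f)" (is "?L = ?R")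
proof
  show "?R \<subseteq> ?L"
    by (auto simp: presented_def Let_def coset_def lie_ideal.zero intro!: exI[of _ f])
  show "?L \<subseteq> ?R"
  proof
    fix h assume "h \<in> ?L"
    then obtain f' where *: "f' - f \<in> lie_ideal X p Rel" "h - c \<cdot>\<^sub>F f' \<in> lie_ideal X p Rel"
      by (auto simp: presented_def Let_def coset_def)
    have "h - c \<cdot>\<^sub>F f = (h - c \<cdot>\<^sub>F f') + c \<cdot>\<^sub>F (f' - f)"
      by (rule poly_mapping_eqI) (simp add: lookup_add lookup_minus algebra_simps)
    moreover have "c \<cdot>\<^sub>F (f' - f) \<in> lie_ideal X p Rel"
      using * by (rule_tac lie_ideal.scale)
    ultimately show "h \<in> ?R"
      using * by (metis (mono_tags, lifting) coset_def lie_ideal.add mem_Collect_eq)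
  qed
qed

lemma presented_bracket_coset:
  assumes f: "f \<in> free_alg_on X" and g: "g \<in> free_alg_on X"
    and Rel: "Rel \<subseteq> free_alg_on X"
  shows "sa_bracket (presented X p Rel) (coset (lie_ideal X p Rel) f) (coset (lie_ideal X p Rel) g) =
     coset (lie_ideal X p Rel) (f \<star> g)" (is "?L = ?R")
proof
  show "?R \<subseteq> ?L"
    using lie_ideal.zero[of X p Rel]
    by (auto simp: presented_def Let_def coset_def) (metis cancel_comm_monoid_add_class.diff_cancel)
  show "?L \<subseteq> ?R"
  proof
    fix h assume "h \<in> ?L"
    then obtain f' g' where *: "f' - f \<in> lie_ideal X p Rel" "g' - g \<in> lie_ideal X p Rel"
        "h - f' \<star> g' \<in> lie_ideal X p Rel"
      by (auto simp: presented_def Let_def coset_def)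
    have "g' \<in> free_alg_on X"
      using free_alg_on_add[OF lie_ideal_free[OF Rel *(2)] g] by simp
    have "h - f \<star> g = (h - f' \<star> g') + ((f' - f) \<star> g' + f \<star> (g' - g))"
      by (rule poly_mapping_eqI)
         (simp add: lookup_add lookup_minus algebra_simps split: magma.splits)
    moreover have "(f' - f) \<star> g' \<in> lie_ideal X p Rel" "f \<star> (g' - g) \<in> lie_ideal X p Rel"
      using * f \<open>g' \<in> free_alg_on X\<close> by (auto intro: lie_ideal.mult_left lie_ideal.mult_right)
    ultimately show "h \<in> ?R"
      using * by (metis (mono_tags, lifting) coset_def lie_ideal.add mem_Collect_eq)
  qed
qed

section \<open>The Lie superalgebra of a base system\<close>

datatype 'e generator = Gen_h 'e | Gen_E 'e

definition c_of :: "'e base_system \<Rightarrow> 'e \<Rightarrow> nat" where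
  "c_of D \<alpha> = (if e_g D \<alpha> = UNIV \<or> e_g D \<alpha> = {n. odd n} then 2 else 1)"

definition star :: "'e::ab_group_add base_system \<Rightarrow> 'e \<Rightarrow> 'e" where
  "star D \<alpha> = e_scale D (of_nat (c_of D \<alpha>)) \<alpha> + e_scale D (of_nat (e_k D \<alpha>)) (e_a D)"

definition B_plus :: "'e::ab_group_add base_system \<Rightarrow> 'e set" where
  "B_plus D = simple_roots D \<union> star D ` simple_roots D"

definition B_all :: "'e::ab_group_add base_system \<Rightarrow> 'e set" where
  "B_all D = B_plus D \<union> uminus ` B_plus D"

definition parity :: "'e::ab_group_add base_system \<Rightarrow> 'e generator \<Rightarrow> bool" where
  "parity D x = (case x of Gen_h _ \<Rightarrow> False | Gen_E \<mu> \<Rightarrow> e_scale D 2 \<mu> \<in> R_kg D)"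

definition generators :: "'e::ab_group_add base_system \<Rightarrow> 'e generator set" where
  "generators D = range Gen_h \<union> Gen_E ` B_all D"

definition A_triples :: "'e::ab_group_add base_system \<Rightarrow> ('e \<times> 'e \<times> nat) set" where
  "A_triples D = {(\<alpha>, \<beta>, y). \<alpha> \<in> simple_roots D \<and> \<beta> \<in> simple_roots D \<and> 1 \<le> y \<and> \<alpha> \<noteq> \<beta> \<and>
     e_form D \<alpha> (coroot D \<beta>) = - 1 \<and> e_k D \<alpha> * y = e_k D \<beta>}"

text \<open>The numbers \<open>J(\<mu>\<^sup>\<or>, \<nu>)\<close> with \<open>\<mu>, \<nu>\<close> in \<open>B_all D\<close> are integers when \<open>D\<close> is a quasi-elliptic base
  system, so nothing is lost by reading them off as \<open>\<lfloor>Re _\<rfloor>\<close>.\<close>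

definition serre_exponent :: "'e base_system \<Rightarrow> 'e \<Rightarrow> 'e \<Rightarrow> nat" where
  "serre_exponent D \<mu> \<nu> = (let m = \<lfloor>Re (e_form D (coroot D \<mu>) \<nu>)\<rfloor> in
     if m < 0 then nat (1 - m) else 1)"

abbreviation gh :: "'e \<Rightarrow> 'e generator free_alg" where "gh \<sigma> \<equiv> gen_elt (Gen_h \<sigma>)"
abbreviation gE :: "'e \<Rightarrow> 'e generator free_alg" where "gE \<mu> \<equiv> gen_elt (Gen_E \<mu>)"

definition ad_pow :: "'g free_alg \<Rightarrow> nat \<Rightarrow> 'g free_alg \<Rightarrow> 'g free_alg" where
  "ad_pow f n g = ((\<star>) f ^^ n) g"

definition common_relators :: "'e::ab_group_add base_system \<Rightarrow> 'e generator free_alg set" where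
  "common_relators D =
     {x \<cdot>\<^sub>F gh \<sigma> + y \<cdot>\<^sub>F gh \<tau> - gh (e_scale D x \<sigma> + e_scale D y \<tau>) | x y \<sigma> \<tau>. True} \<union>
     {gh \<sigma> \<star> gh \<tau> | \<sigma> \<tau>. True} \<union>
     {gh \<sigma> \<star> gE \<mu> - e_form D \<sigma> \<mu> \<cdot>\<^sub>F gE \<mu> | \<sigma> \<mu>. \<mu> \<in> B_all D} \<union>
     {gE \<mu> \<star> gE (- \<mu>) - gh (coroot D \<mu>) | \<mu>. \<mu> \<in> B_plus D} \<union>
     {ad_pow (gE \<mu>) (serre_exponent D \<mu> \<nu>) (gE \<nu>) | \<mu> \<nu>.
        \<mu> \<in> B_all D \<and> \<nu> \<in> B_all D \<and> \<mu> \<noteq> \<nu> \<and> \<mu> + \<nu> \<noteq> 0} \<union>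
     {ad_pow (gE \<alpha>) i (ad_pow (gE (star D \<alpha>)) (y - i) (gE \<beta>)) | \<alpha> \<beta> y i.
        (\<alpha>, \<beta>, y) \<in> A_triples D \<and> 1 \<le> i \<and> i < y} \<union>
     {ad_pow (gE (- \<alpha>)) i (ad_pow (gE (- star D \<alpha>)) (y - i) (gE (- \<beta>))) | \<alpha> \<beta> y i.
        (\<alpha>, \<beta>, y) \<in> A_triples D \<and> 1 \<le> i \<and> i < y}"

definition linking_relators ::
    "'e::ab_group_add base_system \<Rightarrow> ('e \<times> 'e \<times> nat) set \<Rightarrow> 'e generator free_alg set" where
  "linking_relators D S =
     {of_nat (c_of D \<alpha>) \<cdot>\<^sub>F ad_pow (gE (star D \<alpha>)) y (gE \<beta>)
        - ad_pow (gE \<alpha>) (c_of D \<alpha> * y) (gE (star D \<beta>)) | \<alpha> \<beta> y. (\<alpha>, \<beta>, y) \<in> S} \<union>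
     {((- 1) ^ (c_of D \<alpha> + 1) * of_nat (c_of D \<alpha>)) \<cdot>\<^sub>F ad_pow (gE (- star D \<alpha>)) y (gE (- \<beta>))
        - ad_pow (gE (- \<alpha>)) (c_of D \<alpha> * y) (gE (- star D \<beta>)) | \<alpha> \<beta> y. (\<alpha>, \<beta>, y) \<in> S}"

definition g_alg ::
    "'e::ab_group_add base_system \<Rightarrow> ('e generator free_alg set, 'e generator) presented_superalgebra"
  where
  "g_alg D = presented (generators D) (parity D)
     (common_relators D \<union> linking_relators D (A_triples D))"

definition gq_alg ::
    "'e::ab_group_add base_system \<Rightarrow> complex \<Rightarrow>
     ('e generator free_alg set, 'e generator) presented_superalgebra" where
  "gq_alg D q =
     (let \<alpha>0 = e_simple D 0; \<alpha>l = e_simple D (e_rank D) in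
      presented (generators D) (parity D)
        (common_relators D \<union>
         linking_relators D (A_triples D - {(\<alpha>0, \<alpha>l, 1), (\<alpha>l, \<alpha>0, 1)}) \<union>
         {q \<cdot>\<^sub>F (gE (star D \<alpha>0) \<star> gE \<alpha>l) - gE \<alpha>0 \<star> gE (star D \<alpha>l),
          inverse q \<cdot>\<^sub>F (gE (- star D \<alpha>0) \<star> gE (- \<alpha>l)) - gE (- \<alpha>0) \<star> gE (- star D \<alpha>l)}))"

definition weight_space ::
    "'e base_system \<Rightarrow> ('x, 'e generator) presented_superalgebra \<Rightarrow> 'e \<Rightarrow> 'x set" where
  "weight_space D G \<mu> =
     {x \<in> sa_carrier G. \<forall>\<sigma>. sa_bracket G (sa_gen G (Gen_h \<sigma>)) x = sa_scale G (e_form D \<sigma> \<mu>) x}"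

section \<open>Extended affine Lie algebras\<close>

text \<open>The Lie algebra is the whole type \<^typ>\<open>'l\<close>.\<close>

record 'l lie_triple =
  l_scale :: "complex \<Rightarrow> 'l \<Rightarrow> 'l"
  l_bracket :: "'l \<Rightarrow> 'l \<Rightarrow> 'l"
  l_form :: "'l \<Rightarrow> 'l \<Rightarrow> complex"
  l_cartan :: "'l set"

definition lie_algebra :: "(complex \<Rightarrow> 'l \<Rightarrow> 'l) \<Rightarrow> ('l::ab_group_add \<Rightarrow> 'l \<Rightarrow> 'l) \<Rightarrow> bool" where
  "lie_algebra sc br \<longleftrightarrow>
     vector_space sc \<and>
     (\<forall>x. Vector_Spaces.linear sc sc (br x)) \<and>
     (\<forall>y. Vector_Spaces.linear sc sc (\<lambda>x. br x y)) \<and>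
     (\<forall>x. br x x = 0) \<and>
     (\<forall>x y z. br x (br y z) + br y (br z x) + br z (br x y) = 0)"

definition purely_even :: "'l::ab_group_add lie_triple \<Rightarrow> 'l lie_superalgebra" where
  "purely_even L = \<lparr> sa_carrier = UNIV, sa_add = plus, sa_scale = l_scale L,
     sa_bracket = l_bracket L, sa_part = (\<lambda>b. if b then {0} else UNIV) \<rparr>"

text \<open>Linear functionals on the Cartan subalgebra, represented as functions on \<^typ>\<open>'l\<close> that vanish
  outside it.\<close>

definition cartan_dual :: "'l::ab_group_add lie_triple \<Rightarrow> ('l \<Rightarrow> complex) set" where
  "cartan_dual L = {\<alpha>.
     (\<forall>x. x \<notin> l_cartan L \<longrightarrow> \<alpha> x = 0) \<and>
     (\<forall>x\<in>l_cartan L. \<forall>y\<in>l_cartan L. \<alpha> (x + y) = \<alpha> x + \<alpha> y) \<and>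
     (\<forall>c. \<forall>x\<in>l_cartan L. \<alpha> (l_scale L c x) = c * \<alpha> x)}"

definition root_space :: "'l lie_triple \<Rightarrow> ('l \<Rightarrow> complex) \<Rightarrow> 'l set" where
  "root_space L \<alpha> = {x. \<forall>h\<in>l_cartan L. l_bracket L h x = l_scale L (\<alpha> h) x}"

definition eala_roots :: "'l::ab_group_add lie_triple \<Rightarrow> ('l \<Rightarrow> complex) set" where
  "eala_roots L = {\<alpha> \<in> cartan_dual L. root_space L \<alpha> \<noteq> {0}}"

definition t_vec :: "'l lie_triple \<Rightarrow> ('l \<Rightarrow> complex) \<Rightarrow> 'l" where
  "t_vec L \<alpha> = (THE t. t \<in> l_cartan L \<and> (\<forall>h\<in>l_cartan L. l_form L t h = \<alpha> h))"

definition dual_form :: "'l lie_triple \<Rightarrow> ('l \<Rightarrow> complex) \<Rightarrow> ('l \<Rightarrow> complex) \<Rightarrow> complex" where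
  "dual_form L \<alpha> \<beta> = l_form L (t_vec L \<alpha>) (t_vec L \<beta>)"

definition nonisotropic_roots :: "'l::ab_group_add lie_triple \<Rightarrow> ('l \<Rightarrow> complex) set" where
  "nonisotropic_roots L = {\<alpha> \<in> eala_roots L. dual_form L \<alpha> \<alpha> \<noteq> 0}"

definition isotropic_roots :: "'l::ab_group_add lie_triple \<Rightarrow> ('l \<Rightarrow> complex) set" where
  "isotropic_roots L = {\<alpha> \<in> eala_roots L. dual_form L \<alpha> \<alpha> = 0}"

text \<open>Discreteness refers to the topology of pointwise convergence on \<^typ>\<open>'l \<Rightarrow> complex\<close>; on
  \<open>cartan_dual L\<close>, whose members vanish outside the finite-dimensional Cartan subalgebra, it is the
  usual vector space topology.\<close>

definition eala :: "'l::ab_group_add lie_triple \<Rightarrow> bool" where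
  "eala L \<longleftrightarrow>
     (let sc = l_scale L; br = l_bracket L; B = l_form L; H = l_cartan L in
        lie_algebra sc br \<and>
        symmetric_bilinear sc B \<and> nondegenerate B \<and> (\<forall>x y z. B (br x y) z = B x (br y z)) \<and>
        module.subspace sc H \<and> H \<noteq> {0} \<and> (\<exists>S. finite S \<and> module.span sc S = H) \<and>
        (\<forall>h\<in>H. \<forall>h'\<in>H. br h h' = 0) \<and>
        (\<forall>h\<in>H. module.span sc {x. \<exists>c. br h x = sc c x} = UNIV) \<and>
        {x. \<forall>h\<in>H. br h x = 0} = H \<and>
        (\<forall>\<alpha>\<in>nonisotropic_roots L. \<forall>x\<in>root_space L \<alpha>. \<forall>y. \<exists>n. (br x ^^ n) y = 0) \<and>
        discrete (eala_roots L) \<and>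
        \<not> (\<exists>R1 R2. R1 \<noteq> {} \<and> R2 \<noteq> {} \<and> nonisotropic_roots L = R1 \<union> R2 \<and>
              (\<forall>\<alpha>\<in>R1. \<forall>\<beta>\<in>R2. dual_form L \<alpha> \<beta> = 0)) \<and>
        (\<forall>\<sigma>\<in>isotropic_roots L. \<exists>\<alpha>\<in>nonisotropic_roots L.
              (\<lambda>h. \<alpha> h + \<sigma> h) \<in> eala_roots L))"

definition isometric_monomorphism ::
    "'e::ab_group_add base_system \<Rightarrow> 'l::ab_group_add lie_triple \<Rightarrow> ('e \<Rightarrow> 'l \<Rightarrow> complex) \<Rightarrow> bool" where
  "isometric_monomorphism D L \<phi> \<longleftrightarrow>
     range \<phi> \<subseteq> cartan_dual L \<and>
     (\<forall>x y h. \<phi> (x + y) h = \<phi> x h + \<phi> y h) \<and>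
     (\<forall>c x h. \<phi> (e_scale D c x) h = c * \<phi> x h) \<and>
     inj \<phi> \<and>
     (\<forall>x y. dual_form L (\<phi> x) (\<phi> y) = e_form D x y)"

end

theory Submission
  imports Defs
begin

text \<open>The homomorphism sends \<open>h\<^sub>\<sigma>\<close> to \<open>t\<^sub>\<phi>\<^sub>(\<^sub>\<sigma>\<^sub>)\<close> and \<open>E\<^sub>\<mu>\<close> to a suitably scaled root vector, and nearly
  everything about it follows from the representation theory of sl2. Let \<open>\<mu>\<close> correspond to a
  nonisotropic root. The form pairs the root spaces of \<open>\<mu>\<close> and \<open>- \<mu>\<close> nondegenerately, so \<open>\<mu>\<close> gives an
  sl2-triple \<open>(e, f, t)\<close> in which \<open>e\<close> and \<open>f\<close> act locally nilpotently. Injectivity of powers of \<open>e\<close> on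
  negative weight spaces (\<open>sl2_raise_inj\<close>) then shows that the root space of \<open>\<mu>\<close> is a line
  (\<open>real_root_space_one_dim\<close>), that \<open>2 \<mu>\<close> is not a root (\<open>RS_double_zero\<close>) and that reflections are
  effected by powers of \<open>e\<close> or \<open>f\<close> (\<open>reflected_weight_vector\<close>). In particular no generator is odd, so
  signs never matter.

  The Serre relations and the relations on \<open>(ad E\<^sub>\<alpha>)\<^sup>i (ad E\<^sub>\<alpha>\<^sub>*)\<^sup>y\<^sup>-\<^sup>i E\<^sub>\<beta>\<close> hold for any choice of root
  vectors, because the weights in question are not roots. This is a fact about \<open>R(k, g)\<close>
  (\<open>base_difference_not_root\<close>, \<open>serre_inner_not_root\<close>). What is needed of the positivity of affine roots
  is only that no root is, up to a multiple of \<open>a\<close>, a combination of two simple roots with coefficients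
  of opposite signs; since
  a root has integral coordinates both in the root lattice and, after passing to coroots, in the coroot
  lattice, such a combination would have too large a norm (\<open>mixed_not_in_orbit\<close>).

  The two sides of a linking relation are nonzero vectors of one root line, so they differ by a factor,
  and comparing pairings under the form shows that the same factor governs the relation for the negative
  roots (\<open>link_ratio\<close>). Rescaling the vectors \<open>E\<^sub>\<alpha>\<^sub>*\<close> removes these factors along any tree of bonds
  (\<open>normalised_family_exists\<close>). Every affine diagram of rank at least two is a tree except the cycle of
  type \<open>A\<^sub>l\<^sup>(\<^sup>1\<^sup>)\<close>, where the factor of one bond survives as \<open>q\<close>.

  Finally, \<open>R(k, g)\<close> is generated from \<open>\<Pi> \<union> \<Pi>\<^sup>*\<close> by the reflections in \<open>\<Pi> \<union> \<Pi>\<^sup>*\<close> (\<open>R_kg_induct\<close>), and these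
  reflections are effected inside the image, so the image contains every root space of a root in
  \<open>R(k, g)\<close> (\<open>root_space_generated\<close>). Conversely, the image of a weight space of weight \<open>\<mu>\<close> lies in the
  root space of \<open>\<mu>\<close> although the \<open>t\<^sub>\<phi>\<^sub>(\<^sub>\<sigma>\<^sub>)\<close> need not span the Cartan subalgebra, because the image is a sum
  of root spaces with weights in \<open>\<phi>(\<E>)\<close> (\<open>weight_vector_in_root_space\<close>).\<close>

section \<open>Complex Lie algebras and sl2-triples\<close>

locale complex_lie_algebra =
  fixes sc :: "complex \<Rightarrow> 'l::ab_group_add \<Rightarrow> 'l" (infixr "*L" 75)
    and br :: "'l \<Rightarrow> 'l \<Rightarrow> 'l"
  assumes lie_algebra: "lie_algebra sc br"
begin

sublocale vector_space sc
  using lie_algebra by (simp add: lie_algebra_def)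

lemma br_linear_right: "Vector_Spaces.linear sc sc (br x)"
  using lie_algebra by (simp add: lie_algebra_def)

lemma br_linear_left: "Vector_Spaces.linear sc sc (\<lambda>x. br x y)"
  using lie_algebra by (simp add: lie_algebra_def)

lemma br_add: "br x (y + z) = br x y + br x z" "br (x + y) z = br x z + br y z"
  using br_linear_right[of x] br_linear_left[of z] by (simp_all add: Vector_Spaces.linear_iff)

lemma br_scale: "br x (c *L y) = c *L br x y" "br (c *L x) y = c *L br x y"
  using br_linear_right[of x] br_linear_left[of y] by (simp_all add: Vector_Spaces.linear_iff)

lemma br_zero [simp]: "br x 0 = 0" "br 0 x = 0"
  using br_scale(1)[of x 0 0] br_scale(2)[of 0 0 x] by simp_all

lemma br_minus: "br x (- y) = - br x y" "br (- x) y = - br x y"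
  using br_scale(1)[of x "-1" y] br_scale(2)[of "-1" x y] by simp_all

lemma br_diff: "br x (y - z) = br x y - br x z" "br (x - y) z = br x z - br y z"
  using br_add(1)[of x y "- z"] br_add(2)[of x "- y" z] by (simp_all add: br_minus)

lemma br_sum: "br x (sum f A) = (\<Sum>a\<in>A. br x (f a))"
  by (induction A rule: infinite_finite_induct) (simp_all add: br_add)

lemma br_self [simp]: "br x x = 0"
  using lie_algebra by (simp add: lie_algebra_def)

lemma br_anticommute: "br x y = - br y x"
proof -
  have "br (x + y) (x + y) = br x y + br y x"
    by (simp add: br_add del: br_self) simp
  then show ?thesis
    by (simp add: eq_neg_iff_add_eq_0)
qed

lemma br_jacobi: "br x (br y z) = br (br x y) z + br y (br x z)"
proof -
  have "br x (br y z) + br y (br z x) + br z (br x y) = 0"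
    using lie_algebra by (simp add: lie_algebra_def)
  then have "br x (br y z) = - br z (br x y) - br y (br z x)"
    by (simp add: algebra_simps eq_neg_iff_add_eq_0)
  also have "\<dots> = br (br x y) z + br y (br x z)"
    using br_anticommute[of z "br x y"] br_anticommute[of z x] by (simp add: br_minus)
  finally show ?thesis .
qed

lemma br_funpow_scale: "(br x ^^ n) (c *L y) = c *L (br x ^^ n) y"
  by (induction n) (simp_all add: br_scale)

lemma br_funpow_scale_left: "(br (c *L x) ^^ n) y = c ^ n *L (br x ^^ n) y"
  by (induction n) (simp_all add: br_scale)

lemma br_funpow_diff: "(br x ^^ n) (y - z) = (br x ^^ n) y - (br x ^^ n) z"
  by (induction n) (simp_all add: br_diff)

definition sl2_triple :: "'l \<Rightarrow> 'l \<Rightarrow> 'l \<Rightarrow> bool" where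
  "sl2_triple e f h \<longleftrightarrow> br e f = h \<and> br h e = 2 *L e \<and> br h f = (- 2) *L f"

lemma sl2_triple_swap: "sl2_triple e f h \<Longrightarrow> sl2_triple f e (- h)"
  using br_anticommute[of f e] by (simp add: sl2_triple_def br_minus)

lemma sl2_weight_raise:
  assumes "sl2_triple e f h" "br h v = \<omega> *L v"
  shows "br h ((br e ^^ n) v) = (\<omega> + 2 * of_nat n) *L (br e ^^ n) v"
proof (induction n)
  case (Suc n)
  have "br h (br e ((br e ^^ n) v)) = br (br h e) ((br e ^^ n) v) + br e (br h ((br e ^^ n) v))"
    by (rule br_jacobi)
  also have "\<dots> = (2 + (\<omega> + 2 * of_nat n)) *L br e ((br e ^^ n) v)"
    using assms(1) Suc unfolding sl2_triple_def by (simp only: br_scale br_add scale_left_distrib)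
  finally show ?case
    by (simp add: algebra_simps)
qed (use assms in simp)

lemma sl2_weight_lower:
  assumes "sl2_triple e f h" "br h v = \<omega> *L v"
  shows "br h ((br f ^^ n) v) = (\<omega> - 2 * of_nat n) *L (br f ^^ n) v"
  using sl2_weight_raise[OF sl2_triple_swap[OF assms(1)], of v "- \<omega>" n] assms(2)
  by (simp add: br_minus) (metis add.inverse_inverse minus_diff_eq scale_minus_left uminus_add_conv_diff)

text \<open>The case \<open>c = 0\<close> covers highest weight vectors; the general case is for the eigenvectors of
  \<open>f e\<close> that occur in the proof of \<open>sl2_raise_inj\<close>.\<close>

lemma sl2_raise_lower:
  assumes triple: "sl2_triple e f h" and weight: "br h v = \<omega> *L v"
    and eigen: "br f (br e v) = c *L v"
  shows "br e ((br f ^^ Suc n) v) =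
    (c + of_nat (Suc n) * (\<omega> - of_nat n)) *L (br f ^^ n) v"
proof (induction n)
  case 0
  have "br e (br f v) = h' + br f (br e v)" if "h' = br (br e f) v" for h'
    using br_jacobi[of e f v] that by simp
  then show ?case
    using triple weight eigen by (simp add: sl2_triple_def scale_left_distrib add.commute)
next
  case (Suc n)
  let ?v = "(br f ^^ Suc n) v"
  have "br e (br f ?v) = br (br e f) ?v + br f (br e ?v)"
    by (rule br_jacobi)
  also have "br (br e f) ?v = (\<omega> - 2 * of_nat (Suc n)) *L ?v"
    using triple sl2_weight_lower[OF triple weight] unfolding sl2_triple_def by metis
  also have "br f (br e ?v) = (c + of_nat (Suc n) * (\<omega> - of_nat n)) *L ?v"
    using Suc by (simp add: br_scale)
  also have "(\<omega> - 2 * of_nat (Suc n)) *L ?v + (c + of_nat (Suc n) * (\<omega> - of_nat n)) *L ?v =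
      (c + of_nat (Suc (Suc n)) * (\<omega> - of_nat (Suc n))) *L ?v"
    unfolding scale_left_distrib[symmetric] by (simp add: algebra_simps)
  finally show ?case
    by simp
qed

text \<open>Since \<open>e f\<^sup>m\<^sup>+\<^sup>1 v\<close> is \<open>(m + 1) (\<omega> - m) f\<^sup>m v\<close>, the first vanishing power of \<open>f\<close> determines the
  weight.\<close>

lemma sl2_highest_weight:
  assumes triple: "sl2_triple e f h" and weight: "br h v = \<omega> *L v" and "br e v = 0"
    and "v \<noteq> 0" and nil: "\<exists>n. (br f ^^ n) v = 0"
  obtains m :: nat where "\<omega> = of_nat m" "(br f ^^ Suc m) v = 0"
    "\<And>n. n \<le> m \<Longrightarrow> (br f ^^ n) v \<noteq> 0"
proof -
  define N where "N = (LEAST n. (br f ^^ n) v = 0)"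
  have N: "(br f ^^ N) v = 0"
    unfolding N_def using nil by (rule LeastI_ex)
  have below: "(br f ^^ n) v \<noteq> 0" if "n < N" for n
    using that not_less_Least unfolding N_def by blast
  have "N \<noteq> 0"
    using N \<open>v \<noteq> 0\<close> by (metis funpow_0)
  then obtain m where m: "N = Suc m"
    by (metis not0_implies_Suc)
  have "(0 + of_nat (Suc m) * (\<omega> - of_nat m)) *L (br f ^^ m) v = 0"
    using sl2_raise_lower[OF triple weight, of 0 m] N assms(3) by (simp add: m)
  then have "\<omega> = of_nat m"
    using below[of m] by (auto simp: m simp del: of_nat_Suc)
  with that N below show ?thesis
    by (simp add: m)
qed

lemma sl2_raise_power_lower:
  assumes triple: "sl2_triple e f h" and weight: "br h v = \<omega> *L v"
  shows "(br e ^^ p) (br f v) =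
    br f ((br e ^^ p) v) + (of_nat p * (\<omega> + of_nat p - 1)) *L (br e ^^ (p - 1)) v"
proof (induction p)
  case (Suc p)
  let ?x = "(br e ^^ p) v"
  have swap: "br e (br f ?x) = (\<omega> + 2 * of_nat p) *L ?x + br f (br e ?x)"
    using br_jacobi[of e f ?x] sl2_weight_raise[OF triple weight, of p] triple
    unfolding sl2_triple_def by metis
  have "(br e ^^ Suc p) (br f v) =
      br e (br f ?x) + (of_nat p * (\<omega> + of_nat p - 1)) *L br e ((br e ^^ (p - 1)) v)"
    using Suc by (simp add: br_add br_scale)
  also have "(of_nat p * (\<omega> + of_nat p - 1)) *L br e ((br e ^^ (p - 1)) v) =
      (of_nat p * (\<omega> + of_nat p - 1)) *L ?x"
    by (cases p) simp_all
  also have "br e (br f ?x) + \<dots> = br f (br e ?x) +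
      (\<omega> + 2 * of_nat p + of_nat p * (\<omega> + of_nat p - 1)) *L ?x"
    unfolding swap scale_left_distrib by (simp add: add_ac)
  also have "\<omega> + 2 * of_nat p + of_nat p * (\<omega> + of_nat p - 1) =
      of_nat (Suc p) * (\<omega> + of_nat (Suc p) - 1)"
    by (simp add: algebra_simps)
  finally show ?case
    by simp
qed simp

text \<open>If \<open>e\<^sup>p\<^sup>+\<^sup>1 v = 0\<close>, then a suitable \<open>f e v - c v\<close> is killed by \<open>e\<^sup>p\<close>, hence zero by induction;
  so \<open>v\<close> is an eigenvector of \<open>f e\<close>, and \<open>e f\<^sup>n\<^sup>+\<^sup>1 v\<close> is a strictly negative multiple of \<open>f\<^sup>n v\<close> for every
  \<open>n\<close>, which the nilpotency of \<open>f\<close> allows only for \<open>v = 0\<close>.\<close>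

lemma sl2_raise_inj:
  assumes triple: "sl2_triple e f h"
    and nil: "\<And>v. \<exists>n. (br f ^^ n) v = 0"
  shows "br h v = (- of_nat m) *L v \<Longrightarrow> (br e ^^ p) v = 0 \<Longrightarrow> p \<le> m \<Longrightarrow> v = 0"
proof (induction p arbitrary: v)
  case (Suc p)
  \<comment> \<open>The eigenvalue for which moving \<open>f\<close> past \<open>e\<^sup>p\<close> in \<open>e\<^sup>p f e v\<close> leaves \<open>c e\<^sup>p v\<close>; as \<open>p < m\<close>, it is
    not positive.\<close>
  define c where "c = real p * (real p + 1 - real m)"
  define u where "u = br f (br e v) - of_real c *L v"
  have ev: "br h (br e v) = (2 - of_nat m) *L br e v"
    using sl2_weight_raise[OF triple Suc.prems(1), of 1] by simp
  have "br h (br f (br e v)) = (- of_nat m) *L br f (br e v)"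
    using sl2_weight_lower[OF triple ev, of 1] by simp
  then have weight: "br h u = (- of_nat m) *L u"
    using Suc.prems(1) by (simp add: u_def br_diff br_scale scale_right_diff_distrib)
  have "(br e ^^ p) (br f (br e v)) =
      br f ((br e ^^ Suc p) v) + of_real c *L (br e ^^ (p - 1)) (br e v)"
    unfolding sl2_raise_power_lower[OF triple ev] c_def
    by (simp add: funpow_swap1 algebra_simps)
  also have "of_real c *L (br e ^^ (p - 1)) (br e v) = of_real c *L (br e ^^ p) v"
    by (cases p) (simp_all add: c_def funpow_swap1)
  finally have "(br e ^^ p) u = 0"
    using Suc.prems(2) by (simp add: u_def br_funpow_diff br_funpow_scale)
  then have "u = 0"
    using Suc.IH weight Suc.prems(3) by simp
  then have eigen: "br f (br e v) = of_real c *L v"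
    by (simp add: u_def)
  have neg: "c + real (Suc n) * (- real m - real n) < 0" for n
  proof -
    have "c \<le> 0" "real (Suc n) * (- real m - real n) < 0"
      using Suc.prems(3) unfolding c_def
      by (auto intro!: mult_nonneg_nonpos mult_pos_neg)
    then show ?thesis
      by simp
  qed
  have "(br f ^^ n) v = 0 \<Longrightarrow> v = 0" for n
  proof (induction n)
    case (Suc n)
    have "of_real c + of_nat (Suc n) * (- of_nat m - of_nat n) =
        (of_real (c + real (Suc n) * (- real m - real n)) :: complex)"
      by simp
    then have "of_real (c + real (Suc n) * (- real m - real n)) *L (br f ^^ n) v = 0"
      using sl2_raise_lower[OF triple \<open>br h v = (- of_nat m) *L v\<close> eigen, of n] Suc.prems
      by simp
    then show ?case
      using neg[of n] Suc.IH by (auto simp del: of_real_add of_real_mult)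
  qed simp
  then show ?case
    using nil by blast
qed simp

end

section \<open>The invariant form of an extended affine Lie algebra\<close>

locale extended_affine_lie_algebra =
  fixes L :: "'l::ab_group_add lie_triple"
  assumes eala: "eala L"
begin

abbreviation L_scale (infixr "*L" 75) where "c *L x \<equiv> l_scale L c x"
abbreviation "br \<equiv> l_bracket L"
abbreviation "\<B> \<equiv> l_form L"
abbreviation "\<H> \<equiv> l_cartan L"

sublocale complex_lie_algebra "l_scale L" "l_bracket L"
  using eala by unfold_locales (simp add: eala_def Let_def)

lemma form_sym: "\<B> x y = \<B> y x"
  using eala by (simp add: eala_def Let_def symmetric_bilinear_def)

lemma form_linear: "Vector_Spaces.linear (l_scale L) (*) (\<B> x)"
  using eala by (simp add: eala_def Let_def symmetric_bilinear_def)

lemma form_add: "\<B> x (y + z) = \<B> x y + \<B> x z" "\<B> (y + z) x = \<B> y x + \<B> z x"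
  using form_linear[of x] form_sym[of _ x] by (simp_all add: Vector_Spaces.linear_iff)

lemma form_scale: "\<B> x (c *L y) = c * \<B> x y" "\<B> (c *L y) x = c * \<B> y x"
  using form_linear[of x] form_sym[of _ x] by (simp_all add: Vector_Spaces.linear_iff)

lemma form_zero [simp]: "\<B> x 0 = 0" "\<B> 0 x = 0"
  using form_scale(1)[of x 0 0] form_scale(2)[of 0 0 x] by simp_all

lemma form_minus: "\<B> x (- y) = - \<B> x y" "\<B> (- y) x = - \<B> y x"
  using form_scale(1)[of x "- 1" y] form_scale(2)[of "- 1" y x] by simp_all

lemma form_diff: "\<B> x (y - z) = \<B> x y - \<B> x z" "\<B> (y - z) x = \<B> y x - \<B> z x"
  using form_add(1)[of x y "- z"] form_add(2)[of y "- z" x] by (simp_all add: form_minus)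

lemma form_invariant: "\<B> (br x y) z = \<B> x (br y z)"
  using eala by (simp add: eala_def Let_def)

lemma form_invariant_left: "\<B> (br x y) z = - \<B> y (br x z)"
  using form_invariant[of y x z] br_anticommute[of x y] by (simp add: form_minus)

lemma form_funpow: "\<B> ((br x ^^ n) y) z = (- 1) ^ n * \<B> y ((br x ^^ n) z)"
proof (induction n arbitrary: z)
  case (Suc n)
  then show ?case
    by (simp add: form_invariant_left) (simp add: funpow_swap1)
qed simp

lemma form_nondegenerate: "(\<And>y. \<B> x y = 0) \<Longrightarrow> x = 0"
  using eala by (simp add: eala_def Let_def nondegenerate_def)

lemma cartan_subspace: "subspace \<H>"
  using eala by (simp add: eala_def Let_def)

lemma cartan_span: obtains S where "finite S" "span S = \<H>"
  using eala by (auto simp: eala_def Let_def)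

lemma cartan_centralizer: "{x. \<forall>h\<in>\<H>. br h x = 0} = \<H>"
  using eala by (simp add: eala_def Let_def)

lemma cartan_commute: "h \<in> \<H> \<Longrightarrow> h' \<in> \<H> \<Longrightarrow> br h h' = 0"
  using cartan_centralizer by auto

lemma root_space_subspace: "subspace (root_space L \<alpha>)"
  by (auto simp: subspace_def root_space_def br_add br_scale scale_right_distrib mult.commute)

lemma cartan_eigenvector_sum:
  assumes "h \<in> \<H>"
  obtains C g where "finite C" "\<And>c. c \<in> C \<Longrightarrow> br h (g c) = c *L g c" "y = sum g C"
proof -
  have "y \<in> span {x. \<exists>c. br h x = c *L x}"
    using assms eala by (simp add: eala_def Let_def)
  then have "\<exists>C g. finite C \<and> (\<forall>c\<in>C. br h (g c) = c *L g c) \<and> y = sum g C"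
  proof (induction rule: span_induct_alt)
    case base
    show ?case
      by (rule exI[of _ "{}"]) simp
  next
    case (step r x z)
    then obtain c C g where c: "br h x = c *L x"
      and C: "finite C" "\<forall>c\<in>C. br h (g c) = c *L g c" "z = sum g C"
      by blast
    define g' where "g' = (\<lambda>d. (if d \<in> C then g d else 0) + (if d = c then r *L x else 0))"
    have "sum g' (insert c C) = (\<Sum>d\<in>insert c C. if d \<in> C then g d else 0) + r *L x"
      using C(1) by (simp add: g'_def sum.distrib)
    also have "(\<Sum>d\<in>insert c C. if d \<in> C then g d else 0) = sum g C"
      using C(1) by (intro sum.mono_neutral_cong_right) auto
    finally have "r *L x + z = sum g' (insert c C)"
      using C(3) by (simp add: add.commute)
    moreover have "\<forall>d\<in>insert c C. br h (g' d) = d *L g' d"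
      using C(2) c by (auto simp: g'_def br_add br_scale scale_right_distrib mult.commute)
    ultimately show ?case
      using C(1) by blast
  qed
  then show ?thesis
    using that by blast
qed

text \<open>The conditions on \<open>y\<close> that cut out the weight space opposite to that of \<open>x\<close> are imposed for one
  element of a spanning set of \<open>\<H>\<close> after the other. Each time \<open>y\<close> is a sum of eigenvectors, and those
  with the wrong eigenvalue are orthogonal to \<open>x\<close>.\<close>

lemma opposite_root_space_pairing:
  assumes dual: "\<alpha> \<in> cartan_dual L" and x: "x \<in> root_space L \<alpha>"
    and orth: "\<And>y. y \<in> root_space L (\<lambda>h. - \<alpha> h) \<Longrightarrow> \<B> x y = 0"
  shows "x = 0"
proof -
  obtain S where S: "finite S" "span S = \<H>"
    by (rule cartan_span)
  have in_H: "s \<in> \<H>" if "s \<in> S" for s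
    using S(2) span_base that by blast
  have eigen_all: "y \<in> root_space L (\<lambda>h. - \<alpha> h)"
    if y: "\<And>s. s \<in> S \<Longrightarrow> br s y = (- \<alpha> s) *L y" for y
  proof -
    have "h \<in> \<H> \<and> br h y = (- \<alpha> h) *L y" if "h \<in> span S" for h
      using that
    proof (induction rule: span_induct_alt)
      case base
      have "\<alpha> (0 *L 0) = 0 * \<alpha> 0"
        using dual subspace_0[OF cartan_subspace] unfolding cartan_dual_def by blast
      then show ?case
        using subspace_0[OF cartan_subspace] by simp
    next
      case (step c s h)
      have "\<alpha> (c *L s + h) = c * \<alpha> s + \<alpha> h"
        using dual step in_H[of s] subspace_scale[OF cartan_subspace, of s c]
        unfolding cartan_dual_def by simp
      moreover have "c *L s + h \<in> \<H>"
        using step in_H cartan_subspace by (simp add: subspace_add subspace_scale)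
      ultimately show ?case
        using step y[of s]
        by (simp add: br_add br_scale scale_left_distrib[symmetric] del: scale_minus_left)
    qed
    then show ?thesis
      unfolding root_space_def using S(2) by blast
  qed
  \<comment> \<open>The vectors that satisfy the conditions for \<open>S - T\<close>. The claim for \<open>K T\<close> is proved by induction
    on \<open>T\<close>, that is, by giving up one condition after the other.\<close>
  define K where "K T = {y. \<forall>s\<in>S - T. br s y = (- \<alpha> s) *L y}" for T
  have split: "\<B> x y = 0"
    if s: "s \<in> S" and IH: "\<And>y. y \<in> K T \<Longrightarrow> \<B> x y = 0"
      and "finite C" "- \<alpha> s \<notin> C" "br s y0 = (- \<alpha> s) *L y0"
        "\<And>c. c \<in> C \<Longrightarrow> br s (g c) = c *L g c" "y = y0 + sum g C" "y \<in> K (insert s T)"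
    for T s C g y y0
    using that(3-)
  proof (induction C arbitrary: y y0 g rule: finite_induct)
    case empty
    then have "y \<in> K T"
      by (auto simp: K_def)
    then show ?case
      by (rule IH)
  next
    case (insert c C)
    \<comment> \<open>Applying \<open>ad s - c\<close> removes the eigenvector for \<open>c\<close> from \<open>y\<close> and multiplies \<open>\<B> x y\<close> by the
      nonzero number \<open>- \<alpha> s - c\<close>.\<close>
    define y' where "y' = br s y - c *L y"
    define y0' where "y0' = (- \<alpha> s - c) *L y0"
    define g' where "g' d = (d - c) *L g d" for d
    have "br s y = br s y0 + (br s (g c) + (\<Sum>d\<in>C. br s (g d)))"
      using insert.hyps insert.prems(4) by (simp add: br_add br_sum)
    also have "(\<Sum>d\<in>C. br s (g d)) = (\<Sum>d\<in>C. d *L g d)"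
      using insert.prems(3) by (intro sum.cong) auto
    finally have "y' = (- \<alpha> s *L y0 - c *L y0) + ((\<Sum>d\<in>C. d *L g d) - (\<Sum>d\<in>C. c *L g d))"
      using insert.hyps insert.prems
      by (simp add: y'_def scale_right_distrib scale_sum_right algebra_simps)
    then have "y' = y0' + sum g' C"
      by (simp add: y0'_def g'_def[abs_def] scale_left_diff_distrib sum_subtractf)
    moreover have "br s y0' = (- \<alpha> s) *L y0'"
      using insert.prems(2) by (simp add: y0'_def br_scale mult.commute)
    moreover have "br s (g' d) = d *L g' d" if "d \<in> C" for d
      using insert.prems(3) that by (simp add: g'_def br_scale mult.commute)
    moreover have "y' \<in> K (insert s T)"
      unfolding K_def
    proof (intro CollectI ballI)
      fix t assume "t \<in> S - insert s T"
      then have t: "t \<in> S" "t \<notin> insert s T"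
        by auto
      have "br t (br s y) = br s (br t y)"
        using br_jacobi[of t s y] cartan_commute[OF in_H[OF t(1)] in_H[OF s]] by simp
      then show "br t y' = (- \<alpha> t) *L y'"
        using insert.prems(5) t
        by (simp add: y'_def K_def br_diff br_scale scale_right_diff_distrib br_minus mult.commute)
    qed
    ultimately have "\<B> x y' = 0"
      using insert.IH insert.prems(1) by (metis insertCI)
    moreover have "\<B> x (br s y) = - \<alpha> s * \<B> x y"
      using form_invariant_left[of s x y] x in_H[OF s] by (simp add: root_space_def form_scale)
    ultimately have "(- \<alpha> s - c) * \<B> x y = 0"
      by (simp add: y'_def form_diff form_scale algebra_simps)
    moreover have "- \<alpha> s - c \<noteq> 0"
      using insert.prems(1) by auto
    ultimately show ?case
      by simp
  qed
  have "\<B> x y = 0" if "finite T" "T \<subseteq> S" "y \<in> K T" for T y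
    using that
  proof (induction T arbitrary: y rule: finite_induct)
    case empty
    then show ?case
      using orth eigen_all by (simp add: K_def)
  next
    case (insert s T)
    have s: "s \<in> S"
      using insert.prems by simp
    obtain C g where C: "finite C" "\<And>c. c \<in> C \<Longrightarrow> br s (g c) = c *L g c" "y = sum g C"
      using cartan_eigenvector_sum[OF in_H[OF s]] by metis
    define y0 where "y0 = (if - \<alpha> s \<in> C then g (- \<alpha> s) else 0)"
    have "y = y0 + sum g (C - {- \<alpha> s})"
      using C(1,3) by (simp add: y0_def sum.remove)
    moreover have "br s y0 = (- \<alpha> s) *L y0"
      using C(2) by (simp add: y0_def del: scale_minus_left)
    ultimately show ?case
      using split[of s T "C - {- \<alpha> s}" y0 g y] C insert s by auto
  qed
  then show ?thesis
    using S(1) by (intro form_nondegenerate) (auto simp: K_def)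
qed

lemma cartan_form_nondegenerate:
  assumes "h \<in> \<H>" "\<And>h'. h' \<in> \<H> \<Longrightarrow> \<B> h h' = 0"
  shows "h = 0"
proof (rule opposite_root_space_pairing)
  show "(\<lambda>_. 0) \<in> cartan_dual L"
    by (simp add: cartan_dual_def)
  show "h \<in> root_space L (\<lambda>_. 0)"
    using assms(1) by (simp add: root_space_def cartan_commute)
  show "\<B> h y = 0" if "y \<in> root_space L (\<lambda>_. - 0)" for y
    using assms(2) cartan_centralizer that by (auto simp: root_space_def)
qed

text \<open>On the kernel of \<open>\<B> s\<close> the induction hypothesis applies, and the difference is a multiple of
  \<open>\<B> s\<close>. This provides Riesz vectors without any count of dimensions.\<close>

lemma functional_in_span:
  assumes "finite S" "subspace K"
    and "\<And>x y. x \<in> K \<Longrightarrow> y \<in> K \<Longrightarrow> f (x + y) = f x + f y"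
    and "\<And>c x. x \<in> K \<Longrightarrow> f (c *L x) = c * f x"
    and "\<And>x. x \<in> K \<Longrightarrow> (\<And>s. s \<in> S \<Longrightarrow> \<B> s x = 0) \<Longrightarrow> f x = 0"
  shows "\<exists>t\<in>span S. \<forall>x\<in>K. \<B> t x = f x"
  using assms
proof (induction S arbitrary: K rule: finite_induct)
  case empty
  then show ?case
    by (auto intro!: bexI[of _ 0])
next
  case (insert s S)
  define K' where "K' = {x\<in>K. \<B> s x = 0}"
  have "subspace K'"
    using insert.prems(1) by (auto simp: K'_def subspace_def form_add form_scale)
  then have "\<exists>t\<in>span S. \<forall>x\<in>K'. \<B> t x = f x"
  proof (rule insert.IH)
    show "f x = 0" if "x \<in> K'" "\<And>s. s \<in> S \<Longrightarrow> \<B> s x = 0" for x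
      using insert.prems(4)[of x] that by (auto simp: K'_def)
  qed (use insert.prems(2,3) in \<open>auto simp: K'_def\<close>)
  then obtain t where t: "t \<in> span S" "\<And>x. x \<in> K \<Longrightarrow> \<B> s x = 0 \<Longrightarrow> \<B> t x = f x"
    by (auto simp: K'_def)
  have t': "t \<in> span (insert s S)"
    using t(1) span_mono[of S "insert s S"] by auto
  show ?case
  proof (cases "\<forall>x\<in>K. \<B> s x = 0")
    case True
    with t t' show ?thesis
      by auto
  next
    case False
    then obtain z where z: "z \<in> K" "\<B> s z \<noteq> 0"
      by blast
    define c where "c = (f z - \<B> t z) / \<B> s z"
    have "\<B> (t + c *L s) x = f x" if x: "x \<in> K" for x
    proof -
      define r where "r = - (\<B> s x / \<B> s z)"
      have rz: "r *L z \<in> K"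
        using insert.prems(1) z by (simp add: subspace_scale)
      have "x + r *L z \<in> K"
        using insert.prems(1) x rz by (simp add: subspace_add)
      moreover have "\<B> s (x + r *L z) = 0"
        using z by (simp add: form_diff form_scale r_def)
      ultimately have "\<B> t (x + r *L z) = f (x + r *L z)"
        by (rule t(2))
      then have "\<B> t x + r * \<B> t z = f x + r * f z"
        using insert.prems(2)[OF x rz] insert.prems(3)[OF z(1)] by (simp add: form_add form_scale)
      then show ?thesis
        using z by (simp add: form_add form_scale c_def r_def divide_simps) (simp add: algebra_simps)
    qed
    moreover have "t + c *L s \<in> span (insert s S)"
      using t' by (intro span_add span_scale) (auto intro: span_base)
    ultimately show ?thesis
      by blast
  qed
qed

lemma t_vec_unique:
  assumes "\<alpha> \<in> cartan_dual L"
  shows "\<exists>!t. t \<in> \<H> \<and> (\<forall>h\<in>\<H>. \<B> t h = \<alpha> h)"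
proof -
  obtain S where S: "finite S" "span S = \<H>"
    by (rule cartan_span)
  have "h = 0" if h: "h \<in> \<H>" "\<And>s. s \<in> S \<Longrightarrow> \<B> s h = 0" for h
  proof (rule cartan_form_nondegenerate[OF h(1)])
    fix h' assume "h' \<in> \<H>"
    then have "h' \<in> span S"
      by (simp add: S)
    then have "\<B> h' h = 0"
      by (induction rule: span_induct_alt) (simp_all add: form_add form_scale h(2))
    then show "\<B> h h' = 0"
      by (simp add: form_sym)
  qed
  moreover have "\<alpha> 0 = 0"
    using assms subspace_0[OF cartan_subspace] unfolding cartan_dual_def
    by (metis (mono_tags, lifting) mem_Collect_eq mult_zero_left scale_zero_left)
  ultimately obtain t where "t \<in> \<H>" "\<forall>h\<in>\<H>. \<B> t h = \<alpha> h"
    using functional_in_span[OF S(1) cartan_subspace, of \<alpha>] assms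
    unfolding cartan_dual_def S(2) by blast
  moreover have "t = t'"
    if "t \<in> \<H>" "\<forall>h\<in>\<H>. \<B> t h = \<alpha> h" "t' \<in> \<H>" "\<forall>h\<in>\<H>. \<B> t' h = \<alpha> h" for t t'
    using cartan_form_nondegenerate[of "t - t'"] that subspace_diff[OF cartan_subspace]
    by (auto simp: form_diff)
  ultimately show ?thesis
    by blast
qed

lemma t_vec_cartan: "\<alpha> \<in> cartan_dual L \<Longrightarrow> t_vec L \<alpha> \<in> \<H>"
  and t_vec_form: "\<alpha> \<in> cartan_dual L \<Longrightarrow> h \<in> \<H> \<Longrightarrow> \<B> (t_vec L \<alpha>) h = \<alpha> h"
  using theI'[OF t_vec_unique] unfolding t_vec_def by auto

lemma t_vec_eqI:
  "\<alpha> \<in> cartan_dual L \<Longrightarrow> t \<in> \<H> \<Longrightarrow> (\<And>h. h \<in> \<H> \<Longrightarrow> \<B> t h = \<alpha> h) \<Longrightarrow> t_vec L \<alpha> = t"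
  using t_vec_unique t_vec_cartan t_vec_form by metis

lemma root_space_bracket:
  assumes "x \<in> root_space L \<alpha>" "y \<in> root_space L \<beta>"
  shows "br x y \<in> root_space L (\<lambda>h. \<alpha> h + \<beta> h)"
  using assms unfolding root_space_def
  by (auto simp: br_jacobi[of _ x y] br_scale scale_left_distrib)

text \<open>The bracket centralises \<open>\<H>\<close>, so it lies in \<open>\<H>\<close>, where its pairings with \<open>\<H>\<close> determine it.\<close>

lemma opposite_bracket:
  assumes dual: "\<alpha> \<in> cartan_dual L" and x: "x \<in> root_space L \<alpha>"
    and y: "y \<in> root_space L (\<lambda>h. - \<alpha> h)"
  shows "br x y = \<B> x y *L t_vec L \<alpha>"
proof -
  have "br x y \<in> \<H>"
    using root_space_bracket[OF x y] cartan_centralizer by (auto simp: root_space_def)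
  moreover have "\<B> (br x y) h = \<B> (\<B> x y *L t_vec L \<alpha>) h" if "h \<in> \<H>" for h
    using x y that t_vec_form[OF dual that] form_invariant[of x y h] br_anticommute[of y h]
    by (simp add: root_space_def form_scale)
  ultimately show ?thesis
    using cartan_form_nondegenerate[of "br x y - \<B> x y *L t_vec L \<alpha>"] t_vec_cartan[OF dual]
      subspace_diff[OF cartan_subspace] subspace_scale[OF cartan_subspace]
    by (auto simp: form_diff)
qed

lemma ad_locally_nilpotent:
  "\<alpha> \<in> nonisotropic_roots L \<Longrightarrow> x \<in> root_space L \<alpha> \<Longrightarrow> \<exists>n. (br x ^^ n) y = 0"
  using eala by (simp add: eala_def Let_def)

end

section \<open>Root spaces attached to vectors of the base system\<close>

locale bilinear_base =
  fixes D :: "'e::ab_group_add base_system"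
  assumes E_space: "vector_space (e_scale D)"
    and E_form: "symmetric_bilinear (e_scale D) (e_form D)"
begin

abbreviation E_scale (infixr "*E" 75) where "c *E x \<equiv> e_scale D c x"
abbreviation "J \<equiv> e_form D"

sublocale E: vector_space "e_scale D"
  by (rule E_space)

lemma J_sym: "J x y = J y x"
  using E_form by (simp add: symmetric_bilinear_def)

lemma J_linear: "Vector_Spaces.linear (e_scale D) (*) (J x)"
  using E_form by (simp add: symmetric_bilinear_def)

lemma J_add: "J x (y + z) = J x y + J x z" "J (y + z) x = J y x + J z x"
  using J_linear[of x] J_sym[of _ x] by (simp_all add: Vector_Spaces.linear_iff)

lemma J_scale: "J x (c *E y) = c * J x y" "J (c *E y) x = c * J y x"
  using J_linear[of x] J_sym[of _ x] by (simp_all add: Vector_Spaces.linear_iff)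

lemma J_zero [simp]: "J x 0 = 0" "J 0 x = 0"
  using J_scale(1)[of x 0 0] J_scale(2)[of 0 0 x] by simp_all

lemma J_minus: "J x (- y) = - J x y" "J (- y) x = - J y x"
  using J_scale(1)[of x "- 1" y] J_scale(2)[of "- 1" y x] by simp_all

lemma J_diff: "J x (y - z) = J x y - J x z" "J (y - z) x = J y x - J z x"
  using J_add(1)[of x y "- z"] J_add(2)[of y "- z" x] by (simp_all add: J_minus)

lemma J_sum: "J x (sum f A) = (\<Sum>a\<in>A. J x (f a))"
  by (induction A rule: infinite_finite_induct) (simp_all add: J_add)

lemma J_coroot: "J (coroot D x) y = 2 * J x y / J x x" "J y (coroot D x) = 2 * J x y / J x x"
  using J_sym[of y x] by (simp_all add: coroot_def J_scale)

lemma coroot_minus: "coroot D (- x) = - coroot D x"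
  by (simp add: coroot_def J_minus)

end

locale eala_weights = extended_affine_lie_algebra L + bilinear_base D
  for L :: "'l::ab_group_add lie_triple" and D :: "'e::ab_group_add base_system" +
  fixes \<phi> :: "'e \<Rightarrow> 'l \<Rightarrow> complex"
  assumes isometric: "isometric_monomorphism D L \<phi>"
begin

abbreviation "RS \<mu> \<equiv> root_space L (\<phi> \<mu>)"
abbreviation "T \<sigma> \<equiv> t_vec L (\<phi> \<sigma>)"

lemma phi_dual: "\<phi> x \<in> cartan_dual L"
  using isometric by (auto simp: isometric_monomorphism_def)

lemma phi_add: "\<phi> (x + y) = (\<lambda>h. \<phi> x h + \<phi> y h)"
  using isometric by (auto simp: isometric_monomorphism_def)

lemma phi_scale: "\<phi> (c *E x) = (\<lambda>h. c * \<phi> x h)"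
  using isometric by (auto simp: isometric_monomorphism_def)

lemma phi_zero: "\<phi> 0 = (\<lambda>h. 0)"
  using phi_scale[of 0 0] by simp

lemma phi_minus: "\<phi> (- x) = (\<lambda>h. - \<phi> x h)"
  using phi_scale[of "- 1" x] by simp

lemma phi_inj: "inj \<phi>"
  using isometric by (simp add: isometric_monomorphism_def)

lemma RS_zero: "RS 0 = \<H>"
  using cartan_centralizer by (simp add: root_space_def phi_zero)

lemma zero_in_RS [simp]: "0 \<in> RS \<mu>"
  using subspace_0[OF root_space_subspace] .

lemma RS_scale: "x \<in> RS \<mu> \<Longrightarrow> c *L x \<in> RS \<mu>"
  using subspace_scale[OF root_space_subspace] .

lemma RS_bracket: "x \<in> RS \<mu> \<Longrightarrow> y \<in> RS \<nu> \<Longrightarrow> br x y \<in> RS (\<mu> + \<nu>)"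
  using root_space_bracket by (simp add: phi_add)

lemma RS_funpow:
  assumes "x \<in> RS \<mu>" "y \<in> RS \<nu>"
  shows "(br x ^^ n) y \<in> RS (of_nat n *E \<mu> + \<nu>)"
proof (induction n)
  case (Suc n)
  then have "br x ((br x ^^ n) y) \<in> RS (\<mu> + (of_nat n *E \<mu> + \<nu>))"
    by (rule RS_bracket[OF assms(1)])
  then show ?case
    by (simp add: E.scale_left_distrib add.assoc)
qed (use assms in simp)

lemma T_cartan: "T \<sigma> \<in> \<H>"
  by (rule t_vec_cartan[OF phi_dual])

lemma phi_T: "\<phi> \<mu> (T \<sigma>) = J \<sigma> \<mu>"
  using t_vec_form[OF phi_dual T_cartan, of \<mu> \<sigma>] isometric J_sym[of \<sigma> \<mu>]
  by (simp add: isometric_monomorphism_def dual_form_def)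

lemma T_bracket: "x \<in> RS \<mu> \<Longrightarrow> br (T \<sigma>) x = J \<sigma> \<mu> *L x"
  using T_cartan[of \<sigma>] by (simp add: root_space_def phi_T)

lemma T_linear: "T (a *E \<sigma> + b *E \<tau>) = a *L T \<sigma> + b *L T \<tau>"
proof (rule t_vec_eqI[OF phi_dual])
  show "a *L T \<sigma> + b *L T \<tau> \<in> \<H>"
    using T_cartan cartan_subspace by (simp add: subspace_add subspace_scale)
qed (simp add: form_add form_scale t_vec_form[OF phi_dual] phi_add phi_scale)

lemma T_scale: "T (a *E \<sigma>) = a *L T \<sigma>"
  using T_linear[of a \<sigma> 0 0] by simp

lemma RS_pairing:
  assumes "x \<in> RS \<mu>" "x \<noteq> 0"
  obtains y where "y \<in> RS (- \<mu>)" "\<B> x y = c"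
proof -
  obtain y where "y \<in> RS (- \<mu>)" "\<B> x y \<noteq> 0"
    using opposite_root_space_pairing[OF phi_dual assms(1)] assms(2) by (auto simp: phi_minus)
  then show ?thesis
    using that[of "(c / \<B> x y) *L y"] by (simp add: form_scale RS_scale)
qed

text \<open>This value of the form makes \<open>e\<close>, \<open>f\<close> and the vector of the coroot of \<open>\<mu>\<close> an sl2-triple.\<close>

definition chevalley_pair :: "'e \<Rightarrow> 'l \<Rightarrow> 'l \<Rightarrow> bool" where
  "chevalley_pair \<mu> e f \<longleftrightarrow>
     J \<mu> \<mu> \<noteq> 0 \<and> e \<in> RS \<mu> \<and> f \<in> RS (- \<mu>) \<and> \<B> e f = 2 / J \<mu> \<mu>"

lemma chevalley_pair_swap: "chevalley_pair \<mu> e f \<Longrightarrow> chevalley_pair (- \<mu>) f e"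
  by (simp add: chevalley_pair_def J_minus form_sym)

lemma chevalley_pair_scale:
  "chevalley_pair \<mu> e f \<Longrightarrow> c \<noteq> 0 \<Longrightarrow> chevalley_pair \<mu> (c *L e) (inverse c *L f)"
  by (simp add: chevalley_pair_def form_scale RS_scale)

lemma chevalley_pair_sl2:
  assumes "chevalley_pair \<mu> e f"
  shows "sl2_triple e f (T (coroot D \<mu>))"
proof -
  have "br e f = T (coroot D \<mu>)"
    using assms opposite_bracket[OF phi_dual, of e \<mu> f]
    by (simp add: chevalley_pair_def phi_minus coroot_def T_scale)
  then show ?thesis
    using assms T_bracket[of e \<mu> "coroot D \<mu>"] T_bracket[of f "- \<mu>" "coroot D \<mu>"]
    by (simp add: sl2_triple_def chevalley_pair_def J_coroot J_minus)
qed

text \<open>Equivalently, \<open>\<phi>\<close> maps \<open>\<mu>\<close> to a nonisotropic root.\<close>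

definition real_root :: "'e \<Rightarrow> bool" where
  "real_root \<mu> \<longleftrightarrow> J \<mu> \<mu> \<noteq> 0 \<and> RS \<mu> \<noteq> {0}"

lemma real_root_iff: "real_root \<mu> \<longleftrightarrow> \<phi> \<mu> \<in> nonisotropic_roots L"
  using isometric phi_dual[of \<mu>]
  by (auto simp: real_root_def nonisotropic_roots_def eala_roots_def isometric_monomorphism_def)

lemma real_root_nonzero: "real_root \<mu> \<Longrightarrow> \<exists>x\<in>RS \<mu>. x \<noteq> 0"
  unfolding real_root_def using zero_in_RS[of \<mu>] by blast

lemma real_rootI: "J \<mu> \<mu> \<noteq> 0 \<Longrightarrow> x \<in> RS \<mu> \<Longrightarrow> x \<noteq> 0 \<Longrightarrow> real_root \<mu>"
  by (auto simp: real_root_def)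

lemma chevalley_pair_nonzero: "chevalley_pair \<mu> e f \<Longrightarrow> e \<noteq> 0 \<and> f \<noteq> 0"
  by (auto simp: chevalley_pair_def)

lemma chevalley_pair_exists:
  assumes "real_root \<mu>"
  obtains e f where "chevalley_pair \<mu> e f"
proof -
  obtain e where e: "e \<in> RS \<mu>" "e \<noteq> 0"
    using real_root_nonzero[OF assms] by blast
  obtain f where "f \<in> RS (- \<mu>)" "\<B> e f = 2 / J \<mu> \<mu>"
    using RS_pairing[OF e] .
  then show ?thesis
    using that e assms by (auto simp: chevalley_pair_def real_root_def)
qed

lemma chevalley_pair_real_root: "chevalley_pair \<mu> e f \<Longrightarrow> real_root \<mu>"
  using chevalley_pair_nonzero[of \<mu> e f] by (auto simp: chevalley_pair_def intro: real_rootI)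

lemma real_root_minus: "real_root \<mu> \<Longrightarrow> real_root (- \<mu>)"
  by (meson chevalley_pair_exists chevalley_pair_swap chevalley_pair_real_root)

lemma chevalley_pair_nilpotent:
  assumes "chevalley_pair \<mu> e f"
  shows "\<exists>n. (br e ^^ n) v = 0" "\<exists>n. (br f ^^ n) v = 0"
proof -
  have "real_root \<mu>" "real_root (- \<mu>)"
    using assms chevalley_pair_real_root chevalley_pair_swap by blast+
  then show "\<exists>n. (br e ^^ n) v = 0" "\<exists>n. (br f ^^ n) v = 0"
    using ad_locally_nilpotent assms unfolding real_root_iff chevalley_pair_def by blast+
qed

lemma chevalley_pair_weight:
  "v \<in> RS \<nu> \<Longrightarrow> br (T (coroot D \<mu>)) v = J (coroot D \<mu>) \<nu> *L v"
  by (rule T_bracket)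

text \<open>If \<open>x\<close> and \<open>e\<close> both have weight \<open>\<mu>\<close>, then \<open>f\<close> kills some \<open>x - c e\<close>; a vector of weight \<open>2\<close>
  killed by \<open>f\<close> vanishes.\<close>

lemma real_root_space_one_dim:
  assumes "real_root \<mu>" "e \<in> RS \<mu>" "e \<noteq> 0" "x \<in> RS \<mu>"
  obtains c where "x = c *L e"
proof -
  have J: "J \<mu> \<mu> \<noteq> 0"
    using assms(1) by (simp add: real_root_def)
  obtain f where f: "f \<in> RS (- \<mu>)" "\<B> e f = 2 / J \<mu> \<mu>"
    using RS_pairing[OF assms(2,3)] .
  then have pair: "chevalley_pair \<mu> e f"
    using assms(2) J by (simp add: chevalley_pair_def)
  define c where "c = \<B> x f / \<B> e f"
  define z where "z = x - c *L e"
  have z: "z \<in> RS \<mu>"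
    unfolding z_def using assms(2,4) root_space_subspace by (simp add: subspace_diff subspace_scale)
  have "\<B> z f = 0"
    using f J by (simp add: z_def c_def form_diff form_scale)
  then have "br f z = 0"
    using opposite_bracket[OF phi_dual z, of f] f br_anticommute[of f z] by (simp add: phi_minus)
  moreover have "br (- T (coroot D \<mu>)) z = (- of_nat 2) *L z"
    using chevalley_pair_weight[OF z, of \<mu>] J by (simp add: J_coroot br_minus)
  ultimately have "z = 0"
    using sl2_raise_inj[OF sl2_triple_swap[OF chevalley_pair_sl2[OF pair]], of z 2 1]
      chevalley_pair_nilpotent(1)[OF pair] by simp
  then show ?thesis
    using that[of c] by (simp add: z_def)
qed

text \<open>A vector of weight \<open>- 2 \<mu>\<close> is carried by \<open>e\<close> into the line of \<open>f\<close>, hence is killed by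
  \<open>e\<^sup>4\<close>; as \<open>e\<^sup>4\<close> is injective on weight \<open>- 4\<close>, it is zero. So a Lie algebra has no real root that
  would be odd in a superalgebra.\<close>

lemma RS_double_zero:
  assumes "real_root \<mu>"
  shows "RS (2 *E \<mu>) = {0}"
proof -
  have "x = 0" if x: "x \<in> RS (2 *E \<mu>)" for x
  proof -
    obtain f e where pair: "chevalley_pair (- \<mu>) e f"
      using chevalley_pair_exists[OF real_root_minus[OF assms]] by metis
    have f: "f \<in> RS \<mu>" "f \<noteq> 0" and e: "e \<in> RS (- \<mu>)"
      using pair chevalley_pair_nonzero[OF pair] by (auto simp: chevalley_pair_def)
    have "br e x \<in> RS (- \<mu> + 2 *E \<mu>)"
      by (rule RS_bracket[OF e x])
    moreover have "- \<mu> + 2 *E \<mu> = \<mu>"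
      using E.scale_left_distrib[of 1 1 \<mu>] by simp
    ultimately obtain c where "br e x = c *L f"
      using real_root_space_one_dim[OF assms f] by metis
    then have "(br e ^^ 4) x = c *L br e (br e (br e f))"
      by (simp add: numeral_eq_Suc br_scale)
    also have "br e (br e f) = - 2 *L e"
      using chevalley_pair_sl2[OF pair] br_anticommute[of e "br e f"]
      by (simp add: sl2_triple_def)
    finally have "(br e ^^ 4) x = 0"
      by (simp add: br_minus br_scale)
    moreover have "br (T (coroot D (- \<mu>))) x = (- of_nat 4) *L x"
      using chevalley_pair_weight[OF x, of "- \<mu>"] assms
      by (simp add: J_coroot J_minus J_scale real_root_def)
    ultimately show ?thesis
      using sl2_raise_inj[OF chevalley_pair_sl2[OF pair], of x 4 4]
        chevalley_pair_nilpotent(2)[OF pair] by simp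
  qed
  then show ?thesis
    using zero_in_RS[of "2 *E \<mu>"] by blast
qed

text \<open>As \<open>\<nu> - \<mu>\<close> is not a weight, \<open>v\<close> is a lowest weight vector for the triple.\<close>

lemma root_string:
  assumes pair: "chevalley_pair \<mu> e f" and v: "v \<in> RS \<nu>" "v \<noteq> 0" and "RS (\<nu> - \<mu>) = {0}"
  obtains m :: nat where "J (coroot D \<mu>) \<nu> = - of_nat m" "(br e ^^ Suc m) v = 0"
proof -
  have "br f v \<in> RS (- \<mu> + \<nu>)"
    using RS_bracket[of f "- \<mu>" v \<nu>] pair v(1) by (simp add: chevalley_pair_def)
  then have fv: "br f v = 0"
    using assms(4) by simp
  have "br (- T (coroot D \<mu>)) v = (- J (coroot D \<mu>) \<nu>) *L v"
    using chevalley_pair_weight[OF v(1)] by (simp add: br_minus)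
  with sl2_highest_weight[OF sl2_triple_swap[OF chevalley_pair_sl2[OF pair]] this fv v(2)]
  obtain m :: nat where "- J (coroot D \<mu>) \<nu> = of_nat m" "(br e ^^ Suc m) v = 0"
    using chevalley_pair_nilpotent(1)[OF pair] by metis
  then show ?thesis
    using that[of m] by (simp add: minus_equation_iff)
qed

text \<open>By injectivity, \<open>f\<^sup>n v\<close> or \<open>e\<^sup>n v\<close> is not zero for the weight \<open>n\<close> or \<open>- n\<close> of \<open>v\<close>; it has the
  reflected weight.\<close>

lemma reflected_weight_vector:
  assumes pair: "chevalley_pair \<mu> e f" and v: "v \<in> RS \<nu>" "v \<noteq> 0"
  obtains n g where "g = e \<or> g = f" "(br g ^^ n) v \<in> RS (reflection D \<mu> \<nu>)" "(br g ^^ n) v \<noteq> 0"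
proof -
  define r where "r = J (coroot D \<mu>) \<nu>"
  note triple = chevalley_pair_sl2[OF pair]
  note nil = chevalley_pair_nilpotent[OF pair]
  have weight: "br (T (coroot D \<mu>)) v = r *L v"
    using chevalley_pair_weight[OF v(1)] by (simp add: r_def)
  \<comment> \<open>The last nonzero \<open>e\<^sup>k v\<close> is a highest weight vector, so the weight \<open>r\<close> of \<open>v\<close> is an integer.\<close>
  define N where "N = (LEAST n. (br e ^^ n) v = 0)"
  have N: "(br e ^^ N) v = 0"
    unfolding N_def using nil(1) by (rule LeastI_ex)
  then have "N \<noteq> 0"
    using v(2) by (metis funpow_0)
  then obtain k where k: "N = Suc k"
    by (metis not0_implies_Suc)
  have top: "(br e ^^ k) v \<noteq> 0"
    using not_less_Least[of k "\<lambda>n. (br e ^^ n) v = 0"] by (simp add: N_def[symmetric] k)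
  have "br e ((br e ^^ k) v) = 0"
    using N by (simp add: k)
  from sl2_highest_weight[OF triple sl2_weight_raise[OF triple weight] this top nil(2)]
  obtain m :: nat where "r + 2 * of_nat k = of_nat m"
    by metis
  then have r: "r = of_int (int m - 2 * int k)"
    by (simp add: eq_diff_eq)
  show ?thesis
  proof (cases "2 * k \<le> m")
    case True
    have r: "r = of_nat (m - 2 * k)"
      using True by (simp add: r of_nat_diff)
    have "(br f ^^ (m - 2 * k)) v \<noteq> 0"
      using sl2_raise_inj[OF sl2_triple_swap[OF triple] nil(1), of v "m - 2 * k" "m - 2 * k"]
        weight v(2) r by (auto simp: br_minus)
    moreover have "(br f ^^ (m - 2 * k)) v \<in> RS (of_nat (m - 2 * k) *E (- \<mu>) + \<nu>)"
      using pair v(1) by (intro RS_funpow) (simp_all add: chevalley_pair_def)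
    moreover have "of_nat (m - 2 * k) *E (- \<mu>) + \<nu> = reflection D \<mu> \<nu>"
      using r by (simp add: reflection_def r_def[symmetric])
    ultimately show ?thesis
      using that[of f "m - 2 * k"] by simp
  next
    case False
    have r: "r = - of_nat (2 * k - m)"
      using False by (simp add: r of_nat_diff)
    have "(br e ^^ (2 * k - m)) v \<noteq> 0"
      using sl2_raise_inj[OF triple nil(2), of v "2 * k - m" "2 * k - m"]
        weight v(2) r by auto
    moreover have "(br e ^^ (2 * k - m)) v \<in> RS (of_nat (2 * k - m) *E \<mu> + \<nu>)"
      using pair v(1) by (intro RS_funpow) (simp_all add: chevalley_pair_def)
    moreover have "of_nat (2 * k - m) *E \<mu> + \<nu> = reflection D \<mu> \<nu>"
      using r by (simp add: reflection_def r_def[symmetric])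
    ultimately show ?thesis
      using that[of e "2 * k - m"] by simp
  qed
qed

text \<open>Invariance moves the operators \<open>ad e\<close> from \<open>v\<close> to \<open>f\<^sup>n u\<close>, where they lead back to a multiple of
  the highest weight vector \<open>u\<close>.\<close>

lemma string_pairing:
  assumes pair: "chevalley_pair \<mu> e f" and u: "u \<in> RS (- \<nu>)" "br e u = 0"
    and m: "J (coroot D \<mu>) \<nu> = - of_nat m"
  shows "\<B> ((br e ^^ n) v) ((br f ^^ n) u) =
    (- 1) ^ n * (\<Prod>i<n. of_nat (Suc i) * (of_nat m - of_nat i)) * \<B> v u"
proof -
  have weight: "br (T (coroot D \<mu>)) u = of_nat m *L u"
    using chevalley_pair_weight[OF u(1), of \<mu>] m by (simp add: J_minus)
  have "(br e ^^ n) ((br f ^^ n) u) = (\<Prod>i<n. of_nat (Suc i) * (of_nat m - of_nat i)) *L u"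
  proof (induction n)
    case (Suc n)
    have "br e ((br f ^^ Suc n) u) = (of_nat (Suc n) * (of_nat m - of_nat n)) *L (br f ^^ n) u"
      using sl2_raise_lower[OF chevalley_pair_sl2[OF pair] weight, of 0 n] u(2) by simp
    then have "(br e ^^ Suc n) ((br f ^^ Suc n) u) =
        (of_nat (Suc n) * (of_nat m - of_nat n)) *L (br e ^^ n) ((br f ^^ n) u)"
      by (simp only: funpow_Suc_right o_def br_funpow_scale)
    then show ?case
      using Suc by (simp add: mult.commute)
  qed simp
  then show ?thesis
    by (simp add: form_funpow form_scale)
qed

text \<open>The \<open>T \<sigma>\<close> need not exhaust \<open>\<H>\<close>, so having the weight \<open>\<mu>\<close> under all of them is in general weaker
  than lying in the root space. Within a sum of root spaces of weights \<open>\<nu>\<close> it suffices, because \<open>J\<close>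
  separates these weights.\<close>

lemma weight_vector_in_root_space:
  assumes nondeg: "nondegenerate J"
    and "finite N" "\<And>\<nu>. \<nu> \<in> N \<Longrightarrow> X \<nu> \<in> RS \<nu>"
    and "\<And>\<sigma>. br (T \<sigma>) (sum X N) = J \<sigma> \<mu> *L sum X N"
  shows "sum X N \<in> RS \<mu>"
  using assms(2-)
proof (induction "card N" arbitrary: N X)
  case 0
  then show ?case
    by simp
next
  case (Suc n)
  show ?case
  proof (cases "N = {\<mu>}")
    case True
    then show ?thesis
      using Suc.prems by simp
  next
    case False
    moreover have "N \<noteq> {}"
      using Suc.hyps(2) by auto
    ultimately obtain \<nu> where \<nu>: "\<nu> \<in> N" "\<nu> \<noteq> \<mu>"
      by blast
    obtain \<sigma> where "J \<sigma> (\<mu> - \<nu>) \<noteq> 0"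
      using nondeg \<nu>(2) unfolding nondegenerate_def by (metis J_sym right_minus_eq)
    then have \<sigma>: "J \<sigma> \<mu> - J \<sigma> \<nu> \<noteq> 0"
      by (simp add: J_diff)
    \<comment> \<open>Applying \<open>ad (T \<sigma>) - J \<sigma> \<nu>\<close> removes the component of weight \<open>\<nu>\<close> and multiplies the sum by a
      nonzero number.\<close>
    define X' where "X' \<nu>' = (J \<sigma> \<nu>' - J \<sigma> \<nu>) *L X \<nu>'" for \<nu>'
    have "br (T \<sigma>) (sum X N) = (\<Sum>\<nu>'\<in>N. J \<sigma> \<nu>' *L X \<nu>')"
      unfolding br_sum using Suc.prems(2) by (intro sum.cong) (auto simp: T_bracket)
    then have "sum X' N = (J \<sigma> \<mu> - J \<sigma> \<nu>) *L sum X N"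
      using Suc.prems(3)[of \<sigma>]
      by (simp add: X'_def scale_left_diff_distrib sum_subtractf scale_sum_right)
    moreover have "sum X' N = sum X' (N - {\<nu>})"
      using Suc.prems(1) \<nu>(1) by (simp add: sum.remove X'_def)
    ultimately have eq: "sum X' (N - {\<nu>}) = (J \<sigma> \<mu> - J \<sigma> \<nu>) *L sum X N"
      by simp
    have "sum X' (N - {\<nu>}) \<in> RS \<mu>"
    proof (rule Suc.hyps(1))
      show "n = card (N - {\<nu>})"
        using Suc.hyps(2) Suc.prems(1) \<nu>(1) by simp
      show "br (T \<tau>) (sum X' (N - {\<nu>})) = J \<tau> \<mu> *L sum X' (N - {\<nu>})" for \<tau>
        unfolding eq using Suc.prems(3)[of \<tau>] by (simp add: br_scale mult.commute)
    qed (use Suc.prems in \<open>auto simp: X'_def RS_scale\<close>)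
    then have "inverse (J \<sigma> \<mu> - J \<sigma> \<nu>) *L sum X' (N - {\<nu>}) \<in> RS \<mu>"
      by (rule RS_scale)
    then show ?thesis
      using \<sigma> by (simp add: eq)
  qed
qed

end

section \<open>Affine diagrams as trees and cycles\<close>

text \<open>The bonds of a tree, in an order in which each attaches exactly one new node to those reached
  so far, from \<open>V\<close> up to \<open>V'\<close>.\<close>

fun grows :: "nat set \<Rightarrow> bond list \<Rightarrow> nat set \<Rightarrow> bool" where
  "grows V [] V' \<longleftrightarrow> V = V'"
| "grows V ((i, j, p, q) # bs) V' \<longleftrightarrow>
     (i \<in> V) \<noteq> (j \<in> V) \<and> grows (insert i (insert j V)) bs V'"

lemma set_chain: "set (chain i j) = {(m, Suc m, 1, 1) | m. i \<le> m \<and> m < j}"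
  by (auto simp: chain_def)

lemma chain_Cons: "i < j \<Longrightarrow> chain i j = (i, Suc i, 1, 1) # chain (Suc i) j"
  by (simp add: chain_def upt_rec[of i])

lemma grows_chain:
  assumes "i \<le> j" "i \<in> V" "V \<inter> {i<..j} = {}"
  shows "grows V (chain i j @ bs) V' \<longleftrightarrow> grows (V \<union> {i..j}) bs V'"
  using assms
proof (induction "j - i" arbitrary: i V)
  case 0
  then show ?case
    by (simp add: chain_def insert_absorb)
next
  case (Suc n)
  then have "i < j"
    by simp
  then have "Suc i \<notin> V"
    using Suc.prems by auto
  have "grows V (chain i j @ bs) V' \<longleftrightarrow> grows (insert (Suc i) V) (chain (Suc i) j @ bs) V'"
    using Suc.prems \<open>i < j\<close> \<open>Suc i \<notin> V\<close>
    by (simp add: chain_Cons insert_absorb insert_commute)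
  also have "\<dots> \<longleftrightarrow> grows (insert (Suc i) V \<union> {Suc i..j}) bs V'"
    using Suc.hyps(2) Suc.prems \<open>i < j\<close> by (intro Suc.hyps(1)) auto
  also have "insert (Suc i) V \<union> {Suc i..j} = V \<union> {i..j}"
    using Suc.prems \<open>i < j\<close> by (auto simp: Suc_le_eq order_le_less)
  finally show ?case .
qed

text \<open>In some diagrams the chain from \<open>1\<close> is entered at its second node, through a bond with \<open>0\<close>.\<close>

lemma grows_chain_second:
  assumes "i < j" "i \<notin> V" "Suc i \<in> V" "V \<inter> {Suc i<..j} = {}"
  shows "grows V (chain i j @ bs) V' \<longleftrightarrow> grows (V \<union> {i..j}) bs V'"
proof -
  have "grows V (chain i j @ bs) V' \<longleftrightarrow> grows (insert i V) (chain (Suc i) j @ bs) V'"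
    using assms by (simp add: chain_Cons insert_absorb)
  also have "\<dots> \<longleftrightarrow> grows (insert i V \<union> {Suc i..j}) bs V'"
    using assms by (intro grows_chain) auto
  also have "insert i V \<union> {Suc i..j} = V \<union> {i..j}"
    using assms(1) by auto
  finally show ?thesis .
qed

text \<open>The diagram is a tree except in type \<open>A\<^sub>l\<^sup>(\<^sup>1\<^sup>)\<close>, where the bond between \<open>0\<close> and \<open>l\<close>
  closes a cycle.\<close>

definition tree_bonds :: "affine_type \<Rightarrow> nat \<Rightarrow> bond list" where
  "tree_bonds X l = (if X = Aff_A1 then chain 0 l else bonds X l)"

lemma grows_chain_0: "grows {0} (chain 0 l) {..l}"
proof -
  have "grows ({0} \<union> {0..l}) [] {..l}"
    by auto
  then have "grows {0} (chain 0 l @ []) {..l}"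
    by (subst grows_chain) simp_all
  then show ?thesis
    by (simp only: append_Nil2)
qed

lemma chain_bounds:
  "(i, j, p, q) \<in> set (chain m n) \<Longrightarrow> n \<le> l \<Longrightarrow>
    i \<le> l \<and> j \<le> l \<and> i \<noteq> j \<and> 1 \<le> p \<and> p \<le> 3 \<and> 1 \<le> q \<and> q \<le> 3"
  by (auto simp: set_chain)

lemma bonds_bounds:
  assumes "affine_rank X l" "(i, j, p, q) \<in> set (bonds X l)"
  shows "i \<le> l \<and> j \<le> l \<and> i \<noteq> j \<and> 1 \<le> p \<and> p \<le> 3 \<and> 1 \<le> q \<and> q \<le> 3"
  using assms by (cases X) (simp; (elim disjE)?; ((rule chain_bounds, assumption, simp) | (elim conjE, simp)))+
lemma tree_bonds_grow:
  assumes "affine_rank X l"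
  shows "\<exists>r. grows {r} (tree_bonds X l) {..l}"
proof (cases "X \<in> {Aff_B1, Aff_D1, Aff_A2_odd}")
  case True
  then have "grows {0} (bonds X l) {..l}"
    using assms by (elim insertE) (auto simp: grows_chain_second)
  then show ?thesis
    using True by (auto simp: tree_bonds_def)
next
  case False
  \<comment> \<open>The list for \<open>E\<^sub>6\<^sup>(\<^sup>1\<^sup>)\<close> begins at node \<open>1\<close> and reaches \<open>0\<close> last.\<close>
  then have "grows {if X = Aff_E61 then 1 else 0} (tree_bonds X l) {..l}"
    using assms grows_chain_0 by (cases X) (auto simp: tree_bonds_def grows_chain)
  then show ?thesis
    by blast
qed

lemma tree_bonds_subset: "set (tree_bonds X l) \<subseteq> set (bonds X l)"
  by (auto simp: tree_bonds_def)

definition bond_entry :: "nat \<Rightarrow> nat \<Rightarrow> bond \<Rightarrow> int" where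
  "bond_entry i j = (\<lambda>(i', j', p, q).
     if (i, j) = (i', j') then p else if (i, j) = (j', i') then q else 0)"

lemma affine_gcm_bond_entry:
  "affine_gcm X l i j = (if i = j then 2 else - (\<Sum>b\<leftarrow>bonds X l. bond_entry i j b))"
  by (simp add: affine_gcm_def bond_entry_def)

lemma grows_entry_zero:
  "grows V bs V' \<Longrightarrow> i \<in> V \<Longrightarrow> j \<in> V \<Longrightarrow> (\<Sum>b\<leftarrow>bs. bond_entry i j b) = 0"
proof (induction bs arbitrary: V)
  case (Cons b bs)
  obtain i' j' p q where b: "b = (i', j', p, q)"
    by (cases b) auto
  have "(\<Sum>b\<leftarrow>bs. bond_entry i j b) = 0"
    using Cons.prems by (intro Cons.IH[of "insert i' (insert j' V)"]) (auto simp: b)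
  moreover have "bond_entry i j b = 0"
    using Cons.prems by (auto simp: b bond_entry_def)
  ultimately show ?case
    by simp
qed simp

text \<open>Each bond brings in a new node, so two nodes are joined by at most one bond.\<close>

lemma grows_entry_le:
  "grows V bs V' \<Longrightarrow> (\<And>i j p q. (i, j, p, q) \<in> set bs \<Longrightarrow> p \<le> c \<and> q \<le> c) \<Longrightarrow> 0 \<le> c \<Longrightarrow>
    (\<Sum>b\<leftarrow>bs. bond_entry i j b) \<le> c"
proof (induction bs arbitrary: V)
  case (Cons b bs)
  obtain i' j' p q where b: "b = (i', j', p, q)"
    by (cases b) auto
  have rest: "grows (insert i' (insert j' V)) bs V'"
    using Cons.prems(1) by (simp add: b)
  have pq: "p \<le> c" "q \<le> c"
    using Cons.prems(2)[of i' j' p q] by (auto simp: b)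
  show ?case
  proof (cases "{i, j} = {i', j'}")
    case True
    then have "(\<Sum>b\<leftarrow>bs. bond_entry i j b) = 0"
      using rest by (intro grows_entry_zero) auto
    then show ?thesis
      using pq Cons.prems(3) by (auto simp: b bond_entry_def)
  next
    case False
    then have "bond_entry i j b = 0"
      by (auto simp: b bond_entry_def)
    moreover have "(\<Sum>b\<leftarrow>bs. bond_entry i j b) \<le> c"
      using Cons.prems(2) by (intro Cons.IH[OF rest _ Cons.prems(3)]) auto
    ultimately show ?thesis
      by simp
  qed
qed simp

lemma bond_entry_nonneg:
  "affine_rank X l \<Longrightarrow> b \<in> set (bonds X l) \<Longrightarrow> 0 \<le> bond_entry i j b"
  using bonds_bounds[of X l] by (cases b) (fastforce simp: bond_entry_def)

lemma affine_gcm_nonpos: "affine_rank X l \<Longrightarrow> i \<noteq> j \<Longrightarrow> affine_gcm X l i j \<le> 0"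
  by (auto simp: affine_gcm_bond_entry intro!: sum_list_nonneg bond_entry_nonneg)

lemma affine_gcm_ge:
  assumes "affine_rank X l"
  shows "- 3 \<le> affine_gcm X l i j"
proof (cases "X = Aff_A1")
  case True
  have "(\<Sum>b\<leftarrow>chain 0 l. bond_entry i j b) \<le> 1"
    by (rule grows_entry_le[OF grows_chain_0]) (auto simp: set_chain)
  moreover have "bond_entry i j (l, 0, 1, 1) \<le> 1"
    by (simp add: bond_entry_def)
  ultimately show ?thesis
    using True by (simp add: affine_gcm_bond_entry)
next
  case False
  then have "(\<Sum>b\<leftarrow>bonds X l. bond_entry i j b) \<le> 3"
    using tree_bonds_grow[OF assms] bonds_bounds[OF assms]
    by (auto simp: tree_bonds_def intro!: grows_entry_le)
  then show ?thesis
    by (simp add: affine_gcm_bond_entry)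
qed

lemma affine_gcm_neg_iff:
  assumes "affine_rank X l" "i \<noteq> j"
  shows "affine_gcm X l i j < 0 \<longleftrightarrow>
    (\<exists>p q. (i, j, p, q) \<in> set (bonds X l) \<or> (j, i, p, q) \<in> set (bonds X l))"
proof -
  have "(\<Sum>b\<leftarrow>bonds X l. bond_entry i j b) = 0 \<longleftrightarrow> (\<forall>b\<in>set (bonds X l). bond_entry i j b = 0)"
    using bond_entry_nonneg[OF assms(1)] by (subst sum_list_nonneg_eq_0_iff) auto
  also have "\<dots> \<longleftrightarrow> \<not> (\<exists>p q. (i, j, p, q) \<in> set (bonds X l) \<or> (j, i, p, q) \<in> set (bonds X l))"
    using bonds_bounds[OF assms(1)] by (fastforce simp: bond_entry_def split: if_splits)
  finally show ?thesis
    using affine_gcm_nonpos[OF assms] assms(2) by (auto simp: affine_gcm_bond_entry)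
qed

lemma affine_gcm_zero_sym:
  assumes "affine_rank X l"
  shows "affine_gcm X l i j = 0 \<longleftrightarrow> affine_gcm X l j i = 0"
proof (cases "i = j")
  case False
  then have "affine_gcm X l i j < 0 \<longleftrightarrow> affine_gcm X l j i < 0"
    using affine_gcm_neg_iff[OF assms False] affine_gcm_neg_iff[OF assms False[symmetric]] by blast
  then show ?thesis
    using affine_gcm_nonpos[OF assms False] affine_gcm_nonpos[OF assms False[symmetric]] by linarith
qed simp

lemma grows_invariant:
  "grows V bs V' \<Longrightarrow> (\<And>i j p q. (i, j, p, q) \<in> set bs \<Longrightarrow> P i \<longleftrightarrow> P j) \<Longrightarrow> 
    (\<And>i. i \<in> V \<Longrightarrow> P i) \<Longrightarrow> i \<in> V' \<Longrightarrow> P i"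
proof (induction bs arbitrary: V)
  case (Cons b bs)
  obtain i' j' p q where b: "b = (i', j', p, q)"
    by (cases b) auto
  have "P i' \<longleftrightarrow> P j'"
    using Cons.prems(2)[of i' j' p q] by (simp add: b)
  then have V: "P k" if "k \<in> insert i' (insert j' V)" for k
    using Cons.prems(1,3) that by (auto simp: b)
  show ?case
  proof (rule Cons.IH[OF _ _ V])
    show "grows (insert i' (insert j' V)) bs V'"
      using Cons.prems(1) by (simp add: b)
    show "P i \<longleftrightarrow> P j" if "(i, j, p, q) \<in> set bs" for i j p q
      using Cons.prems(2)[of i j p q] that by simp
  qed (use Cons.prems(4) in simp_all)
qed simp

text \<open>When a bond is reached, the value at its new end is still free.\<close>

lemma grows_solve:
  assumes "grows V bs V'"
    and "\<And>i j p q u. (i, j, p, q) \<in> set bs \<Longrightarrow> u \<in> U \<Longrightarrow> \<exists>v\<in>U. C i j u v"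
    and "\<And>i j p q v. (i, j, p, q) \<in> set bs \<Longrightarrow> v \<in> U \<Longrightarrow> \<exists>u\<in>U. C i j u v"
    and "\<And>i. z0 i \<in> U"
  shows "\<exists>z. (\<forall>i. z i \<in> U) \<and> (\<forall>i\<in>V. z i = z0 i) \<and>
    (\<forall>(i, j, p, q)\<in>set bs. C i j (z i) (z j))"
  using assms
proof (induction bs arbitrary: V z0)
  case Nil
  then show ?case
    by auto
next
  case (Cons b bs)
  obtain i j p q where b: "b = (i, j, p, q)"
    by (cases b) auto
  have ij: "(i \<in> V) \<noteq> (j \<in> V)" "grows (insert i (insert j V)) bs V'"
    using Cons.prems(1) by (auto simp: b)
  obtain z1 where z1: "\<forall>i. z1 i \<in> U" "\<forall>i\<in>V. z1 i = z0 i" "C i j (z1 i) (z1 j)"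
  proof (cases "i \<in> V")
    case True
    obtain v where "v \<in> U" "C i j (z0 i) v"
      using Cons.prems(2)[of i j p q "z0 i"] Cons.prems(4) by (auto simp: b)
    then show ?thesis
      using that[of "z0(j := v)"] True ij(1) Cons.prems(4) by auto
  next
    case False
    obtain u where "u \<in> U" "C i j u (z0 j)"
      using Cons.prems(3)[of i j p q "z0 j"] Cons.prems(4) by (auto simp: b)
    then show ?thesis
      using that[of "z0(i := u)"] False ij(1) Cons.prems(4) by auto
  qed
  have "\<exists>z. (\<forall>i. z i \<in> U) \<and> (\<forall>k\<in>insert i (insert j V). z k = z1 k) \<and>
      (\<forall>(i, j, p, q)\<in>set bs. C i j (z i) (z j))"
  proof (rule Cons.IH[OF ij(2)])
    show "\<exists>v\<in>U. C i j u v" if "(i, j, p, q) \<in> set bs" "u \<in> U" for i j p q u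
      using Cons.prems(2)[of i j p q u] that by simp
    show "\<exists>u\<in>U. C i j u v" if "(i, j, p, q) \<in> set bs" "v \<in> U" for i j p q v
      using Cons.prems(3)[of i j p q v] that by simp
  qed (use z1(1) in simp)
  then obtain z where z: "\<forall>i. z i \<in> U" "\<forall>k\<in>insert i (insert j V). z k = z1 k"
      "\<forall>(i, j, p, q)\<in>set bs. C i j (z i) (z j)"
    by blast
  then have "z i = z1 i" "z j = z1 j" "\<forall>k\<in>V. z k = z0 k"
    using z1(2) by auto
  then show ?case
    using z z1(3) by (intro exI[of _ z]) (simp add: b split_beta)
qed

section \<open>Roots of a quasi-elliptic base system\<close>

locale qebs_base =
  fixes D :: "'e::ab_group_add base_system"
  assumes qebs: "qebs D"
begin

lemma pebs: "pebs D"
  using qebs by (simp add: qebs_def)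

sublocale bilinear_base D
  by (rule bilinear_base.intro) (use pebs in \<open>simp_all add: pebs_def Let_def\<close>)

abbreviation "l \<equiv> e_rank D"
abbreviation "\<alpha> \<equiv> e_simple D"
abbreviation "a \<equiv> e_a D"
abbreviation "gcm \<equiv> affine_gcm (e_type D) l"
abbreviation "k i \<equiv> e_k D (\<alpha> i)"
abbreviation "norm2 i \<equiv> J (\<alpha> i) (\<alpha> i)"

lemma rank: "affine_rank (e_type D) l"
  using pebs by (simp add: pebs_def Let_def)

lemma norm2_nonzero: "i \<le> l \<Longrightarrow> norm2 i \<noteq> 0"
  using pebs by (simp add: pebs_def Let_def)

lemma J_coroot_simple: "i \<le> l \<Longrightarrow> j \<le> l \<Longrightarrow> J (coroot D (\<alpha> i)) (\<alpha> j) = of_int (gcm i j)"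
  using pebs by (simp add: pebs_def Let_def)

lemma J_simple: "i \<le> l \<Longrightarrow> j \<le> l \<Longrightarrow> 2 * J (\<alpha> i) (\<alpha> j) = of_int (gcm i j) * norm2 i"
  using J_coroot_simple[of i j] norm2_nonzero[of i] by (simp add: J_coroot field_simps)

lemma gcm_diag [simp]: "gcm i i = 2"
  by (simp add: affine_gcm_def)

lemma gcm_nonpos: "i \<noteq> j \<Longrightarrow> gcm i j \<le> 0"
  using affine_gcm_nonpos rank by blast

lemma J_a_simple: "i \<le> l \<Longrightarrow> J a (\<alpha> i) = 0"
  using pebs by (simp add: pebs_def Let_def)

lemma J_a_a: "J a a = 0"
  using pebs by (simp add: pebs_def Let_def)

lemma J_nondegenerate: "nondegenerate J"
  using pebs by (simp add: pebs_def Let_def)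

lemma k_pos: "i \<le> l \<Longrightarrow> 1 \<le> k i"
  using pebs by (auto simp: pebs_def Let_def simple_roots_def)

lemma simple_root_cases: "\<beta> \<in> simple_roots D \<longleftrightarrow> (\<exists>i\<le>l. \<beta> = \<alpha> i)"
  by (auto simp: simple_roots_def)

lemma simple_inj: "i \<le> l \<Longrightarrow> j \<le> l \<Longrightarrow> \<alpha> i = \<alpha> j \<longleftrightarrow> i = j"
proof
  assume "i \<le> l" "j \<le> l" "\<alpha> i = \<alpha> j"
  then have "gcm i j = 2"
    using J_coroot_simple[of i j] J_coroot_simple[of j j] by simp
  then show "i = j"
    using gcm_nonpos[of i j] by fastforce
qed simp

definition comb :: "(nat \<Rightarrow> complex) \<Rightarrow> 'e" where
  "comb x = (\<Sum>i\<le>l. x i *E \<alpha> i)"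

lemma comb_add: "comb x + comb y = comb (\<lambda>i. x i + y i)"
  by (simp add: comb_def sum.distrib E.scale_left_distrib)

lemma comb_scale: "c *E comb x = comb (\<lambda>i. c * x i)"
  by (simp add: comb_def E.scale_sum_right)

lemma comb_single: "i \<le> l \<Longrightarrow> comb (\<lambda>j. if j = i then c else 0) = c *E \<alpha> i"
  by (simp add: comb_def if_distrib[of "\<lambda>c. c *E _"] cong: if_cong)

lemma scale_simple: "i \<le> l \<Longrightarrow> c *E \<alpha> i = comb (\<lambda>j. if j = i then c else 0)"
  by (simp add: comb_single)

lemma comb_unique:
  assumes "comb x + s *E a = comb y + t *E a"
  shows "s = t" "i \<le> l \<Longrightarrow> x i = y i"
proof -
  have indep: "\<not> E.dependent (base_vectors D)"
    using pebs by (simp add: pebs_def Let_def)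
  define u where "u v = (if v = a then s - t else
      x (the_inv_into {..l} \<alpha> v) - y (the_inv_into {..l} \<alpha> v))" for v
  have inj: "inj_on \<alpha> {..l}"
    by (auto simp: inj_on_def simple_inj)
  have a: "a \<noteq> \<alpha> i" if "i \<le> l" for i
    using norm2_nonzero[OF that] J_a_simple[OF that] by auto
  have u: "u (\<alpha> i) = x i - y i" if "i \<le> l" for i
    using that a[OF that] the_inv_into_f_f[OF inj, of i] by (simp add: u_def)
  have "(\<Sum>v\<in>insert a (\<alpha> ` {..l}). u v *E v) = u a *E a + (\<Sum>i\<le>l. u (\<alpha> i) *E \<alpha> i)"
    using a by (subst sum.insert) (auto simp: sum.reindex[OF inj])
  also have "(\<Sum>i\<le>l. u (\<alpha> i) *E \<alpha> i) = comb x - comb y"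
    by (simp add: u comb_def E.scale_left_diff_distrib sum_subtractf)
  also have "u a *E a + (comb x - comb y) = 0"
    using assms by (simp add: u_def E.scale_left_diff_distrib algebra_simps)
  finally have sum: "(\<Sum>v\<in>insert a (\<alpha> ` {..l}). u v *E v) = 0" .
  have zero: "u v = 0" if "v \<in> insert a (\<alpha> ` {..l})" for v
    by (rule E.independentD[OF indep _ _ sum that])
      (auto simp: base_vectors_def simple_roots_def)
  show "s = t"
    using zero[of a] by (simp add: u_def)
  show "x i = y i" if "i \<le> l"
    using zero[of "\<alpha> i"] u[OF that] that by simp
qed

lemma comb_inj: "comb x = comb y \<Longrightarrow> i \<le> l \<Longrightarrow> x i = y i"
  using comb_unique(2)[of x 0 y 0] by simp

text \<open>The form takes complex values, and could be multiplied by any nonzero number on the span of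
  \<open>\<Pi>\<close>; only ratios of norms have a sign. For neighbours in the diagram the ratio is a quotient of two
  negative matrix entries, and the diagram is connected.\<close>

lemma norm2_ratio:
  assumes "i \<le> l" "j \<le> l"
  obtains \<rho> :: real where "\<rho> > 0" "norm2 i = of_real \<rho> * norm2 j"
proof -
  obtain r where r: "grows {r} (tree_bonds (e_type D) l) {..l}"
    using tree_bonds_grow[OF rank] by blast
  define P where "P i \<longleftrightarrow> (\<exists>\<rho>>0. norm2 i = of_real \<rho> * norm2 r)" for i
  have "r \<le> l"
  proof -
    have "grows V bs V' \<Longrightarrow> V \<subseteq> V'" for V bs V'
      by (induction V bs V' rule: grows.induct) auto
    then show ?thesis
      using r by auto
  qed
  have step: "P j" if P: "P i" and ij: "i \<le> l" "j \<le> l" "i \<noteq> j" "gcm i j < 0" for i j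
  proof -
    have neg: "gcm j i < 0"
      using ij gcm_nonpos[of j i] affine_gcm_zero_sym[OF rank, of i j] by force
    obtain \<rho> where \<rho>: "\<rho> > 0" "norm2 i = of_real \<rho> * norm2 r"
      using P by (auto simp: P_def)
    have "of_int (gcm j i) * norm2 j = of_int (gcm i j) * norm2 i"
      using J_simple[of i j] J_simple[of j i] J_sym[of "\<alpha> i" "\<alpha> j"] ij by simp
    then have "norm2 j = of_real (of_int (gcm i j) / of_int (gcm j i) * \<rho>) * norm2 r"
      using neg \<rho>(2) by (simp add: field_simps)
    moreover have "of_int (gcm i j) / of_int (gcm j i) * \<rho> > 0"
      using neg ij(4) \<rho>(1) by (simp add: zero_less_divide_iff mult_less_0_iff)
    ultimately show ?thesis
      unfolding P_def by blast
  qed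
  have P: "P i" if "i \<le> l" for i
  proof (rule grows_invariant[OF r, where P = P])
    fix i j p q assume bond: "(i, j, p, q) \<in> set (tree_bonds (e_type D) l)"
    then have bond: "(i, j, p, q) \<in> set (bonds (e_type D) l)"
      using tree_bonds_subset by blast
    then have "i \<le> l" "j \<le> l" "i \<noteq> j"
      using bonds_bounds[OF rank] by blast+
    then show "P i \<longleftrightarrow> P j"
      using step[of i j] step[of j i] affine_gcm_neg_iff[OF rank, of i j]
        affine_gcm_neg_iff[OF rank, of j i] bond by blast
  qed (use that in \<open>auto simp: P_def intro!: exI[of _ 1]\<close>)
  obtain \<rho> \<rho>' where "\<rho> > 0" "norm2 i = of_real \<rho> * norm2 r" "\<rho>' > 0" "norm2 j = of_real \<rho>' * norm2 r"
    using P assms unfolding P_def by blast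
  then show ?thesis
    using that[of "\<rho> / \<rho>'"] by simp
qed

lemma reflection_linear:
  "reflection D x (y + z) = reflection D x y + reflection D x z"
  "reflection D x (c *E y) = c *E reflection D x y"
  by (simp_all add: reflection_def J_add J_scale E.scale_left_distrib
      E.scale_right_diff_distrib algebra_simps)

lemma reflection_isometry:
  assumes "J x x \<noteq> 0"
  shows "J (reflection D x y) (reflection D x y) = J y y"
  using assms J_sym[of y x] by (simp add: reflection_def J_diff J_scale J_coroot field_simps)

lemma reflection_simple_a: "i \<le> l \<Longrightarrow> reflection D (\<alpha> i) (t *E a) = t *E a"
  using J_sym[of "\<alpha> i" a] by (simp add: reflection_def J_coroot J_scale J_a_simple)

lemma reflection_self: "J x x \<noteq> 0 \<Longrightarrow> reflection D x x = - x"
  using E.scale_left_distrib[of 1 1 x] by (simp add: reflection_def J_coroot)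

lemma weyl_reflection:
  "i \<le> l \<Longrightarrow> w \<in> weyl_group D \<Longrightarrow> reflection D (\<alpha> i) \<circ> w \<in> weyl_group D"
  by (rule weyl_group.intros) (auto simp: simple_root_cases)

lemma weyl_linear:
  assumes "w \<in> weyl_group D"
  shows "w (y + z) = w y + w z" "w (c *E y) = c *E w y"
  using assms by (induction; simp add: reflection_linear)+

lemma weyl_a: "w \<in> weyl_group D \<Longrightarrow> w (t *E a) = t *E a"
  by (induction rule: weyl_group.induct) (auto simp: simple_root_cases reflection_simple_a)

text \<open>The two integrality properties say that a root of the Weyl orbit lies in the root lattice
  and its coroot in the coroot lattice.\<close>

lemma weyl_orbit_coordinates:
  assumes "w \<in> weyl_group D" "j \<le> l"
  shows "\<exists>x. w (\<alpha> j) = comb x \<and> (\<forall>i\<le>l. x i \<in> \<int> \<and> x i * norm2 i / norm2 j \<in> \<int>) \<and>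
    J (w (\<alpha> j)) (w (\<alpha> j)) = norm2 j"
  using assms(1)
proof induction
  case 1
  show ?case
    using assms(2) norm2_nonzero[OF assms(2)]
    by (intro exI[of _ "\<lambda>i. if i = j then 1 else 0"]) (simp add: comb_single)
next
  case (2 \<beta> w)
  obtain x where x: "w (\<alpha> j) = comb x" "\<And>i. i \<le> l \<Longrightarrow> x i \<in> \<int>"
      "\<And>i. i \<le> l \<Longrightarrow> x i * norm2 i / norm2 j \<in> \<int>" "J (w (\<alpha> j)) (w (\<alpha> j)) = norm2 j"
    using 2 by blast
  obtain i where i: "i \<le> l" "\<beta> = \<alpha> i"
    using 2 simple_root_cases by blast
  define c where "c = J (coroot D (\<alpha> i)) (comb x)"
  have "c = (\<Sum>m\<le>l. x m * of_int (gcm i m))"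
    unfolding c_def comb_def J_sum using i(1) by (intro sum.cong) (simp_all add: J_scale J_coroot_simple)
  then have c: "c \<in> \<int>"
    using x(2) by (auto intro!: Ints_sum Ints_mult)
  have "c * norm2 i = 2 * (\<Sum>m\<le>l. x m * J (\<alpha> i) (\<alpha> m))"
    using norm2_nonzero[OF i(1)] by (simp add: c_def J_coroot) (simp add: comb_def J_sum J_scale)
  then have "c * norm2 i / norm2 j = (\<Sum>m\<le>l. x m * (2 * J (\<alpha> i) (\<alpha> m)) / norm2 j)"
    by (simp add: sum_distrib_left sum_divide_distrib mult_ac)
  also have "\<dots> = (\<Sum>m\<le>l. (x m * norm2 m / norm2 j) * of_int (gcm m i))"
  proof (rule sum.cong)
    fix m assume "m \<in> {..l}"
    then have "2 * J (\<alpha> i) (\<alpha> m) = of_int (gcm m i) * norm2 m"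
      using J_simple[of m i] J_sym[of "\<alpha> i" "\<alpha> m"] i(1) by simp
    then show "x m * (2 * J (\<alpha> i) (\<alpha> m)) / norm2 j = (x m * norm2 m / norm2 j) * of_int (gcm m i)"
      by (simp add: mult_ac)
  qed simp
  also have "\<dots> \<in> \<int>"
    by (intro Ints_sum Ints_mult x(3)) auto
  finally have c': "c * norm2 i / norm2 j \<in> \<int>" .
  define y where "y m = x m - (if m = i then c else 0)" for m
  have "comb x = comb y + c *E \<alpha> i"
    using i(1) by (simp add: scale_simple comb_add y_def)
  moreover have "(reflection D \<beta> \<circ> w) (\<alpha> j) = comb x - c *E \<alpha> i"
    by (simp add: x(1) i(2) reflection_def c_def)
  ultimately have "(reflection D \<beta> \<circ> w) (\<alpha> j) = comb y"
    by simp
  moreover have "y m \<in> \<int> \<and> y m * norm2 m / norm2 j \<in> \<int>" if "m \<le> l" for m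
    using x(2,3)[OF that] c c' by (auto simp: y_def algebra_simps diff_divide_distrib)
  moreover have "J ((reflection D \<beta> \<circ> w) (\<alpha> j)) ((reflection D \<beta> \<circ> w) (\<alpha> j)) = norm2 j"
    using reflection_isometry[of "\<alpha> i"] norm2_nonzero[OF i(1)] i(2) x(4) by simp
  ultimately show ?case
    by blast
qed

lemma weyl_invariant_k_g:
  assumes w: "w \<in> weyl_group D" and ij: "i \<le> l" "j \<le> l"
    and eq: "w (\<alpha> j) = \<alpha> i \<or> w (\<alpha> j) = - \<alpha> i"
  shows "k i = k j" "e_g D (\<alpha> i) = e_g D (\<alpha> j)"
proof -
  obtain w' where "w' \<in> weyl_group D" "\<alpha> i = w' (\<alpha> j)"
  proof (cases "w (\<alpha> j) = \<alpha> i")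
    case True
    then show ?thesis
      using that[of w] w by simp
  next
    case False
    have "reflection D (\<alpha> i) (- \<alpha> i) = \<alpha> i"
      using reflection_linear(2)[of "\<alpha> i" "- 1" "\<alpha> i"] reflection_self[OF norm2_nonzero[OF ij(1)]]
      by simp
    then show ?thesis
      using that[of "reflection D (\<alpha> i) \<circ> w"] weyl_reflection[OF ij(1) w] eq False by simp
  qed
  moreover have "weyl_invariant D (e_k D)" "weyl_invariant D (e_g D)"
    using pebs by (simp_all add: pebs_def Let_def)
  ultimately show "k i = k j" "e_g D (\<alpha> i) = e_g D (\<alpha> j)"
    using ij simple_root_cases unfolding weyl_invariant_def by metis+
qed

lemma of_real_Ints: "of_real p \<in> (\<int> :: complex set) \<Longrightarrow> p \<in> \<int>"
  by (metis Ints_cases Ints_of_int Re_complex_of_real of_real_of_int_eq)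

lemma of_nat_divide_Ints:
  assumes "of_nat m / of_nat n \<in> (\<int> :: complex set)" "0 < n"
  shows "n dvd m"
proof -
  obtain z :: int where "of_nat m / of_nat n = (of_int z :: complex)"
    using assms(1) by (rule Ints_cases)
  then have "of_int (int m) = (of_int (z * int n) :: complex)"
    using assms(2) by (simp add: field_simps)
  then have "int m = z * int n"
    using of_int_eq_iff by blast
  then have "int n dvd int m"
    by simp
  then show ?thesis
    by simp
qed

lemma pos_Ints_ge_1: "(p :: real) \<in> \<int> \<Longrightarrow> 0 < p \<Longrightarrow> 1 \<le> p"
  by (auto elim!: Ints_cases)

text \<open>Relative to the norm of \<open>\<alpha> g\<close>, the coordinate \<open>p\<close> contributes \<open>p\<^sup>2 \<rho>\<close> to the norm, which is at
  least \<open>1\<close>, being the product of the positive integers \<open>p\<close> and \<open>p \<rho>\<close>. The coordinate \<open>- q\<close> contributes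
  at least \<open>1\<close> in the same way, and the mixed term is not negative for opposite signs. So the norm
  would be at least twice that of the orbit.\<close>

lemma mixed_not_in_orbit:
  fixes p q :: real
  assumes w: "w \<in> weyl_group D" and le: "g \<le> l" "i \<le> l" "j \<le> l" and "i \<noteq> j" and pos: "p > 0" "q > 0"
  shows "w (\<alpha> g) \<noteq> of_real p *E \<alpha> i - of_real q *E \<alpha> j"
proof
  assume eq: "w (\<alpha> g) = of_real p *E \<alpha> i - of_real q *E \<alpha> j"
  obtain x where x: "w (\<alpha> g) = comb x" "\<And>i. i \<le> l \<Longrightarrow> x i \<in> \<int>"
      "\<And>i. i \<le> l \<Longrightarrow> x i * norm2 i / norm2 g \<in> \<int>" "J (w (\<alpha> g)) (w (\<alpha> g)) = norm2 g"
    using weyl_orbit_coordinates[OF w le(1)] by blast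
  have "comb x = of_real p *E \<alpha> i + (- of_real q) *E \<alpha> j"
    using eq x(1) by simp
  also have "\<dots> = comb (\<lambda>m. (if m = i then of_real p else 0) + (if m = j then - of_real q else 0))"
    using le by (simp only: scale_simple comb_add)
  finally have xi: "x i = of_real p" and xj: "x j = - of_real q"
    using comb_inj[of x _ i] comb_inj[of x _ j] le \<open>i \<noteq> j\<close> by auto
  obtain \<rho> where \<rho>: "\<rho> > 0" "norm2 i = of_real \<rho> * norm2 g"
    using norm2_ratio le by metis
  obtain \<rho>' where \<rho>': "\<rho>' > 0" "norm2 j = of_real \<rho>' * norm2 g"
    using norm2_ratio le by metis
  have ge: "1 \<le> p" "1 \<le> p * \<rho>" "1 \<le> q" "1 \<le> q * \<rho>'"
  proof -
    have "of_real p \<in> (\<int> :: complex set)" "of_real (p * \<rho>) \<in> (\<int> :: complex set)"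
      using x(2,3)[OF le(2)] norm2_nonzero[OF le(1)] by (simp_all add: xi \<rho>(2))
    moreover have "of_real q \<in> (\<int> :: complex set)" "of_real (q * \<rho>') \<in> (\<int> :: complex set)"
      using x(2,3)[OF le(3)] norm2_nonzero[OF le(1)] by (simp_all add: xj \<rho>'(2))
    ultimately show "1 \<le> p" "1 \<le> p * \<rho>" "1 \<le> q" "1 \<le> q * \<rho>'"
      using pos \<rho>(1) \<rho>'(1) by (auto intro!: pos_Ints_ge_1 of_real_Ints)
  qed
  have "norm2 g = of_real (p ^ 2) * norm2 i + of_real (q ^ 2) * norm2 j
      - of_real (p * q) * (2 * J (\<alpha> i) (\<alpha> j))"
    using x(4) J_sym[of "\<alpha> j" "\<alpha> i"] unfolding eq
    by (simp add: J_diff J_scale power2_eq_square algebra_simps)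
  also have "\<dots> = of_real (p ^ 2 * \<rho> + q ^ 2 * \<rho>' - p * q * (of_int (gcm i j) * \<rho>)) * norm2 g"
    unfolding J_simple[OF le(2,3)] \<rho>(2) \<rho>'(2) by (simp add: algebra_simps)
  finally have "of_real (p ^ 2 * \<rho> + q ^ 2 * \<rho>' - p * q * (of_int (gcm i j) * \<rho>)) = (1 :: complex)"
    using norm2_nonzero[OF le(1)] by simp
  then have "p ^ 2 * \<rho> + q ^ 2 * \<rho>' - p * q * (of_int (gcm i j) * \<rho>) = 1"
    using of_real_eq_1_iff by blast
  moreover have "1 \<le> p ^ 2 * \<rho>" "1 \<le> q ^ 2 * \<rho>'"
    using mult_mono[OF ge(1,2)] mult_mono[OF ge(3,4)] pos by (simp_all add: power2_eq_square)
  moreover have "p * q * (of_int (gcm i j) * \<rho>) \<le> 0"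
    using gcm_nonpos[OF \<open>i \<noteq> j\<close>] pos \<rho>(1) by (intro mult_nonneg_nonpos mult_nonpos_nonneg) auto
  ultimately show False
    by linarith
qed

text \<open>Here \<open>p\<close> and \<open>p \<rho>\<close> are integers with product \<open>1\<close>.\<close>

lemma multiple_in_orbit:
  fixes p :: real
  assumes w: "w \<in> weyl_group D" and le: "g \<le> l" "i \<le> l"
    and eq: "w (\<alpha> g) = of_real p *E \<alpha> i"
  shows "p = 1 \<or> p = - 1"
proof -
  obtain x where x: "w (\<alpha> g) = comb x" "\<And>i. i \<le> l \<Longrightarrow> x i \<in> \<int>"
      "\<And>i. i \<le> l \<Longrightarrow> x i * norm2 i / norm2 g \<in> \<int>" "J (w (\<alpha> g)) (w (\<alpha> g)) = norm2 g"
    using weyl_orbit_coordinates[OF w le(1)] by blast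
  have "comb x = comb (\<lambda>m. if m = i then of_real p else 0)"
    using eq x(1) le by (simp add: comb_single)
  then have xi: "x i = of_real p"
    using comb_inj[of x _ i] le by auto
  obtain \<rho> where \<rho>: "\<rho> > 0" "norm2 i = of_real \<rho> * norm2 g"
    using norm2_ratio le by metis
  have "of_real p \<in> (\<int> :: complex set)" "of_real (p * \<rho>) \<in> (\<int> :: complex set)"
    using x(2,3)[OF le(2)] norm2_nonzero[OF le(1)] by (simp_all add: xi \<rho>(2))
  then obtain m n where mn: "p = of_int m" "p * \<rho> = of_int n"
    using of_real_Ints by (metis Ints_cases)
  have "norm2 g = of_real (p * (p * \<rho>)) * norm2 g"
    using x(4) unfolding eq by (simp add: J_scale \<rho>(2) mult_ac)
  then have "of_real (p * (p * \<rho>)) = (1 :: complex)"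
    using norm2_nonzero[OF le(1)] by simp
  then have "p * (p * \<rho>) = 1"
    using of_real_eq_1_iff by blast
  then have "of_int (m * n) = (1 :: real)"
    unfolding mn(2) by (simp add: mn(1))
  then have "m * n = 1"
    by linarith
  then show ?thesis
    using mn(1) zmult_eq_1_iff[of m n] by auto
qed

text \<open>The reflection in \<open>\<alpha> i\<close> changes the sign of \<open>p\<close> alone, so one of the two vectors has
  coefficients of opposite signs.\<close>

lemma orthogonal_not_in_orbit:
  fixes p q :: real
  assumes w: "w \<in> weyl_group D" and le: "g \<le> l" "i \<le> l" "j \<le> l" and "i \<noteq> j"
    and orth: "gcm i j = 0" and nz: "p \<noteq> 0" "q \<noteq> 0"
  shows "w (\<alpha> g) \<noteq> of_real p *E \<alpha> i + of_real q *E \<alpha> j"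
proof
  assume eq: "w (\<alpha> g) = of_real p *E \<alpha> i + of_real q *E \<alpha> j"
  have "reflection D (\<alpha> i) (\<alpha> j) = \<alpha> j"
    using J_coroot_simple[OF le(2,3)] orth by (simp add: reflection_def)
  then have refl: "(reflection D (\<alpha> i) \<circ> w) (\<alpha> g) = of_real (- p) *E \<alpha> i + of_real q *E \<alpha> j"
    using eq reflection_self[OF norm2_nonzero[OF le(2)]] by (simp add: reflection_linear)
  have False if "w' \<in> weyl_group D" "w' (\<alpha> g) = of_real p' *E \<alpha> i + of_real q *E \<alpha> j"
    "p' * q < 0" for w' and p' :: real
  proof (cases "p' > 0")
    case True
    then show False
      using mixed_not_in_orbit[OF that(1) le \<open>i \<noteq> j\<close>, of p' "- q"] that(2,3)
      by (simp add: mult_less_0_iff)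
  next
    case False
    then show False
      using mixed_not_in_orbit[OF that(1) le(1,3,2) \<open>i \<noteq> j\<close>[symmetric], of q "- p'"] that(2,3)
      by (simp add: mult_less_0_iff add.commute)
  qed
  moreover have "p * q < 0 \<or> - p * q < 0"
    using nz mult_eq_0_iff[of p q] by linarith
  ultimately show False
    using w eq weyl_reflection[OF le(2) w] refl by blast
qed

lemma R_kg_comb:
  assumes "comb y + t *E a \<in> R_kg D"
  obtains w j n where "w \<in> weyl_group D" "j \<le> l" "t = of_int n * of_nat (k j)"
    "w (\<alpha> j) = comb y \<or> 2 *E w (\<alpha> j) = comb y \<and> n \<in> e_g D (\<alpha> j)"
proof -
  obtain w \<beta> n c where w: "w \<in> weyl_group D" "\<beta> \<in> simple_roots D"
    and v: "comb y + t *E a = w (c *E \<beta> + (of_int n * of_nat (e_k D \<beta>)) *E a)"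
    and c: "c = 1 \<or> c = 2 \<and> n \<in> e_g D \<beta>"
  proof -
    obtain w \<beta> z where w: "w \<in> weyl_group D" "\<beta> \<in> simple_roots D" "comb y + t *E a = w z"
      and z: "z \<in> {\<beta> + (of_int n * of_nat (e_k D \<beta>)) *E a | n. True} \<union>
        {2 *E \<beta> + (of_int n * of_nat (e_k D \<beta>)) *E a | n. n \<in> e_g D \<beta>}"
      using assms unfolding R_kg_def by blast
    then show ?thesis
      using that[OF w(1,2), of 1] that[OF w(1,2), of 2] by auto
  qed
  obtain j where j: "j \<le> l" "\<beta> = \<alpha> j"
    using w(2) simple_root_cases by blast
  obtain x where x: "w (\<alpha> j) = comb x"
    using weyl_orbit_coordinates[OF w(1) j(1)] by blast
  have eq: "comb y + t *E a = comb (\<lambda>i. c * x i) + (of_int n * of_nat (k j)) *E a"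
    using v weyl_a[OF w(1), of 1]
    by (simp add: weyl_linear[OF w(1)] j(2) x comb_scale)
  then have t: "t = of_int n * of_nat (k j)"
    by (rule comb_unique)
  then have "c *E w (\<alpha> j) = comb y"
    using eq by (simp add: x comb_scale)
  then show ?thesis
    using that[OF w(1) j(1) t] c j(2) by auto
qed

lemma two_term_not_in_R:
  fixes p q :: real
  assumes le: "i \<le> l" "j \<le> l" "i \<noteq> j" and nz: "p \<noteq> 0" "q \<noteq> 0"
    and sign: "gcm i j = 0 \<or> p * q < 0"
  shows "of_real p *E \<alpha> i + of_real q *E \<alpha> j + t *E a \<notin> R_kg D"
proof
  define y where "y m = (if m = i then of_real p else 0) + (if m = j then of_real q else (0::complex))"
    for m
  have y: "comb y = of_real p *E \<alpha> i + of_real q *E \<alpha> j"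
    using le by (simp add: scale_simple comb_add y_def[abs_def])
  assume "of_real p *E \<alpha> i + of_real q *E \<alpha> j + t *E a \<in> R_kg D"
  then obtain w g where w: "w \<in> weyl_group D" "g \<le> l"
      "w (\<alpha> g) = comb y \<or> 2 *E w (\<alpha> g) = comb y"
    unfolding y[symmetric] by (metis R_kg_comb)
  \<comment> \<open>\<open>r\<close> is \<open>1\<close>, or \<open>1 / 2\<close> for the doubled roots of \<open>R(k, g)\<close>.\<close>
  obtain r :: real where r: "r > 0" "w (\<alpha> g) = of_real r *E comb y"
  proof (cases "w (\<alpha> g) = comb y")
    case True
    then show ?thesis
      using that[of 1] by simp
  next
    case False
    then have "2 *E w (\<alpha> g) = comb y"
      using w(3) by simp
    moreover have "(1 / 2) *E (2 *E w (\<alpha> g)) = w (\<alpha> g)"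
      by simp
    ultimately have "w (\<alpha> g) = (1 / 2) *E comb y"
      by argo
    then show ?thesis
      using that[of "1 / 2"] by simp
  qed
  then have eq: "w (\<alpha> g) = of_real (r * p) *E \<alpha> i + of_real (r * q) *E \<alpha> j"
    by (simp add: y E.scale_right_distrib)
  show False
  proof (cases "gcm i j = 0")
    case True
    then show ?thesis
      using orthogonal_not_in_orbit[OF w(1,2) le True, of "r * p" "r * q"] eq nz r(1) by simp
  next
    case False
    then have "p > 0 \<and> q < 0 \<or> p < 0 \<and> q > 0"
      using sign by (auto simp: mult_less_0_iff)
    then show ?thesis
      using mixed_not_in_orbit[OF w(1,2) le, of "r * p" "r * - q"]
        mixed_not_in_orbit[OF w(1,2) le(2,1) le(3)[symmetric], of "r * q" "r * - p"] eq r(1)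
      by (auto simp: add.commute mult_less_0_iff zero_less_mult_iff)
  qed
qed

abbreviation "c i \<equiv> c_of D (\<alpha> i)"

lemma star_eq: "star D (\<alpha> i) = of_nat (c i) *E \<alpha> i + of_nat (k i) *E a"
  by (simp add: star_def)

lemma B_plus_cases: "\<mu> \<in> B_plus D \<longleftrightarrow> (\<exists>i\<le>l. \<mu> = \<alpha> i \<or> \<mu> = star D (\<alpha> i))"
  by (auto simp: B_plus_def simple_roots_def)

lemma c_pos [simp]: "0 < c i"
  by (simp add: c_of_def)

lemma c_nonzero [simp]: "c i \<noteq> 0"
  using c_pos[of i] by linarith

lemma J_multiples:
  assumes "i \<le> l" "j \<le> l"
  shows "J (x *E \<alpha> i + s *E a) (y *E \<alpha> j + t *E a) = x * y * J (\<alpha> i) (\<alpha> j)"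
  using assms J_sym[of "\<alpha> i" a] by (simp add: J_add J_scale J_a_simple J_a_a)

lemma J_star: "i \<le> l \<Longrightarrow> J (star D (\<alpha> i)) (star D (\<alpha> i)) = (of_nat (c i))\<^sup>2 * norm2 i"
  by (simp add: star_eq J_multiples power2_eq_square)

lemma B_plus_norm: "\<mu> \<in> B_plus D \<Longrightarrow> J \<mu> \<mu> \<noteq> 0"
  using norm2_nonzero by (auto simp: B_plus_cases J_star)

text \<open>The products of \<open>s\<^sub>\<alpha>\<close> and \<open>s\<^sub>\<alpha>\<^sub>*\<close> are translations along \<open>a\<close>. Their step is \<open>2 k(\<alpha>)\<close> on the roots over
  \<open>\<alpha>\<close> if \<open>c(\<alpha>) = 1\<close>; if \<open>c(\<alpha>) = 2\<close>, it is \<open>k(\<alpha>)\<close> on those over \<open>\<alpha>\<close> and \<open>2 k(\<alpha>)\<close> on those over \<open>2 \<alpha>\<close>.\<close>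

lemma reflection_translation:
  assumes "i \<le> l"
  shows "reflection D (\<alpha> i) (reflection D (star D (\<alpha> i)) (x *E \<alpha> i + t *E a)) =
      x *E \<alpha> i + (t - 2 * x * of_nat (k i) / of_nat (c i)) *E a"
    "reflection D (star D (\<alpha> i)) (reflection D (\<alpha> i) (x *E \<alpha> i + t *E a)) =
      x *E \<alpha> i + (t + 2 * x * of_nat (k i) / of_nat (c i)) *E a"
proof -
  have c: "of_nat (c i) \<noteq> (0 :: complex)"
    using c_pos[of i] by simp
  have refl: "reflection D (\<alpha> i) (y *E \<alpha> i + t *E a) = (- y) *E \<alpha> i + t *E a" for y t
    using reflection_self[OF norm2_nonzero[OF assms]] reflection_simple_a[OF assms, of 1]
    by (simp add: reflection_linear)
  have star: "reflection D (star D (\<alpha> i)) (y *E \<alpha> i + t *E a) =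
      (- y) *E \<alpha> i + (t - 2 * y * of_nat (k i) / of_nat (c i)) *E a" for y t
  proof -
    have "J (coroot D (star D (\<alpha> i))) (y *E \<alpha> i + t *E a) = 2 * y / of_nat (c i)"
      using c norm2_nonzero[OF assms]
      by (simp add: J_coroot J_star[OF assms]) (simp add: star_eq J_multiples assms power2_eq_square)
    moreover have "(2 * y / of_nat (c i)) *E star D (\<alpha> i) =
        (y *E \<alpha> i + y *E \<alpha> i) + (2 * y * of_nat (k i) / of_nat (c i)) *E a"
      using c by (simp add: star_eq E.scale_right_distrib flip: E.scale_left_distrib)
    ultimately show ?thesis
      by (simp add: reflection_def E.scale_left_diff_distrib)
  qed
  show "reflection D (\<alpha> i) (reflection D (star D (\<alpha> i)) (x *E \<alpha> i + t *E a)) =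
      x *E \<alpha> i + (t - 2 * x * of_nat (k i) / of_nat (c i)) *E a"
    unfolding star refl by simp
  show "reflection D (star D (\<alpha> i)) (reflection D (\<alpha> i) (x *E \<alpha> i + t *E a)) =
      x *E \<alpha> i + (t + 2 * x * of_nat (k i) / of_nat (c i)) *E a"
    unfolding refl star by simp
qed

end

locale qebs_odd = qebs_base +
  assumes g_odd: "\<And>\<beta>. \<beta> \<in> simple_roots D \<Longrightarrow> e_g D \<beta> = {} \<or> e_g D \<beta> = {n. odd n}"
begin

lemma c_g_cases:
  assumes "i \<le> l"
  shows "c i = 1 \<and> e_g D (\<alpha> i) = {} \<or> c i = 2 \<and> e_g D (\<alpha> i) = {n. odd n}"
proof -
  have "{n :: int. odd n} \<noteq> {}"
    using odd_one by blast
  then show ?thesis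
    using g_odd[of "\<alpha> i"] assms by (auto simp: c_of_def simple_root_cases)
qed

lemma B_plus_subset_R: "B_plus D \<subseteq> R_kg D"
proof
  fix \<mu> assume "\<mu> \<in> B_plus D"
  then obtain i where i: "i \<le> l" "\<mu> = \<alpha> i \<or> \<mu> = star D (\<alpha> i)"
    unfolding B_plus_cases by blast
  have R: "z \<in> R_kg D" if "z \<in> {\<alpha> i + (of_int n * of_nat (k i)) *E a | n. True} \<union>
      {2 *E \<alpha> i + (of_int n * of_nat (k i)) *E a | n. n \<in> e_g D (\<alpha> i)}" for z
    unfolding R_kg_def using i(1) that
    by (intro UN_I[OF weyl_group.intros(1)] image_eqI[of _ _ z] UN_I[of "\<alpha> i"])
      (auto simp: simple_root_cases)
  show "\<mu> \<in> R_kg D"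
  proof (cases "\<mu> = \<alpha> i")
    case True
    have "\<alpha> i + (of_int 0 * of_nat (k i)) *E a \<in> R_kg D"
      by (rule R) blast
    then show ?thesis
      using True by simp
  next
    case False
    then have \<mu>: "\<mu> = of_nat (c i) *E \<alpha> i + (of_int 1 * of_nat (k i)) *E a"
      using i(2) by (simp only: star_eq of_int_1 mult_1) blast
    have "(1 :: int) \<in> {n. odd n}"
      by simp
    then have "c i = 1 \<or> c i = 2 \<and> 1 \<in> e_g D (\<alpha> i)"
      using c_g_cases[OF i(1)] by metis
    then consider "c i = 1" | "c i = 2" "1 \<in> e_g D (\<alpha> i)"
      by blast
    then show ?thesis
    proof cases
      case 1
      have "\<alpha> i + (of_int 1 * of_nat (k i)) *E a \<in> R_kg D"
        by (rule R) blast
      then show ?thesis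
        using 1 by (simp add: \<mu>)
    next
      case 2
      have "2 *E \<alpha> i + (of_int 1 * of_nat (k i)) *E a \<in> R_kg D"
        using 2(2) by (intro R) blast
      then show ?thesis
        using 2(1) by (simp add: \<mu>)
    qed
  qed
qed

text \<open>The coefficient \<open>1 + c(\<alpha>)\<close> of \<open>\<alpha>\<close> is \<open>3\<close>, which no root has, or \<open>2\<close>; but \<open>c(\<alpha>) = 1\<close> means that
  \<open>g\<close> is empty at \<open>\<alpha>\<close>, so there are no roots over \<open>2 \<alpha>\<close>.\<close>

lemma self_sum_not_in_R:
  fixes e :: real
  assumes i: "i \<le> l" and e: "e = 1 \<or> e = - 1"
  shows "of_real e *E (\<alpha> i + star D (\<alpha> i)) \<notin> R_kg D"
proof
  define x where "x = of_real (e * (1 + of_nat (c i))) *E \<alpha> i"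
  have x: "x = comb (\<lambda>m. if m = i then of_real (e * (1 + of_nat (c i))) else 0)"
    using i by (simp add: x_def comb_single)
  have "of_real e *E (\<alpha> i + star D (\<alpha> i)) = x + (of_real e * of_nat (k i)) *E a"
    by (simp add: x_def star_eq E.scale_right_distrib E.scale_left_distrib distrib_left)
  moreover assume "of_real e *E (\<alpha> i + star D (\<alpha> i)) \<in> R_kg D"
  ultimately obtain w g n where w: "w \<in> weyl_group D" "g \<le> l"
      "w (\<alpha> g) = x \<or> 2 *E w (\<alpha> g) = x \<and> n \<in> e_g D (\<alpha> g)"
    unfolding x by (metis R_kg_comb)
  show False
  proof (cases "w (\<alpha> g) = x")
    case True
    then show ?thesis
      using multiple_in_orbit[OF w(1,2) i, of "e * (1 + of_nat (c i))"] e c_pos[of i]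
      by (auto simp: x_def)
  next
    case False
    then have half: "2 *E w (\<alpha> g) = x" and n: "n \<in> e_g D (\<alpha> g)"
      using w(3) by auto
    have "w (\<alpha> g) = (1 / 2) *E (2 *E w (\<alpha> g))"
      by simp
    then have eq: "w (\<alpha> g) = of_real (e * (1 + of_nat (c i)) / 2) *E \<alpha> i"
      unfolding half by (simp add: x_def)
    then have "e * (1 + of_nat (c i)) / 2 = 1 \<or> e * (1 + of_nat (c i)) / 2 = - 1"
      by (rule multiple_in_orbit[OF w(1,2) i])
    then have "c i = 1"
      using e by auto
    then have "w (\<alpha> g) = \<alpha> i \<or> w (\<alpha> g) = - \<alpha> i"
      using eq e by auto
    then have "e_g D (\<alpha> i) = e_g D (\<alpha> g)"
      by (rule weyl_invariant_k_g[OF w(1) i w(2)])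
    then show ?thesis
      using c_g_cases[OF i] \<open>c i = 1\<close> n by auto
  qed
qed

lemma B_all_cases:
  assumes "\<mu> \<in> B_all D"
  obtains i e where "i \<le> l" "e = 1 \<or> e = (- 1 :: real)"
    "\<mu> = of_real e *E \<alpha> i \<or> \<mu> = of_real e *E star D (\<alpha> i)"
proof -
  obtain \<nu> where \<nu>: "\<nu> \<in> B_plus D" "\<mu> = \<nu> \<or> \<mu> = - \<nu>"
    using assms by (auto simp: B_all_def)
  then obtain i where "i \<le> l" "\<nu> = \<alpha> i \<or> \<nu> = star D (\<alpha> i)"
    unfolding B_plus_cases by blast
  then show ?thesis
    using that[of i 1] that[of i "- 1"] \<nu>(2) by fastforce
qed

lemma B_all_minus: "\<mu> \<in> B_all D \<Longrightarrow> - \<mu> \<in> B_all D"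
  by (auto simp: B_all_def)

lemma B_all_multiple:
  assumes "i \<le> l" "\<mu> = of_real e *E \<alpha> i \<or> \<mu> = of_real e *E star D (\<alpha> i)"
    "e = 1 \<or> e = (- 1 :: real)"
  obtains p :: real and s where "\<mu> = of_real p *E \<alpha> i + s *E a" "p * e > 0"
proof (cases "\<mu> = of_real e *E \<alpha> i")
  case True
  then show ?thesis
    using that[of e 0] assms(3) by auto
next
  case False
  then have "\<mu> = of_real (e * of_nat (c i)) *E \<alpha> i + (of_real e * of_nat (k i)) *E a"
    using assms(2) by (simp add: star_eq E.scale_right_distrib)
  then show ?thesis
    using that[of "e * of_nat (c i)" "of_real e * of_nat (k i)"] assms(3) by auto
qed

text \<open>If \<open>\<mu>\<close> and \<open>\<nu>\<close> belong to different simple roots, then the angle condition forces \<open>\<nu> - \<mu>\<close> to have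
  coefficients of opposite signs unless these simple roots are orthogonal. If they belong to the same
  \<open>\<alpha>\<close>, then \<open>\<nu> - \<mu>\<close> is \<open>\<alpha> + \<alpha>\<^sup>*\<close> up to sign.\<close>

lemma base_difference_not_root:
  assumes \<mu>: "\<mu> \<in> B_all D" and \<nu>: "\<nu> \<in> B_all D" and ne: "\<mu> \<noteq> \<nu>" "\<mu> + \<nu> \<noteq> 0"
    and angle: "Re (J (coroot D \<mu>) \<nu>) \<le> 0"
  shows "\<nu> - \<mu> \<notin> R_kg D \<and> J (\<nu> - \<mu>) (\<nu> - \<mu>) \<noteq> 0"
proof -
  obtain i e where i: "i \<le> l" "e = 1 \<or> e = (- 1 :: real)"
      "\<mu> = of_real e *E \<alpha> i \<or> \<mu> = of_real e *E star D (\<alpha> i)"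
    using B_all_cases[OF \<mu>] .
  obtain j d where j: "j \<le> l" "d = 1 \<or> d = (- 1 :: real)"
      "\<nu> = of_real d *E \<alpha> j \<or> \<nu> = of_real d *E star D (\<alpha> j)"
    using B_all_cases[OF \<nu>] .
  obtain p s where p: "\<mu> = of_real p *E \<alpha> i + s *E a" "p * e > 0"
    using B_all_multiple[OF i(1,3,2)] by blast
  obtain q t where q: "\<nu> = of_real q *E \<alpha> j + t *E a" "q * d > 0"
    using B_all_multiple[OF j(1,3,2)] by blast
  have nz: "p \<noteq> 0" "q \<noteq> 0"
    using p(2) q(2) by auto
  have "J (coroot D \<mu>) \<nu> = of_real p * of_real q * (2 * J (\<alpha> i) (\<alpha> j)) / (of_real p ^ 2 * norm2 i)"
    unfolding p(1) q(1) J_coroot J_multiples[OF i(1) i(1)] J_multiples[OF i(1) j(1)]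
    by (simp add: power2_eq_square)
  also have "\<dots> = of_real (q / p * of_int (gcm i j))"
    unfolding J_simple[OF i(1) j(1)] using norm2_nonzero[OF i(1)] nz
    by (simp add: power2_eq_square)
  finally have "q / p * of_int (gcm i j) \<le> 0"
    using angle by simp
  then have "p ^ 2 * (q / p * of_int (gcm i j)) \<le> 0"
    by (rule mult_nonneg_nonpos[OF zero_le_power2])
  moreover have "p ^ 2 * (q / p * of_int (gcm i j)) = p * q * of_int (gcm i j)"
    using nz by (simp add: power2_eq_square)
  ultimately have sign: "p * q * of_int (gcm i j) \<le> 0"
    by argo
  have diff: "\<nu> - \<mu> = of_real (- p) *E \<alpha> i + of_real q *E \<alpha> j + (t - s) *E a"
    by (simp add: p(1) q(1) E.scale_left_diff_distrib)
  obtain \<rho> where \<rho>: "\<rho> > 0" "norm2 j = of_real \<rho> * norm2 i"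
    using norm2_ratio i(1) j(1) by metis
  have "J (\<nu> - \<mu>) (\<nu> - \<mu>) = J \<nu> \<nu> + J \<mu> \<mu> - 2 * J \<mu> \<nu>"
    using J_sym[of \<nu> \<mu>] by (simp add: J_diff)
  also have "\<dots> = of_real q ^ 2 * norm2 j + of_real p ^ 2 * norm2 i
      - of_real p * of_real q * (2 * J (\<alpha> i) (\<alpha> j))"
    unfolding p(1) q(1) J_multiples[OF i(1) i(1)] J_multiples[OF j(1) j(1)] J_multiples[OF i(1) j(1)]
    by (simp add: power2_eq_square)
  also have "\<dots> = of_real (q ^ 2 * \<rho> + p ^ 2 - p * q * of_int (gcm i j)) * norm2 i"
    unfolding J_simple[OF i(1) j(1)] \<rho>(2) by (simp add: algebra_simps)
  finally have "J (\<nu> - \<mu>) (\<nu> - \<mu>) = of_real (q ^ 2 * \<rho> + p ^ 2 - p * q * of_int (gcm i j)) * norm2 i" .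
  moreover have "q ^ 2 * \<rho> + p ^ 2 - p * q * of_int (gcm i j) > 0"
  proof -
    have "0 < q ^ 2 * \<rho>" "0 < p ^ 2"
      using nz \<rho>(1) by simp_all
    then show ?thesis
      using sign by linarith
  qed
  ultimately have "J (\<nu> - \<mu>) (\<nu> - \<mu>) \<noteq> 0"
    using norm2_nonzero[OF i(1)] by (simp del: of_real_add of_real_diff of_real_mult)
  moreover have "\<nu> - \<mu> \<notin> R_kg D"
  proof (cases "i = j")
    case False
    have "gcm i j = 0 \<or> - p * q < 0"
    proof (rule ccontr)
      assume neg: "\<not> (gcm i j = 0 \<or> - p * q < 0)"
      then have "gcm i j < 0"
        using gcm_nonpos[OF False] by (simp add: order_le_less)
      moreover have "p * q \<noteq> 0" "\<not> - p * q < 0"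
        using nz neg by simp_all
      then have "p * q < 0"
        by linarith
      ultimately have "p * q * of_int (gcm i j) > 0"
        by (intro mult_neg_neg) auto
      then show False
        using sign by simp
    qed
    then show ?thesis
      unfolding diff using two_term_not_in_R[OF i(1) j(1) False, of "- p" q] nz by simp
  next
    case True
    then have "p * q < 0"
      using sign nz by (auto simp: mult_le_0_iff zero_less_mult_iff mult_less_0_iff)
    then have "e = - d"
      using i(2) j(2) p(2) q(2) by (auto simp: mult_less_0_iff)
    then have "\<nu> - \<mu> = of_real d *E (\<alpha> i + star D (\<alpha> i))"
      using i(3) j(3) True ne(2) by (auto simp: E.scale_right_distrib add.commute)
    then show ?thesis
      using self_sum_not_in_R[OF i(1) j(2)] by simp
  qed
  ultimately show ?thesis
    by blast
qed

text \<open>The arithmetic of the base system at a bond \<open>(\<beta>, \<gamma>)\<close> that carries a linking relation: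
  \<open>c(\<gamma>) = 2\<close> would put \<open>\<gamma>\<close> into \<open>\<Pi>\<^sup>B\<close>, contrary to the entry \<open>- 1\<close>; and \<open>c(\<beta>) = 2\<close> puts \<open>\<beta>\<close> there, which
  gives \<open>m = 2\<close>, while the condition on \<open>g(\<beta>)\<close> makes \<open>1 / y\<close> an integer.\<close>

lemma A_triple:
  assumes "(\<beta>, \<gamma>, y) \<in> A_triples D"
  obtains i j m where "\<beta> = \<alpha> i" "\<gamma> = \<alpha> j" "i \<le> l" "j \<le> l" "i \<noteq> j" "1 \<le> y"
    "k j = k i * y" "gcm j i = - 1" "gcm i j = - int m" "1 \<le> m" "m \<le> 3" "y dvd m"
    "c j = 1" "c i = 2 \<Longrightarrow> y = 1 \<and> m = 2"
proof -
  have A: "\<beta> \<in> simple_roots D" "\<gamma> \<in> simple_roots D" "1 \<le> y" "\<beta> \<noteq> \<gamma>"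
      "J \<beta> (coroot D \<gamma>) = - 1" "e_k D \<gamma> = e_k D \<beta> * y"
    using assms by (auto simp: A_triples_def)
  then obtain i j where ij: "\<beta> = \<alpha> i" "\<gamma> = \<alpha> j" "i \<le> l" "j \<le> l"
    unfolding simple_root_cases by blast
  with A have "i \<noteq> j" and J: "J (\<alpha> i) (coroot D (\<alpha> j)) = - 1" and k: "k j = k i * y"
    by auto
  note ij = ij this(1) A(3)
  have Jc: "J (coroot D (\<alpha> j)) (\<alpha> i) = - 1"
    using J J_sym by metis
  then have "of_int (gcm j i) = (of_int (- 1) :: complex)"
    using J_coroot_simple[OF ij(4,3)] by simp
  then have ji: "gcm j i = - 1"
    using of_int_eq_iff by blast
  then have "gcm i j \<noteq> 0"
    using affine_gcm_zero_sym[OF rank, of i j] by simp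
  then have "gcm i j < 0"
    using gcm_nonpos[OF ij(5)] by simp
  moreover define m where "m = nat (- gcm i j)"
  ultimately have m: "gcm i j = - int m" "1 \<le> m"
    by auto
  then have "m \<le> 3"
    using affine_gcm_ge[OF rank, of i j] by simp
  have nz: "J (\<alpha> j) (\<alpha> i) \<noteq> 0" "J (\<alpha> i) (\<alpha> j) \<noteq> 0"
    using Jc J_sym[of "\<alpha> i"] by (auto simp: J_coroot)
  then have conn: "\<alpha> j \<in> connected_to D (\<alpha> i)" "\<alpha> i \<in> connected_to D (\<alpha> j)"
    using ij by (auto simp: connected_to_def simple_root_cases simple_inj)
  have simple: "\<alpha> i \<in> simple_roots D" "\<alpha> j \<in> simple_roots D"
    using ij by (auto simp: simple_root_cases)
  have kpos: "0 < k i"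
    using k_pos[OF ij(3)] by simp
  have "J (coroot D (\<alpha> i)) (\<alpha> j) * (of_nat (k i) / of_nat (k j)) \<in> \<int>"
    using qebs simple conn Jc unfolding qebs_def by blast
  then have "of_nat m / of_nat y \<in> (\<int> :: complex set)"
    using kpos by (simp add: J_coroot_simple[OF ij(3,4)] m k)
  then have dvd: "y dvd m"
    using ij(6) by (intro of_nat_divide_Ints) auto
  have B: "\<alpha> r \<in> simple_roots_B D" if "r \<le> l" "c r = 2" for r
  proof -
    have "1 \<in> e_g D (\<alpha> r)"
      using c_g_cases[OF that(1)] that(2) by auto
    moreover have "\<forall>\<beta>\<in>simple_roots D. \<beta> \<notin> simple_roots_B D \<longrightarrow> e_g D \<beta> = {}"
      using qebs by (simp add: qebs_def)
    moreover have "\<alpha> r \<in> simple_roots D"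
      using that(1) simple_root_cases by blast
    ultimately show ?thesis
      by auto
  qed
  have "c j \<noteq> 2"
  proof
    assume "c j = 2"
    then have "J (coroot D (\<alpha> j)) (\<alpha> i) = - 2"
      using B[OF ij(4)] conn(2) by (simp add: simple_roots_B_def)
    then show False
      using Jc by simp
  qed
  then have cj: "c j = 1"
    using c_g_cases[OF ij(4)] by auto
  have ci: "y = 1 \<and> m = 2" if "c i = 2"
  proof -
    have "J (coroot D (\<alpha> i)) (\<alpha> j) = - 2"
      using B[OF ij(3) that] conn(1) by (simp add: simple_roots_B_def)
    then have "of_int (gcm i j) = (of_int (- 2) :: complex)"
      using J_coroot_simple[OF ij(3,4)] by simp
    then have "m = 2"
      using m of_int_eq_iff[of "gcm i j" "- 2", where ?'a = complex] by simp
    let ?S = "(\<lambda>n. of_int n * (of_nat (k i) / of_nat (k j))) ` e_g D (\<alpha> i) :: rat set"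
    have "?S \<in> {{}, range of_int, of_int ` {n. even n}, of_int ` {n. odd n}}"
      using qebs B[OF ij(3) that] conn(1) unfolding qebs_def by blast
    then have "?S \<subseteq> range of_int"
      by auto
    moreover have "of_int 1 * (of_nat (k i) / of_nat (k j)) \<in> ?S"
      using c_g_cases[OF ij(3)] that by (intro imageI) auto
    ultimately obtain z :: int where "1 / of_nat y = (of_int z :: rat)"
      using kpos by (auto simp: k)
    then have "of_int 1 = (of_int (z * int y) :: rat)"
      using ij(6) by (simp add: field_simps)
    then have "1 = z * int y"
      using of_int_eq_iff by blast
    then have "int y dvd 1"
      by (metis dvd_triv_right)
    then have "y = 1"
      by simp
    with \<open>m = 2\<close> show ?thesis
      by simp
  qed
  show ?thesis
    using that[OF ij k ji m \<open>m \<le> 3\<close> dvd cj ci] .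
qed

text \<open>As \<open>1 < y\<close> divides \<open>m \<le> 3\<close>, it equals \<open>m\<close>. Hence \<open>\<kappa>\<close> is the root \<open>s\<^sub>\<alpha> \<beta>\<close> shifted by
  \<open>(y - s) k(\<alpha>) a\<close>, and this shift is not a multiple of the spacing \<open>k(\<beta>) = y k(\<alpha>)\<close> of the roots over
  the Weyl orbit of \<open>\<beta>\<close>.\<close>

lemma serre_inner_not_root:
  assumes A: "(\<alpha> i, \<alpha> j, y) \<in> A_triples D" and i: "i \<le> l" and s: "1 \<le> s" "s < y"
  defines "\<kappa> \<equiv> of_nat s *E \<alpha> i + (of_nat (y - s) *E star D (\<alpha> i) + \<alpha> j)"
  shows "\<kappa> \<notin> R_kg D \<and> J \<kappa> \<kappa> \<noteq> 0"
proof -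
  obtain i' j' m where A': "\<alpha> i = \<alpha> i'" "\<alpha> j = \<alpha> j'" "i' \<le> l" "j' \<le> l" "k j' = k i' * y"
      "gcm i' j' = - int m" "1 \<le> m" "m \<le> 3" "y dvd m" "c j' = 1" "c i' = 2 \<Longrightarrow> y = 1 \<and> m = 2"
    using A_triple[OF A] by metis
  have "i' = i"
    using A'(1,3) i simple_inj by simp
  note A' = A'[unfolded this]
  have "y = m"
  proof -
    obtain r where "m = y * r"
      using A'(9) by blast
    moreover have "\<not> 2 \<le> r"
    proof
      assume "2 \<le> r"
      then have "2 * 2 \<le> y * r"
        using s by (intro mult_le_mono) auto
      then show False
        using A'(8) \<open>m = y * r\<close> by simp
    qed
    ultimately show ?thesis
      using A'(7) by (cases "r = 0"; cases "r = 1") auto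
  qed
  have ci: "c i = 1"
    using A'(11) s c_g_cases[OF i] by auto
  have refl: "reflection D (\<alpha> i) (\<alpha> j) = \<alpha> j + of_nat y *E \<alpha> i"
    using J_coroot_simple[OF i A'(4)] A'(6) \<open>y = m\<close> by (simp add: A'(2) reflection_def)
  have "of_nat s *E \<alpha> i + of_nat (y - s) *E \<alpha> i = of_nat y *E \<alpha> i"
    using s unfolding E.scale_left_distrib[symmetric] of_nat_add[symmetric] by simp
  then have \<kappa>: "\<kappa> = reflection D (\<alpha> i) (\<alpha> j) + (of_nat (y - s) * of_nat (k i)) *E a"
    by (simp add: \<kappa>_def refl star_eq ci E.scale_right_distrib add_ac)
  have refl_w: "reflection D (\<alpha> i) \<circ> id \<in> weyl_group D"
    by (intro weyl_reflection i weyl_group.intros(1))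
  obtain x where x: "reflection D (\<alpha> i) (\<alpha> j) = comb x"
    using weyl_orbit_coordinates[OF refl_w A'(4)] A'(2) by auto
  have invol: "reflection D (\<alpha> i) (reflection D (\<alpha> i) (\<alpha> j)) = \<alpha> j"
    unfolding refl using reflection_self[OF norm2_nonzero[OF i]]
    by (simp add: reflection_linear) (simp add: refl)
  have "J \<kappa> \<kappa> = J (reflection D (\<alpha> i) (\<alpha> j)) (reflection D (\<alpha> i) (\<alpha> j))"
    unfolding \<kappa> refl using J_a_simple[OF i] J_a_simple[OF A'(4)] J_sym[of "\<alpha> i" a] J_sym[of "\<alpha> j" a] A'(2)
    by (simp add: J_add J_scale J_a_a)
  then have "J \<kappa> \<kappa> \<noteq> 0"
    using reflection_isometry[OF norm2_nonzero[OF i]] norm2_nonzero[OF A'(4)] A'(2) by simp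
  moreover have "\<kappa> \<notin> R_kg D"
  proof
    assume "\<kappa> \<in> R_kg D"
    then obtain w g n where w: "w \<in> weyl_group D" "g \<le> l"
        "of_nat (y - s) * of_nat (k i) = (of_int n * of_nat (k g) :: complex)"
        "w (\<alpha> g) = comb x \<or> 2 *E w (\<alpha> g) = comb x"
      unfolding \<kappa> x by (metis R_kg_comb)
    define w' where "w' = reflection D (\<alpha> i) \<circ> w"
    have w': "w' \<in> weyl_group D"
      unfolding w'_def by (rule weyl_reflection[OF i w(1)])
    show False
    proof (cases "w (\<alpha> g) = comb x")
      case True
      then have "w' (\<alpha> g) = \<alpha> j'"
        using invol x A'(2) by (simp add: w'_def)
      then have kg: "k g = k i * y"
        using weyl_invariant_k_g(1)[OF w' A'(4) w(2)] A'(5) by simp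
      have "of_int (int (y - s) * int (k i)) = (of_int (n * int (k i) * int y) :: complex)"
        using w(3) unfolding kg by simp
      then have "int (y - s) * int (k i) = n * int (k i) * int y"
        using of_int_eq_iff by blast
      then have "int (y - s) = n * int y"
        using k_pos[OF i] by simp
      then have "int y dvd int (y - s)"
        by simp
      then have "y dvd y - s"
        by simp
      then show False
        using s by (simp add: nat_dvd_not_less)
    next
      case False
      then have "2 *E w' (\<alpha> g) = \<alpha> j'"
        using w(4) invol x A'(2) by (simp add: w'_def reflection_linear[symmetric])
      then have "w' (\<alpha> g) = of_real (1 / 2) *E \<alpha> j'"
        by (metis E.scale_scale E.scale_one mult.commute nonzero_eq_divide_eq of_real_1
            of_real_divide of_real_numeral zero_neq_numeral)
      then show False
        using multiple_in_orbit[OF w' w(2) A'(4)] by fastforce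
    qed
  qed
  ultimately show ?thesis
    by blast
qed

text \<open>The translations reach all roots over \<open>\<alpha>\<close> and \<open>2 \<alpha>\<close> from \<open>\<alpha>\<close> and \<open>\<alpha>\<^sup>*\<close>: when their step is twice
  the spacing, \<open>\<alpha>\<close> and \<open>\<alpha>\<^sup>*\<close> start the two residue classes if \<open>c(\<alpha>) = 1\<close>, and over \<open>2 \<alpha>\<close> only the odd class,
  that of \<open>\<alpha>\<^sup>*\<close>, occurs.\<close>

lemma R_kg_induct [consumes 1, case_names base reflect]:
  assumes "\<mu> \<in> R_kg D"
    and base: "\<And>\<rho>. \<rho> \<in> B_plus D \<Longrightarrow> Q \<rho>"
    and reflect: "\<And>\<rho> \<nu>. \<rho> \<in> B_plus D \<Longrightarrow> Q \<nu> \<Longrightarrow> Q (reflection D \<rho> \<nu>)"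
  shows "Q \<mu>"
proof -
  let ?d = "\<lambda>i x. 2 * x * of_nat (k i) / of_nat (c i)"
  have translate: "Q (x *E \<alpha> i + (t + of_int n * ?d i x) *E a)"
    if i: "i \<le> l" and "Q (x *E \<alpha> i + t *E a)" for i x t n
  proof (induction n rule: int_induct[where k = 0])
    case base
    then show ?case
      using that by simp
  next
    case (step1 n)
    have "Q (reflection D (star D (\<alpha> i)) (reflection D (\<alpha> i)
        (x *E \<alpha> i + (t + of_int n * ?d i x) *E a)))"
      using i by (intro reflect step1) (auto simp: B_plus_cases)
    moreover have eq: "t + of_int n * ?d i x + ?d i x =
        t + of_int (n + 1) * ?d i x"
      by (simp add: distrib_right add_divide_distrib)
    ultimately show ?case
      unfolding reflection_translation[OF i] eq by blast
  next
    case (step2 n)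
    have "Q (reflection D (\<alpha> i) (reflection D (star D (\<alpha> i))
        (x *E \<alpha> i + (t + of_int n * ?d i x) *E a)))"
      using i by (intro reflect step2) (auto simp: B_plus_cases)
    moreover have eq: "t + of_int n * ?d i x - ?d i x =
        t + of_int (n - 1) * ?d i x"
      by (simp add: left_diff_distrib diff_divide_distrib)
    ultimately show ?case
      unfolding reflection_translation[OF i] eq by blast
  qed
  have simple: "Q (\<alpha> i + (of_int n * of_nat (k i)) *E a)" if i: "i \<le> l" for i n
  proof -
    have Q: "Q (1 *E \<alpha> i + 0 *E a)" "Q (star D (\<alpha> i))"
      using base i by (auto simp: B_plus_cases)
    consider "c i = 2" | "c i = 1" "even n" | "c i = 1" "odd n"
      using c_g_cases[OF i] by auto
    then show ?thesis
    proof cases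
      case 1
      then show ?thesis
        using translate[OF i Q(1), of n] by simp
    next
      case 2
      then obtain m where "n = 2 * m"
        by blast
      then show ?thesis
        using translate[OF i Q(1), of m] 2 by (simp add: mult_ac)
    next
      case 3
      then obtain m where "n = 2 * m + 1"
        using oddE by blast
      moreover have "Q (1 *E \<alpha> i + of_nat (k i) *E a)"
        using Q(2) 3 by (simp add: star_eq)
      ultimately show ?thesis
        using translate[OF i, of 1 "of_nat (k i)" m] 3 by (simp add: algebra_simps)
    qed
  qed
  have double: "Q (2 *E \<alpha> i + (of_int n * of_nat (k i)) *E a)"
    if i: "i \<le> l" and n: "n \<in> e_g D (\<alpha> i)" for i n
  proof -
    have c: "c i = 2" "odd n"
      using c_g_cases[OF i] n by auto
    then obtain m where "n = 2 * m + 1"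
      using oddE by blast
    moreover have "Q (2 *E \<alpha> i + of_nat (k i) *E a)"
    proof -
      have "Q (star D (\<alpha> i))"
        using base i B_plus_cases by blast
      then show ?thesis
        by (simp add: star_eq c)
    qed
    ultimately show ?thesis
      using translate[OF i, of 2 "of_nat (k i)" m] c by (simp add: algebra_simps)
  qed
  have weyl: "Q (w \<nu>)" if "w \<in> weyl_group D" "Q \<nu>" for w \<nu>
    using that
  proof induction
    case (2 \<beta> w)
    then show ?case
      using reflect[of \<beta>] by (auto simp: B_plus_def)
  qed simp
  obtain w \<beta> z where w: "w \<in> weyl_group D" "\<beta> \<in> simple_roots D" "\<mu> = w z"
    and z: "z \<in> {\<beta> + (of_int n * of_nat (e_k D \<beta>)) *E a | n. True} \<union>
      {2 *E \<beta> + (of_int n * of_nat (e_k D \<beta>)) *E a | n. n \<in> e_g D \<beta>}"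
    using assms(1) unfolding R_kg_def by blast
  obtain i where i: "i \<le> l" "\<beta> = \<alpha> i"
    using w(2) simple_root_cases by blast
  have "Q z"
    using z simple[OF i(1)] double[OF i(1)] unfolding i(2) by auto
  then show ?thesis
    using weyl w(1,3) by simp
qed

end

section \<open>Chevalley families and their normalisation\<close>

context qebs_base
begin

lemma B_plus_not_negative:
  assumes "\<mu> \<in> B_plus D" "\<nu> \<in> B_plus D"
  shows "\<mu> + \<nu> \<noteq> 0"
proof
  assume sum: "\<mu> + \<nu> = 0"
  have form: "\<exists>i\<le>l. \<exists>n t. 0 < n \<and> \<rho> = of_nat n *E \<alpha> i + t *E a" if \<rho>: "\<rho> \<in> B_plus D" for \<rho>
  proof -
    obtain i where i: "i \<le> l" "\<rho> = \<alpha> i \<or> \<rho> = star D (\<alpha> i)"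
      using \<rho> unfolding B_plus_cases by blast
    have "\<exists>n t. 0 < n \<and> \<alpha> i = of_nat n *E \<alpha> i + t *E a"
      by (rule exI[of _ 1], rule exI[of _ 0]) simp
    moreover have "\<exists>n t. 0 < n \<and> star D (\<alpha> i) = of_nat n *E \<alpha> i + t *E a"
      unfolding star_eq by (rule exI[of _ "c i"], rule exI[of _ "of_nat (k i)"]) simp
    ultimately show ?thesis
      using i by blast
  qed
  obtain i n s where i: "i \<le> l" "0 < n" "\<mu> = of_nat n *E \<alpha> i + s *E a"
    using form[OF assms(1)] by blast
  obtain j m t where j: "j \<le> l" "0 < m" "\<nu> = of_nat m *E \<alpha> j + t *E a"
    using form[OF assms(2)] by blast
  define x where "x = (\<lambda>k. (if k = i then of_nat n else 0) + (if k = j then of_nat m else (0 :: complex)))"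
  have "comb x = of_nat n *E \<alpha> i + of_nat m *E \<alpha> j"
    by (simp only: scale_simple i(1) j(1) comb_add x_def)
  then have "comb x + (s + t) *E a = \<mu> + \<nu>"
    by (simp add: i(3) j(3) E.scale_left_distrib)
  also have "\<dots> = comb (\<lambda>_. 0) + 0 *E a"
    by (simp add: sum comb_def)
  finally have "x i = 0"
    by (rule comb_unique(2)[OF _ i(1)])
  then have "of_nat (n + (if i = j then m else 0)) = (0 :: complex)"
    by (simp add: x_def split: if_splits)
  then show False
    using i(2) by (simp only: of_nat_eq_0_iff)
qed

lemma star_not_simple:
  assumes "i \<le> l" "j \<le> l"
  shows "star D (\<alpha> i) \<noteq> \<alpha> j"
proof
  assume "star D (\<alpha> i) = \<alpha> j"
  then have "comb (\<lambda>m. if m = i then of_nat (c i) else 0) + of_nat (k i) *E a =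
      comb (\<lambda>m. if m = j then 1 else 0) + 0 *E a"
    using assms by (simp add: star_eq comb_single)
  then have "of_nat (k i) = (0 :: complex)"
    by (rule comb_unique)
  then show False
    using k_pos[OF assms(1)] by simp
qed

lemma star_inj:
  assumes "i \<le> l" "j \<le> l" "star D (\<alpha> i) = star D (\<alpha> j)"
  shows "i = j"
proof (rule ccontr)
  assume "i \<noteq> j"
  have "comb (\<lambda>m. if m = i then of_nat (c i) else 0) + of_nat (k i) *E a =
      comb (\<lambda>m. if m = j then of_nat (c j) else 0) + of_nat (k j) *E a"
    using assms by (simp add: star_eq comb_single)
  from comb_unique(2)[OF this assms(1)] show False
    using \<open>i \<noteq> j\<close> by simp
qed

lemma J_coroot_star:
  assumes "i \<le> l" "j \<le> l"
  shows "J (coroot D (star D (\<alpha> i))) (\<alpha> j) = of_int (gcm i j) / of_nat (c i)"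
proof -
  have "J (star D (\<alpha> i)) (\<alpha> j) = of_nat (c i) * J (\<alpha> i) (\<alpha> j)"
    using J_multiples[OF assms, of "of_nat (c i)" "of_nat (k i)" 1 0] by (simp add: star_eq)
  then have "J (coroot D (star D (\<alpha> i))) (\<alpha> j) =
      of_nat (c i) * (2 * J (\<alpha> i) (\<alpha> j)) / ((of_nat (c i))\<^sup>2 * norm2 i)"
    by (simp add: J_coroot J_star[OF assms(1)])
  then show ?thesis
    unfolding J_simple[OF assms] using norm2_nonzero[OF assms(1)] by (simp add: power2_eq_square)
qed

lemma J_coroot_simple_star:
  assumes "i \<le> l" "j \<le> l"
  shows "J (coroot D (\<alpha> i)) (star D (\<alpha> j)) = of_nat (c j) * of_int (gcm i j)"
proof -
  have "J (\<alpha> i) (star D (\<alpha> j)) = of_nat (c j) * J (\<alpha> i) (\<alpha> j)"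
    using J_multiples[OF assms, of 1 0 "of_nat (c j)" "of_nat (k j)"] by (simp add: star_eq)
  then show ?thesis
    using J_coroot_simple[OF assms] norm2_nonzero[OF assms(1)] by (simp add: J_coroot field_simps)
qed

end

locale realised_base_system = eala_weights L D \<phi> + qebs_odd D
  for L :: "'l::ab_group_add lie_triple" and D :: "'e::ab_group_add base_system"
    and \<phi> :: "'e \<Rightarrow> 'l \<Rightarrow> complex" +
  assumes roots: "\<phi> ` R_kg D = nonisotropic_roots L"
begin

lemma real_root_iff_R: "real_root \<mu> \<longleftrightarrow> \<mu> \<in> R_kg D"
  unfolding real_root_iff roots[symmetric] using phi_inj by (auto dest: injD)

lemma RS_not_root: "J \<kappa> \<kappa> \<noteq> 0 \<Longrightarrow> \<kappa> \<notin> R_kg D \<Longrightarrow> RS \<kappa> = {0}"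
  using real_root_iff_R by (auto simp: real_root_def)

lemma RS_minus_zero:
  assumes "RS \<mu> = {0}"
  shows "RS (- \<mu>) = {0}"
proof -
  have "x = 0" if x: "x \<in> RS (- \<mu>)" for x
  proof (rule ccontr)
    assume "x \<noteq> 0"
    then obtain y where "y \<in> RS (- (- \<mu>))" "\<B> x y = 1"
      using RS_pairing[OF x] by blast
    then show False
      using assms by simp
  qed
  then show ?thesis
    using zero_in_RS[of "- \<mu>"] by blast
qed

lemma B_plus_real_root: "\<mu> \<in> B_plus D \<Longrightarrow> real_root \<mu>"
  using B_plus_subset_R real_root_iff_R by blast

lemma B_all_real_root: "\<mu> \<in> B_all D \<Longrightarrow> real_root \<mu>"
  using B_plus_real_root real_root_minus by (auto simp: B_all_def)

definition chevalley_family :: "('e \<Rightarrow> 'l) \<Rightarrow> bool" where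
  "chevalley_family e \<longleftrightarrow> (\<forall>\<mu>\<in>B_plus D. chevalley_pair \<mu> (e \<mu>) (e (- \<mu>)))"

lemma chevalley_family_pair:
  "chevalley_family e \<Longrightarrow> \<mu> \<in> B_all D \<Longrightarrow> chevalley_pair \<mu> (e \<mu>) (e (- \<mu>))"
  using chevalley_pair_swap unfolding chevalley_family_def B_all_def by fastforce

lemma chevalley_family_RS: "chevalley_family e \<Longrightarrow> \<mu> \<in> B_all D \<Longrightarrow> e \<mu> \<in> RS \<mu>"
  using chevalley_family_pair by (auto simp: chevalley_pair_def)

lemma chevalley_family_nonzero: "chevalley_family e \<Longrightarrow> \<mu> \<in> B_all D \<Longrightarrow> e \<mu> \<noteq> 0"
  using chevalley_family_pair chevalley_pair_nonzero by blast

lemma B_plus_minus: "\<mu> \<in> B_plus D \<Longrightarrow> - \<mu> \<notin> B_plus D"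
  using B_plus_not_negative[of \<mu> "- \<mu>"] by auto

lemma chevalley_family_exists: obtains e where "chevalley_family e"
proof -
  have "\<forall>\<mu>\<in>B_plus D. \<exists>P. chevalley_pair \<mu> (fst P) (snd P)"
    using chevalley_pair_exists[OF B_plus_real_root] by (metis fst_conv snd_conv)
  then obtain P where P: "\<forall>\<mu>\<in>B_plus D. chevalley_pair \<mu> (fst (P \<mu>)) (snd (P \<mu>))"
    by (rule bchoice[THEN exE])
  show ?thesis
    using that[of "\<lambda>\<mu>. if \<mu> \<in> B_plus D then fst (P \<mu>) else snd (P (- \<mu>))"] P B_plus_minus
    by (simp add: chevalley_family_def)
qed

text \<open>The inverse factor at a negative root keeps the pairs normalised.\<close>

definition rescale :: "('e \<Rightarrow> complex) \<Rightarrow> ('e \<Rightarrow> 'l) \<Rightarrow> 'e \<Rightarrow> 'l" where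
  "rescale z e \<mu> = (if \<mu> \<in> B_plus D then z \<mu> *L e \<mu> else inverse (z (- \<mu>)) *L e \<mu>)"

lemma chevalley_family_rescale:
  assumes "chevalley_family e" "\<And>\<mu>. z \<mu> \<noteq> 0"
  shows "chevalley_family (rescale z e)"
  using assms chevalley_pair_scale B_plus_minus by (simp add: chevalley_family_def rescale_def)

text \<open>For a non-acute angle \<open>\<nu> - \<mu>\<close> is not a root, so the \<open>\<mu>\<close>-string starts at \<open>\<nu>\<close> and its length is
  the exponent; for an acute angle \<open>\<nu> + \<mu>\<close> is not a root.\<close>

lemma serre_relation:
  assumes e: "chevalley_family e" and \<mu>: "\<mu> \<in> B_all D" and \<nu>: "\<nu> \<in> B_all D"
    and ne: "\<mu> \<noteq> \<nu>" "\<mu> + \<nu> \<noteq> 0"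
  shows "(br (e \<mu>) ^^ serre_exponent D \<mu> \<nu>) (e \<nu>) = 0"
proof (cases "Re (J (coroot D \<mu>) \<nu>) \<le> 0")
  case True
  then have zero: "RS (\<nu> - \<mu>) = {0}"
    using base_difference_not_root[OF \<mu> \<nu> ne] RS_not_root by blast
  obtain m :: nat where "J (coroot D \<mu>) \<nu> = - of_nat m" "(br (e \<mu>) ^^ Suc m) (e \<nu>) = 0"
    by (rule root_string[OF chevalley_family_pair[OF e \<mu>] chevalley_family_RS[OF e \<nu>]
        chevalley_family_nonzero[OF e \<nu>] zero])
  moreover have "serre_exponent D \<mu> \<nu> = Suc m" if "J (coroot D \<mu>) \<nu> = - of_nat m"
    using that floor_of_int[of "- int m", where ?'a = real]
    by (simp add: serre_exponent_def Let_def nat_add_distrib)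
  ultimately show ?thesis
    by simp
next
  case False
  then have "Re (J (coroot D (- \<mu>)) \<nu>) \<le> 0"
    by (simp add: coroot_minus J_minus)
  moreover have "- \<mu> \<noteq> \<nu>" "- \<mu> + \<nu> \<noteq> 0"
    using ne by (auto simp: eq_neg_iff_add_eq_0 add.commute)
  ultimately have "RS (\<nu> - - \<mu>) = {0}"
    using base_difference_not_root[OF B_all_minus[OF \<mu>] \<nu>] RS_not_root by blast
  moreover have "br (e \<mu>) (e \<nu>) \<in> RS (\<mu> + \<nu>)"
    by (intro RS_bracket chevalley_family_RS e \<mu> \<nu>)
  ultimately have "br (e \<mu>) (e \<nu>) = 0"
    by (simp add: add.commute)
  moreover have "serre_exponent D \<mu> \<nu> = 1"
    using False by (simp add: serre_exponent_def Let_def floor_less_iff)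
  ultimately show ?thesis
    by simp
qed

lemma B_plus_in_B_all: "\<mu> \<in> B_plus D \<Longrightarrow> \<mu> \<in> B_all D"
  by (simp add: B_all_def)

lemma simple_in_B: "i \<le> l \<Longrightarrow> \<alpha> i \<in> B_plus D" "i \<le> l \<Longrightarrow> star D (\<alpha> i) \<in> B_plus D"
  by (auto simp: B_plus_cases)

lemma inner_relation:
  assumes e: "chevalley_family e" and A: "(\<beta>, \<gamma>, y) \<in> A_triples D" and s: "1 \<le> s" "s < y"
  shows "(br (e \<beta>) ^^ s) ((br (e (star D \<beta>)) ^^ (y - s)) (e \<gamma>)) = 0"
    "(br (e (- \<beta>)) ^^ s) ((br (e (- star D \<beta>)) ^^ (y - s)) (e (- \<gamma>))) = 0"
proof -
  obtain i j where ij: "\<beta> = \<alpha> i" "\<gamma> = \<alpha> j" "i \<le> l" "j \<le> l"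
    using A_triple[OF A] by metis
  define \<kappa> where "\<kappa> = of_nat s *E \<alpha> i + (of_nat (y - s) *E star D (\<alpha> i) + \<alpha> j)"
  have "\<kappa> \<notin> R_kg D \<and> J \<kappa> \<kappa> \<noteq> 0"
    using serre_inner_not_root[OF _ ij(3) s, of j] A ij unfolding \<kappa>_def by blast
  then have zero: "RS \<kappa> = {0}" "RS (- \<kappa>) = {0}"
    using RS_not_root RS_minus_zero by blast+
  note B = B_plus_in_B_all[OF simple_in_B(1)] B_plus_in_B_all[OF simple_in_B(2)]
  have "(br (e \<beta>) ^^ s) ((br (e (star D \<beta>)) ^^ (y - s)) (e \<gamma>)) \<in> RS \<kappa>"
    unfolding ij(1,2) \<kappa>_def by (intro RS_funpow chevalley_family_RS e B ij)
  moreover have "(br (e (- \<beta>)) ^^ s) ((br (e (- star D \<beta>)) ^^ (y - s)) (e (- \<gamma>)))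
      \<in> RS (of_nat s *E (- \<alpha> i) + (of_nat (y - s) *E (- star D (\<alpha> i)) + - \<alpha> j))"
    unfolding ij(1,2) by (intro RS_funpow chevalley_family_RS e B_all_minus B ij)
  moreover have "of_nat s *E (- \<alpha> i) + (of_nat (y - s) *E (- star D (\<alpha> i)) + - \<alpha> j) = - \<kappa>"
    by (simp add: \<kappa>_def)
  ultimately show "(br (e \<beta>) ^^ s) ((br (e (star D \<beta>)) ^^ (y - s)) (e \<gamma>)) = 0"
    "(br (e (- \<beta>)) ^^ s) ((br (e (- star D \<beta>)) ^^ (y - s)) (e (- \<gamma>))) = 0"
    using zero by simp_all
qed

text \<open>The values of the two sides of the linking relations, for the root vectors of positive and of
  negative roots.\<close>

definition link_left where
  "link_left e \<beta> \<gamma> y = of_nat (c_of D \<beta>) *L (br (e (star D \<beta>)) ^^ y) (e \<gamma>)"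

definition link_right where
  "link_right e \<beta> \<gamma> y = (br (e \<beta>) ^^ (c_of D \<beta> * y)) (e (star D \<gamma>))"

definition neg_link_left where
  "neg_link_left e \<beta> \<gamma> y = ((- 1) ^ (c_of D \<beta> + 1) * of_nat (c_of D \<beta>)) *L
     (br (e (- star D \<beta>)) ^^ y) (e (- \<gamma>))"

definition neg_link_right where
  "neg_link_right e \<beta> \<gamma> y = (br (e (- \<beta>)) ^^ (c_of D \<beta> * y)) (e (- star D \<gamma>))"

definition linked where
  "linked e \<beta> \<gamma> y \<longleftrightarrow> link_right e \<beta> \<gamma> y = link_left e \<beta> \<gamma> y \<and>
     neg_link_left e \<beta> \<gamma> y = neg_link_right e \<beta> \<gamma> y"

lemma string_factor_nonzero:
  "n \<le> m \<Longrightarrow> (\<Prod>i<n. of_nat (Suc i) * (of_nat m - of_nat i)) \<noteq> (0 :: complex)"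
  by (auto simp del: of_nat_Suc)

text \<open>Both sides span the root space of \<open>\<gamma> + y \<beta>\<^sup>*\<close>, so they differ by a factor \<open>\<rho>\<close>. The pairings
  of the positive with the negative side are determined by the sl2-strings, and agree; hence the
  same \<open>\<rho>\<close> relates the negative sides.\<close>

lemma link_ratio:
  assumes e: "chevalley_family e" and A: "(\<beta>, \<gamma>, y) \<in> A_triples D"
  shows "\<exists>\<rho>. \<rho> \<noteq> 0 \<and> link_left e \<beta> \<gamma> y \<noteq> 0 \<and> link_right e \<beta> \<gamma> y = \<rho> *L link_left e \<beta> \<gamma> y \<and>
    neg_link_left e \<beta> \<gamma> y = \<rho> *L neg_link_right e \<beta> \<gamma> y"
proof -
  obtain i j m where A': "\<beta> = \<alpha> i" "\<gamma> = \<alpha> j" "i \<le> l" "j \<le> l" "i \<noteq> j" "1 \<le> y" "k j = k i * y"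
      "gcm j i = - 1" "gcm i j = - int m" "1 \<le> m" "m \<le> 3" "y dvd m" "c j = 1"
      "c i = 2 \<Longrightarrow> y = 1 \<and> m = 2"
    using A_triple[OF A] by metis
  note ij = A'(1-4)
  have "y \<le> m"
    using A'(10,12) by (intro dvd_imp_le) auto
  note B = simple_in_B(1)[OF ij(3)] simple_in_B(2)[OF ij(3)] simple_in_B(1)[OF ij(4)]
    simple_in_B(2)[OF ij(4)]
  note in_B = B[THEN B_plus_in_B_all]
  note in_RS = in_B[THEN chevalley_family_RS[OF e]]
    in_B[THEN B_all_minus, THEN chevalley_family_RS[OF e]]
  note pairs = in_B[THEN chevalley_family_pair[OF e]]
  define \<kappa> where "\<kappa> = of_nat y *E star D (\<alpha> i) + \<alpha> j"
  have \<kappa>': "\<kappa> = of_nat (c i * y) *E \<alpha> i + star D (\<alpha> j)"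
    by (simp add: \<kappa>_def star_eq A'(7,13) E.scale_right_distrib mult.commute add_ac)
  have XL: "link_left e \<beta> \<gamma> y \<in> RS \<kappa>" and XR: "link_right e \<beta> \<gamma> y \<in> RS \<kappa>"
    unfolding link_left_def link_right_def ij(1,2)
    by (simp_all only: RS_scale RS_funpow in_RS \<kappa>_def) (simp only: \<kappa>_def[symmetric] \<kappa>' RS_funpow in_RS)
  have minus: "- \<kappa> = of_nat y *E (- star D (\<alpha> i)) + - \<alpha> j"
      "- \<kappa> = of_nat (c i * y) *E (- \<alpha> i) + - star D (\<alpha> j)"
    by (simp add: \<kappa>_def) (simp add: \<kappa>')
  have YL: "neg_link_left e \<beta> \<gamma> y \<in> RS (- \<kappa>)"
    unfolding neg_link_left_def ij(1,2) minus(1) by (intro RS_scale RS_funpow in_RS)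
  have YR: "neg_link_right e \<beta> \<gamma> y \<in> RS (- \<kappa>)"
    unfolding neg_link_right_def ij(1,2) minus(2) by (intro RS_funpow in_RS)
  have kills: "br (e (star D (\<alpha> i))) (e (- \<alpha> j)) = 0" "br (e (\<alpha> i)) (e (- star D (\<alpha> j))) = 0"
  proof -
    have zero: "br (e \<mu>) (e (- \<nu>)) = 0"
      if \<mu>\<nu>: "\<mu> \<in> B_plus D" "\<nu> \<in> B_plus D" and neg: "Re (J (coroot D \<mu>) \<nu>) \<le> 0" for \<mu> \<nu>
    proof -
      have "\<mu> \<noteq> \<nu>"
        using neg B_plus_norm[OF \<mu>\<nu>(1)] by (auto simp: J_coroot)
      then have "RS (- (\<nu> - \<mu>)) = {0}"
        using base_difference_not_root[OF \<mu>\<nu>[THEN B_plus_in_B_all] _ _ neg] B_plus_not_negative[OF \<mu>\<nu>]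
          RS_not_root RS_minus_zero by blast
      moreover have "br (e \<mu>) (e (- \<nu>)) \<in> RS (\<mu> + - \<nu>)"
        using \<mu>\<nu>[THEN B_plus_in_B_all] by (intro RS_bracket chevalley_family_RS e B_all_minus)
      ultimately show ?thesis
        by simp
    qed
    have "Re (of_int (gcm i j) / of_nat (c i)) \<le> 0"
      using A'(9) by (simp add: Re_divide_of_nat)
    then show "br (e (star D (\<alpha> i))) (e (- \<alpha> j)) = 0"
      using zero[OF B(2,3)] by (simp add: J_coroot_star ij)
    show "br (e (\<alpha> i)) (e (- star D (\<alpha> j))) = 0"
      using zero[OF B(1,4)] A'(9,13) by (simp add: J_coroot_simple_star ij)
  qed
  define N where "N = 2 / norm2 j"
  have N: "\<B> (e (\<alpha> j)) (e (- \<alpha> j)) = N" "\<B> (e (star D (\<alpha> j))) (e (- star D (\<alpha> j))) = N" "N \<noteq> 0"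
    using pairs(3,4) norm2_nonzero[OF ij(4)]
    by (simp_all add: chevalley_pair_def N_def J_star[OF ij(4)] A'(13))
  have pairing: "\<B> (link_left e \<beta> \<gamma> y) (neg_link_left e \<beta> \<gamma> y) =
      \<B> (link_right e \<beta> \<gamma> y) (neg_link_right e \<beta> \<gamma> y) \<and>
    \<B> (link_left e \<beta> \<gamma> y) (neg_link_left e \<beta> \<gamma> y) \<noteq> 0"
  proof -
    consider "c i = 1" | "c i = 2" "y = 1" "m = 2"
      using c_g_cases[OF ij(3)] A'(14) by blast
    then show ?thesis
    proof cases
      \<comment> \<open>Both strings have the highest weight \<open>m\<close>, and both sides are reached after \<open>y\<close> steps.\<close>
      case 1
      have left: "J (coroot D (star D (\<alpha> i))) (\<alpha> j) = - of_nat m"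
        using A'(9) 1 by (simp add: J_coroot_star ij)
      have right: "J (coroot D (\<alpha> i)) (star D (\<alpha> j)) = - of_nat m"
        using A'(9,13) by (simp add: J_coroot_simple_star ij)
      define P :: complex where "P = (\<Prod>i<y. of_nat (Suc i) * (of_nat m - of_nat i))"
      have "P \<noteq> 0"
        unfolding P_def by (rule string_factor_nonzero[OF \<open>y \<le> m\<close>])
      then show ?thesis
        using string_pairing[OF pairs(2) in_RS(7) kills(1) left, of y "e (\<alpha> j)", folded P_def]
          string_pairing[OF pairs(1) in_RS(8) kills(2) right, of y "e (star D (\<alpha> j))", folded P_def] N
        by (simp add: link_left_def link_right_def neg_link_left_def neg_link_right_def ij 1 form_scale)
    next
      \<comment> \<open>The left string is a doublet and the right one a triplet; the coefficients \<open>2\<close> and \<open>- 2\<close> on the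
        left compensate, and both pairings are \<open>4 N\<close>.\<close>
      case 2
      have left: "J (coroot D (star D (\<alpha> i))) (\<alpha> j) = - of_nat 1"
        using A'(9) 2 by (simp add: J_coroot_star ij)
      have right: "J (coroot D (\<alpha> i)) (star D (\<alpha> j)) = - of_nat 2"
        using A'(9,13) 2 by (simp add: J_coroot_simple_star ij)
      show ?thesis
        using string_pairing[OF pairs(2) in_RS(7) kills(1) left, of 1 "e (\<alpha> j)"]
          string_pairing[OF pairs(1) in_RS(8) kills(2) right, of 2 "e (star D (\<alpha> j))"] N
        by (simp add: link_left_def link_right_def neg_link_left_def neg_link_right_def ij 2
            form_scale form_minus numeral_2_eq_2)
    qed
  qed
  have "J \<kappa> \<kappa> \<noteq> 0"
  proof -
    have nj: "norm2 j = of_nat m * norm2 i"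
      using J_simple[OF ij(3,4)] J_simple[OF ij(4,3)] J_sym[of "\<alpha> i" "\<alpha> j"] A'(8,9) by simp
    have "\<kappa> = of_nat (c i * y) *E \<alpha> i + 0 *E a + (1 *E \<alpha> j + of_nat (k j) *E a)"
      by (simp add: \<kappa>' star_eq A'(13))
    then have "J \<kappa> \<kappa> = of_nat (c i * y) ^ 2 * norm2 i + norm2 j
        + of_nat (c i * y) * (2 * J (\<alpha> i) (\<alpha> j))"
      using J_sym[of "\<alpha> j" "\<alpha> i"]
      by (simp only: J_add(1)[of _ "_ + 0 *E a"] J_add(2)[of "_ + 0 *E a"] J_multiples ij)
        (simp add: power2_eq_square)
    also have "\<dots> = of_int (int (c i * y) ^ 2 + int m - int (c i * y) * int m) * norm2 i"
      unfolding J_simple[OF ij(3,4)] A'(9) nj by (simp add: algebra_simps)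
    finally have J: "J \<kappa> \<kappa> = of_int (int (c i * y) ^ 2 + int m - int (c i * y) * int m) * norm2 i" .
    have "m = 1 \<or> m = 2 \<or> m = 3" "y = 1 \<or> y = 2 \<or> y = 3"
      using A'(6,10,11) \<open>y \<le> m\<close> by auto
    then have "int (c i * y) ^ 2 + int m - int (c i * y) * int m \<noteq> 0"
      using c_g_cases[OF ij(3)] A'(12,14) by (elim disjE conjE) simp_all
    then show ?thesis
      unfolding J using norm2_nonzero[OF ij(3)] by (simp only: mult_eq_0_iff of_int_eq_0_iff) simp
  qed
  have XL0: "link_left e \<beta> \<gamma> y \<noteq> 0" and YR0: "neg_link_right e \<beta> \<gamma> y \<noteq> 0"
    using pairing by (auto simp del: mult_eq_0_iff)
  have real: "real_root \<kappa>"
    by (rule real_rootI[OF \<open>J \<kappa> \<kappa> \<noteq> 0\<close> XL XL0])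
  obtain \<rho> where \<rho>: "link_right e \<beta> \<gamma> y = \<rho> *L link_left e \<beta> \<gamma> y"
    using real_root_space_one_dim[OF real XL XL0 XR] .
  obtain \<tau> where \<tau>: "neg_link_left e \<beta> \<gamma> y = \<tau> *L neg_link_right e \<beta> \<gamma> y"
    using real_root_space_one_dim[OF real_root_minus[OF real] YR YR0 YL] .
  have "\<tau> = \<rho>" "\<rho> \<noteq> 0"
    using pairing by (auto simp: \<rho> \<tau> form_scale)
  then show ?thesis
    using \<rho> \<tau> XL0 by blast
qed

lemma rescale_link:
  assumes \<beta>: "\<beta> \<in> simple_roots D" and \<gamma>: "\<gamma> \<in> simple_roots D"
    and z: "\<And>\<beta>. \<beta> \<in> simple_roots D \<Longrightarrow> z \<beta> = 1"
  shows "link_left (rescale z e) \<beta> \<gamma> y = z (star D \<beta>) ^ y *L link_left e \<beta> \<gamma> y"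
    "link_right (rescale z e) \<beta> \<gamma> y = z (star D \<gamma>) *L link_right e \<beta> \<gamma> y"
proof -
  have "rescale z e \<beta> = e \<beta>" "rescale z e \<gamma> = e \<gamma>"
      "rescale z e (star D \<beta>) = z (star D \<beta>) *L e (star D \<beta>)"
      "rescale z e (star D \<gamma>) = z (star D \<gamma>) *L e (star D \<gamma>)"
    using assms by (auto simp: rescale_def B_plus_def)
  then show "link_left (rescale z e) \<beta> \<gamma> y = z (star D \<beta>) ^ y *L link_left e \<beta> \<gamma> y"
    "link_right (rescale z e) \<beta> \<gamma> y = z (star D \<gamma>) *L link_right e \<beta> \<gamma> y"
    by (simp_all add: link_left_def link_right_def br_funpow_scale br_funpow_scale_left mult.commute)
qed

lemma complex_root_exists:
  fixes w :: complex
  assumes "w \<noteq> 0" "0 < n"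
  obtains v where "v \<noteq> 0" "v ^ n = w"
proof
  show "exp (Ln w / of_nat n) ^ n = w"
    using assms by (simp flip: exp_of_nat_mult)
qed simp

definition joined :: "nat \<Rightarrow> nat \<Rightarrow> bool" where
  "joined i j \<longleftrightarrow> (\<exists>p q. (i, j, p, q) \<in> set (tree_bonds (e_type D) l) \<or>
     (j, i, p, q) \<in> set (tree_bonds (e_type D) l))"

text \<open>The factors \<open>\<rho>\<close> can be absorbed into the vectors \<open>E\<^sub>\<alpha>\<^sub>*\<close>, one simple root after the other, for
  all the bonds of a tree.\<close>

lemma normalised_family_exists:
  obtains e where "chevalley_family e"
    "\<And>i j y. joined i j \<Longrightarrow> (\<alpha> i, \<alpha> j, y) \<in> A_triples D \<Longrightarrow> linked e (\<alpha> i) (\<alpha> j) y"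
proof -
  obtain e0 where e0: "chevalley_family e0"
    by (rule chevalley_family_exists)
  define \<rho> where "\<rho> i j y = (SOME r. r \<noteq> 0 \<and>
      link_right e0 (\<alpha> i) (\<alpha> j) y = r *L link_left e0 (\<alpha> i) (\<alpha> j) y)" for i j y
  have \<rho>: "\<rho> i j y \<noteq> 0 \<and>
      link_right e0 (\<alpha> i) (\<alpha> j) y = \<rho> i j y *L link_left e0 (\<alpha> i) (\<alpha> j) y"
    if "(\<alpha> i, \<alpha> j, y) \<in> A_triples D" for i j y
    unfolding \<rho>_def by (rule someI_ex) (use link_ratio[OF e0 that] in blast)
  \<comment> \<open>The conditions on the factors \<open>u\<close> of \<open>E\<^sub>\<alpha>\<^sub>i\<^sub>*\<close> and \<open>v\<close> of \<open>E\<^sub>\<alpha>\<^sub>j\<^sub>*\<close> under which the linking relations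
    between \<open>\<alpha> i\<close> and \<open>\<alpha> j\<close> hold.\<close>
  define C where "C i j u v \<longleftrightarrow>
      (\<forall>y. (\<alpha> i, \<alpha> j, y) \<in> A_triples D \<longrightarrow> v * \<rho> i j y = u ^ y) \<and>
      (\<forall>y. (\<alpha> j, \<alpha> i, y) \<in> A_triples D \<longrightarrow> u * \<rho> j i y = v ^ y)" for i j u v
  have y_unique: "y = y'" if le: "i \<le> l" and A: "(\<alpha> i, \<alpha> j, y) \<in> A_triples D" "(\<alpha> i, \<alpha> j, y') \<in> A_triples D"
    for i j y y'
  proof -
    have "k i * y = k i * y'"
      using A by (simp add: A_triples_def)
    then show ?thesis
      using k_pos[OF le] by simp
  qed
  \<comment> \<open>If both orientations of a bond carry a relation, the two relations are equivalent.\<close>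
  have opposite: "y = 1 \<and> y' = 1 \<and> \<rho> i j 1 * \<rho> j i 1 = 1"
    if le: "i \<le> l" "j \<le> l" and A: "(\<alpha> i, \<alpha> j, y) \<in> A_triples D" "(\<alpha> j, \<alpha> i, y') \<in> A_triples D" for i j y y'
  proof -
    have "k i * (y * y') = k i * 1"
      using A by (simp add: A_triples_def mult.assoc[symmetric])
    then have y: "y = 1" "y' = 1"
      using k_pos[OF le(1)] by simp_all
    have c: "c_of D (\<alpha> j) = 1" "c_of D (\<alpha> i) = 1"
      using A_triple[OF A(1)] A_triple[OF A(2)] by metis+
    let ?X = "link_left e0 (\<alpha> i) (\<alpha> j) 1"
    have "link_left e0 (\<alpha> j) (\<alpha> i) 1 = - link_right e0 (\<alpha> i) (\<alpha> j) 1"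
      "link_right e0 (\<alpha> j) (\<alpha> i) 1 = - ?X"
      using c br_anticommute[of "e0 (star D (\<alpha> j))" "e0 (\<alpha> i)"]
        br_anticommute[of "e0 (\<alpha> j)" "e0 (star D (\<alpha> i))"]
      by (simp_all add: link_left_def link_right_def)
    then have "?X = (\<rho> i j 1 * \<rho> j i 1) *L ?X"
      using \<rho>[OF A(1)] \<rho>[OF A(2)] unfolding y by (simp add: mult.commute)
    moreover have "?X \<noteq> 0"
      using link_ratio[OF e0 A(1)] unfolding y by blast
    ultimately have "\<rho> i j 1 * \<rho> j i 1 = 1"
      by (metis scale_cancel_right scale_one)
    with y show ?thesis
      by simp
  qed
  have solve: "\<exists>v\<in>{z. z \<noteq> 0}. C i j u v" if le: "i \<le> l" "j \<le> l" and u: "u \<noteq> 0" for i j u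
  proof -
    consider (forward) y where "(\<alpha> i, \<alpha> j, y) \<in> A_triples D"
      | (backward) y where "(\<alpha> j, \<alpha> i, y) \<in> A_triples D" "\<nexists>y. (\<alpha> i, \<alpha> j, y) \<in> A_triples D"
      | (none) "\<nexists>y. (\<alpha> j, \<alpha> i, y) \<in> A_triples D" "\<nexists>y. (\<alpha> i, \<alpha> j, y) \<in> A_triples D"
      by blast
    then show ?thesis
    proof cases
      case forward
      define v where "v = u ^ y / \<rho> i j y"
      have "v * \<rho> i j y' = u ^ y'" if "(\<alpha> i, \<alpha> j, y') \<in> A_triples D" for y'
        using y_unique[OF le(1) forward that] \<rho>[OF forward] by (simp add: v_def)
      moreover have "u * \<rho> j i y' = v ^ y'" if "(\<alpha> j, \<alpha> i, y') \<in> A_triples D" for y'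
        using opposite[OF le forward that] \<rho>[OF forward] by (auto simp: v_def field_simps)
      moreover have "v \<noteq> 0"
        using u \<rho>[OF forward] by (simp add: v_def)
      ultimately show ?thesis
        unfolding C_def by blast
    next
      case backward
      have "0 < y"
        using backward(1) by (simp add: A_triples_def)
      moreover have "u * \<rho> j i y \<noteq> 0"
        using u \<rho>[OF backward(1)] by simp
      ultimately obtain v where v: "v \<noteq> 0" "v ^ y = u * \<rho> j i y"
        using complex_root_exists by blast
      have "u * \<rho> j i y' = v ^ y'" if "(\<alpha> j, \<alpha> i, y') \<in> A_triples D" for y'
        using y_unique[OF le(2) backward(1) that] v by simp
      then show ?thesis
        unfolding C_def using backward(2) v(1) by blast
    next
      case none
      then show ?thesis
        unfolding C_def by (intro bexI[of _ 1]) auto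
    qed
  qed
  have C_sym: "C i j u v \<longleftrightarrow> C j i v u" for i j u v
    by (auto simp: C_def)
  obtain r where r: "grows {r} (tree_bonds (e_type D) l) {..l}"
    using tree_bonds_grow[OF rank] by blast
  have le: "i \<le> l" "j \<le> l" if "(i, j, p, q) \<in> set (tree_bonds (e_type D) l)" for i j p q
    using bonds_bounds[OF rank] tree_bonds_subset that by blast+
  have "\<exists>z. (\<forall>i. z i \<in> {z. z \<noteq> 0}) \<and> (\<forall>i\<in>{r}. z i = 1) \<and>
      (\<forall>(i, j, p, q)\<in>set (tree_bonds (e_type D) l). C i j (z i) (z j))"
  proof (rule grows_solve[OF r, where ?z0.0 = "\<lambda>_. 1"])
    fix i j p q and u :: complex
    assume bond: "(i, j, p, q) \<in> set (tree_bonds (e_type D) l)" and u: "u \<in> {z. z \<noteq> 0}"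
    show "\<exists>v\<in>{z. z \<noteq> 0}. C i j u v"
      using solve[OF le[OF bond], of u] u by simp
    show "\<exists>v\<in>{z. z \<noteq> 0}. C i j v u"
      using solve[OF le(2,1)[OF bond], of u] u unfolding C_sym[of i j _ u] by simp
  qed simp
  then obtain s where s: "\<And>i. s i \<noteq> 0"
      "\<And>i j p q. (i, j, p, q) \<in> set (tree_bonds (e_type D) l) \<Longrightarrow> C i j (s i) (s j)"
    by blast
  define z where "z \<mu> = (if \<exists>i\<le>l. \<mu> = star D (\<alpha> i) then s (THE i. i \<le> l \<and> \<mu> = star D (\<alpha> i)) else 1)" for \<mu>
  have z_star: "z (star D (\<alpha> i)) = s i" if "i \<le> l" for i
  proof -
    have "(THE i'. i' \<le> l \<and> star D (\<alpha> i) = star D (\<alpha> i')) = i"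
      by (rule the_equality) (use that star_inj in auto)
    then show ?thesis
      using that by (auto simp: z_def)
  qed
  have z_simple: "z \<beta> = 1" if "\<beta> \<in> simple_roots D" for \<beta>
    using that star_not_simple by (auto simp: z_def simple_root_cases) metis
  define e where "e = rescale z e0"
  have e: "chevalley_family e"
    unfolding e_def by (rule chevalley_family_rescale[OF e0]) (simp add: z_def s(1))
  show ?thesis
  proof (rule that[OF e])
    fix i j y
    assume bond: "joined i j" and A: "(\<alpha> i, \<alpha> j, y) \<in> A_triples D"
    have ij: "i \<le> l" "j \<le> l"
      using bond le unfolding joined_def by blast+
    have "C i j (s i) (s j)"
      using bond s(2) C_sym unfolding joined_def by blast
    then have "s j * \<rho> i j y = s i ^ y"
      using A by (simp add: C_def)
    moreover have "\<alpha> i \<in> simple_roots D" "\<alpha> j \<in> simple_roots D"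
      using ij simple_root_cases by blast+
    ultimately have right: "link_right e (\<alpha> i) (\<alpha> j) y = link_left e (\<alpha> i) (\<alpha> j) y"
      using \<rho>[OF A] by (simp add: e_def rescale_link z_simple z_star ij)
    obtain t where "link_left e (\<alpha> i) (\<alpha> j) y \<noteq> 0"
        "link_right e (\<alpha> i) (\<alpha> j) y = t *L link_left e (\<alpha> i) (\<alpha> j) y"
        "neg_link_left e (\<alpha> i) (\<alpha> j) y = t *L neg_link_right e (\<alpha> i) (\<alpha> j) y"
      using link_ratio[OF e A] by blast
    moreover from this have "t = 1"
      using right by (metis scale_cancel_right scale_one)
    ultimately show "linked e (\<alpha> i) (\<alpha> j) y"
      using right by (simp add: linked_def)
  qed
qed

lemma A_triple_bond:
  assumes "(\<alpha> i, \<alpha> j, y) \<in> A_triples D" "i \<le> l" "j \<le> l"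
  shows "\<exists>p q. (i, j, p, q) \<in> set (bonds (e_type D) l) \<or> (j, i, p, q) \<in> set (bonds (e_type D) l)"
proof -
  obtain i' j' m where "\<alpha> i = \<alpha> i'" "\<alpha> j = \<alpha> j'" "i' \<le> l" "j' \<le> l" "i' \<noteq> j'" "gcm j' i' = - 1"
    using A_triple[OF assms(1)] by metis
  then have "i \<noteq> j" "gcm j i < 0"
    using assms(2,3) simple_inj by auto
  then show ?thesis
    using affine_gcm_neg_iff[OF rank, of j i] by blast
qed

end

section \<open>Evaluating presentations in a Lie algebra\<close>

abbreviation monomials :: "'g free_alg \<Rightarrow> 'g magma set" where
  "monomials \<equiv> Poly_Mapping.keys"

abbreviation coefficient :: "'g free_alg \<Rightarrow> 'g magma \<Rightarrow> complex" where
  "coefficient \<equiv> Poly_Mapping.lookup"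

abbreviation monomial :: "'g magma \<Rightarrow> 'g free_alg" where
  "monomial t \<equiv> Poly_Mapping.single t 1"

context complex_lie_algebra
begin

primrec monomial_eval :: "('g \<Rightarrow> 'l) \<Rightarrow> 'g magma \<Rightarrow> 'l" where
  "monomial_eval v (Leaf x) = v x"
| "monomial_eval v (Br s t) = br (monomial_eval v s) (monomial_eval v t)"

definition alg_eval :: "('g \<Rightarrow> 'l) \<Rightarrow> 'g free_alg \<Rightarrow> 'l" where
  "alg_eval v f = (\<Sum>t\<in>monomials f. coefficient f t *L monomial_eval v t)"

lemma alg_eval_superset:
  assumes "finite K" "monomials f \<subseteq> K"
  shows "alg_eval v f = (\<Sum>t\<in>K. coefficient f t *L monomial_eval v t)"
  unfolding alg_eval_def using assms by (intro sum.mono_neutral_left) (auto simp: in_keys_iff)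

lemma alg_eval_add: "alg_eval v (f + g) = alg_eval v f + alg_eval v g"
proof -
  let ?K = "monomials f \<union> monomials g"
  have "alg_eval v (f + g) = (\<Sum>t\<in>?K. coefficient (f + g) t *L monomial_eval v t)"
    using keys_add[of f g] by (intro alg_eval_superset) auto
  then show ?thesis
    by (simp add: alg_eval_superset[of ?K] lookup_add scale_left_distrib sum.distrib)
qed

lemma alg_eval_scale: "alg_eval v (c \<cdot>\<^sub>F f) = c *L alg_eval v f"
proof -
  have "alg_eval v (c \<cdot>\<^sub>F f) =
      (\<Sum>t\<in>monomials f. coefficient (c \<cdot>\<^sub>F f) t *L monomial_eval v t)"
    by (intro alg_eval_superset) (auto simp: in_keys_iff)
  then show ?thesis
    by (simp add: alg_eval_def scale_sum_right)
qed

lemma alg_eval_zero [simp]: "alg_eval v 0 = 0"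
  by (simp add: alg_eval_def)

lemma alg_eval_diff: "alg_eval v (f - g) = alg_eval v f - alg_eval v g"
  using alg_eval_add[of v "f - g" g] by (simp add: eq_diff_eq)

lemma alg_eval_gen [simp]: "alg_eval v (gen_elt x) = v x"
  by (simp add: alg_eval_def gen_elt_def)

lemma alg_eval_mult: "alg_eval v (f \<star> g) = br (alg_eval v f) (alg_eval v g)"
proof -
  let ?F = "monomials f" and ?G = "monomials g"
  let ?Br = "\<lambda>(s, t). Br s t"
  have "monomials (f \<star> g) \<subseteq> ?Br ` (?F \<times> ?G)"
    by (auto simp: in_keys_iff split: magma.splits)
      (metis (no_types, lifting) case_prod_conv image_eqI in_keys_iff mem_Sigma_iff)
  then have "alg_eval v (f \<star> g) =
      (\<Sum>t\<in>?Br ` (?F \<times> ?G). coefficient (f \<star> g) t *L monomial_eval v t)"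
    by (intro alg_eval_superset) auto
  also have "\<dots> = (\<Sum>(s, t)\<in>?F \<times> ?G. (coefficient f s * coefficient g t) *L
      br (monomial_eval v s) (monomial_eval v t))"
    by (subst sum.reindex) (auto simp: inj_on_def intro!: sum.cong)
  also have "\<dots> = (\<Sum>s\<in>?F. \<Sum>t\<in>?G. br (coefficient f s *L monomial_eval v s)
      (coefficient g t *L monomial_eval v t))"
    by (simp add: sum.cartesian_product br_scale mult.commute)
  also have "\<dots> = br (alg_eval v f) (alg_eval v g)"
  proof -
    have left: "br (sum h A) y = (\<Sum>s\<in>A. br (h s) y)" for h :: "'g magma \<Rightarrow> 'l" and A y
      by (induction A rule: infinite_finite_induct) (simp_all add: br_add)
    show ?thesis
      by (simp only: alg_eval_def left br_sum) (rule sum.swap)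
  qed
  finally show ?thesis .
qed

lemma alg_eval_ad_pow: "alg_eval v (ad_pow f n g) = (br (alg_eval v f) ^^ n) (alg_eval v g)"
  by (induction n) (simp_all add: ad_pow_def alg_eval_mult)

text \<open>If all generators are even, there is no nonzero odd element, and the super identities become
  those of a Lie algebra.\<close>

lemma even_monomial: "leaves t \<subseteq> X \<Longrightarrow> (\<And>x. x \<in> X \<Longrightarrow> \<not> p x) \<Longrightarrow> \<not> odd_monomial p t"
  by (induction t) auto

lemma homogeneous_odd_zero:
  assumes "f \<in> free_alg_on X" "\<And>x. x \<in> X \<Longrightarrow> \<not> p x" "homogeneous p True f"
  shows "f = 0"
proof -
  have "monomials f = {}"
    using assms even_monomial[of _ X p] by (auto simp: free_alg_on_def homogeneous_def)
  then show ?thesis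
    by simp
qed

lemma alg_eval_lie_ideal:
  assumes even: "\<And>x. x \<in> X \<Longrightarrow> \<not> p x" and rel: "\<And>f. f \<in> Rel \<Longrightarrow> alg_eval v f = 0"
  shows "f \<in> lie_ideal X p Rel \<Longrightarrow> alg_eval v f = 0"
proof (induction rule: lie_ideal.induct)
  case (skew f g b b')
  have "f = 0" if b
    using homogeneous_odd_zero[OF skew(1) even] skew(3) that by simp
  then show ?case
    using br_anticommute[of "alg_eval v f" "alg_eval v g"]
    by (cases b) (simp_all add: alg_eval_add alg_eval_scale alg_eval_mult koszul_sign_def)
next
  case (jacobi f g h b b')
  have "f = 0" if b
    using homogeneous_odd_zero[OF jacobi(1) even] jacobi(4) that by simp
  then show ?case
    using br_jacobi[of "alg_eval v f" "alg_eval v g" "alg_eval v h"]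
    by (cases b) (simp_all add: alg_eval_diff alg_eval_scale alg_eval_mult koszul_sign_def)
qed (simp_all add: rel alg_eval_add alg_eval_scale alg_eval_mult)

definition coset_eval :: "('g \<Rightarrow> 'l) \<Rightarrow> 'g free_alg set \<Rightarrow> 'l" where
  "coset_eval v A = alg_eval v (SOME f. f \<in> A)"

lemma coset_eval:
  assumes even: "\<And>x. x \<in> X \<Longrightarrow> \<not> p x" and rel: "\<And>f. f \<in> Rel \<Longrightarrow> alg_eval v f = 0"
  shows "coset_eval v (coset (lie_ideal X p Rel) f) = alg_eval v f"
proof -
  define g where "g = (SOME g. g \<in> coset (lie_ideal X p Rel) f)"
  have "f \<in> coset (lie_ideal X p Rel) f"
    by (simp add: coset_def lie_ideal.zero)
  then have "g \<in> coset (lie_ideal X p Rel) f"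
    unfolding g_def by (rule someI)
  then have "alg_eval v (g - f) = 0"
    using alg_eval_lie_ideal[OF even rel] by (simp add: coset_def)
  then show ?thesis
    by (simp add: coset_eval_def g_def[symmetric] alg_eval_diff)
qed

end

lemma (in extended_affine_lie_algebra) presented_hom:
  assumes even: "\<And>x. x \<in> X \<Longrightarrow> \<not> p x" and Rel: "Rel \<subseteq> free_alg_on X"
    and rel: "\<And>f. f \<in> Rel \<Longrightarrow> alg_eval v f = 0"
  shows "lie_superalgebra_hom (presented X p Rel) (purely_even L) (coset_eval v)"
proof -
  let ?I = "lie_ideal X p Rel"
  have ev: "coset_eval v (coset ?I f) = alg_eval v f" for f
    by (rule coset_eval) (use even rel in auto)
  have carrier: "sa_carrier (presented X p Rel) = coset ?I ` free_alg_on X"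
    and part: "sa_part (presented X p Rel) b = coset ?I ` {f \<in> free_alg_on X. homogeneous p b f}" for b
    by (simp_all add: presented_def Let_def)
  have "coset_eval v ` sa_part (presented X p Rel) b \<subseteq> sa_part (purely_even L) b" for b
  proof (cases b)
    case True
    have "coset_eval v (coset ?I f) = 0" if "f \<in> free_alg_on X" "homogeneous p True f" for f
      unfolding ev using homogeneous_odd_zero[OF that(1) even that(2)] by simp
    then show ?thesis
      using True by (auto simp: part purely_even_def)
  qed (simp add: purely_even_def)
  then show ?thesis
    unfolding lie_superalgebra_hom_def carrier
    by (auto simp: purely_even_def presented_add_coset presented_scale_coset
        presented_bracket_coset[OF _ _ Rel] ev alg_eval_add alg_eval_scale alg_eval_mult)
qed

section \<open>Weights and surjectivity of the realisation\<close>

primrec generator_weight :: "'e::zero generator \<Rightarrow> 'e" where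
  "generator_weight (Gen_h \<sigma>) = 0"
| "generator_weight (Gen_E \<mu>) = \<mu>"

primrec magma_weight :: "'e::monoid_add generator magma \<Rightarrow> 'e" where
  "magma_weight (Leaf x) = generator_weight x"
| "magma_weight (Br s t) = magma_weight s + magma_weight t"

context realised_base_system
begin

definition gen_value :: "('e \<Rightarrow> 'l) \<Rightarrow> 'e generator \<Rightarrow> 'l" where
  "gen_value e x = (case x of Gen_h \<sigma> \<Rightarrow> T \<sigma> | Gen_E \<mu> \<Rightarrow> e \<mu>)"

lemma gen_value_simps [simp]: "gen_value e (Gen_h \<sigma>) = T \<sigma>" "gen_value e (Gen_E \<mu>) = e \<mu>"
  by (simp_all add: gen_value_def)

abbreviation "X \<equiv> generators D"

text \<open>By \<open>RS_double_zero\<close>, twice a root is never a root.\<close>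

lemma generators_even: "x \<in> X \<Longrightarrow> \<not> parity D x"
proof (cases x)
  case (Gen_E \<mu>)
  assume "x \<in> X"
  then have "real_root \<mu>"
    using Gen_E by (auto simp: generators_def intro: B_all_real_root)
  then have "RS (2 *E \<mu>) = {0}"
    by (rule RS_double_zero)
  then have "2 *E \<mu> \<notin> R_kg D"
    using real_root_iff_R by (auto simp: real_root_def)
  then show ?thesis
    by (simp add: Gen_E parity_def)
qed (simp add: parity_def)

lemma gen_free: "gen_elt x \<in> free_alg_on X \<longleftrightarrow> x \<in> X"
  by (simp add: gen_elt_def free_alg_on_def)

lemma gh_free [simp]: "gh \<sigma> \<in> free_alg_on X"
  unfolding gen_free by (simp add: generators_def)

lemma gE_free: "\<mu> \<in> B_all D \<Longrightarrow> gE \<mu> \<in> free_alg_on X"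
  unfolding gen_free by (simp add: generators_def)

lemma ad_pow_free: "f \<in> free_alg_on X \<Longrightarrow> g \<in> free_alg_on X \<Longrightarrow> ad_pow f n g \<in> free_alg_on X"
  by (induction n) (simp_all add: ad_pow_def free_alg_on_mult)

lemma RS_weight_unique:
  assumes "x \<in> RS \<mu>" "x \<in> RS \<nu>" "x \<noteq> 0"
  shows "\<mu> = \<nu>"
proof -
  have "\<phi> \<mu> h = \<phi> \<nu> h" for h
  proof (cases "h \<in> \<H>")
    case True
    then have "\<phi> \<mu> h *L x = \<phi> \<nu> h *L x"
      using assms by (simp add: root_space_def)
    then show ?thesis
      using assms(3) by simp
  next
    case False
    then show ?thesis
      using phi_dual[of \<mu>] phi_dual[of \<nu>] by (simp add: cartan_dual_def)
  qed
  then show ?thesis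
    using phi_inj by (auto dest: injD)
qed

lemma monomial_weight:
  assumes e: "chevalley_family e"
  shows "leaves t \<subseteq> X \<Longrightarrow> monomial_eval (gen_value e) t \<in> RS (magma_weight t)"
proof (induction t)
  case (Leaf x)
  then show ?case
    using T_cartan RS_zero chevalley_family_RS[OF e] by (auto simp: generators_def)
qed (auto intro: RS_bracket)

text \<open>Collecting monomials of equal weight exhibits the value of \<open>f\<close> as a finite sum of root
  vectors.\<close>

lemma alg_eval_weight:
  assumes e: "chevalley_family e" and f: "f \<in> free_alg_on X"
    and weight: "\<And>\<sigma>. br (T \<sigma>) (alg_eval (gen_value e) f) = J \<sigma> \<mu> *L alg_eval (gen_value e) f"
  shows "alg_eval (gen_value e) f \<in> RS \<mu>"
proof -
  let ?g = "\<lambda>t. coefficient f t *L monomial_eval (gen_value e) t"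
  define N where "N = magma_weight ` monomials f"
  define Y where "Y \<nu> = (\<Sum>t | t \<in> monomials f \<and> magma_weight t = \<nu>. ?g t)" for \<nu>
  have sum: "alg_eval (gen_value e) f = sum Y N"
    unfolding alg_eval_def Y_def N_def by (rule sum.image_gen) simp
  have "Y \<nu> \<in> RS \<nu>" for \<nu>
    unfolding Y_def
  proof (rule subspace_sum[OF root_space_subspace])
    fix t assume "t \<in> {t. t \<in> monomials f \<and> magma_weight t = \<nu>}"
    then show "?g t \<in> RS \<nu>"
      using f monomial_weight[OF e, of t] RS_scale by (auto simp: free_alg_on_def)
  qed
  then show ?thesis
    using weight_vector_in_root_space[OF J_nondegenerate, of N Y \<mu>] weight
    by (simp add: sum N_def)
qed

definition free_weight :: "'e \<Rightarrow> 'e generator free_alg set" where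
  "free_weight \<mu> = {f \<in> free_alg_on X. \<forall>t\<in>monomials f. magma_weight t = \<mu>}"

lemma free_weight_scale: "f \<in> free_weight \<mu> \<Longrightarrow> r \<cdot>\<^sub>F f \<in> free_weight \<mu>"
  by (auto simp: free_weight_def free_alg_on_scale in_keys_iff)

lemma free_weight_mult: "f \<in> free_weight \<mu> \<Longrightarrow> g \<in> free_weight \<nu> \<Longrightarrow> f \<star> g \<in> free_weight (\<mu> + \<nu>)"
  by (auto simp: free_weight_def free_alg_on_mult in_keys_iff split: magma.splits)

lemma free_weight_gE: "\<mu> \<in> B_all D \<Longrightarrow> gE \<mu> \<in> free_weight \<mu>"
  by (simp add: free_weight_def gE_free) (simp add: gen_elt_def)

lemma free_weight_ad_pow:
  assumes "f \<in> free_weight \<mu>" "g \<in> free_weight \<nu>"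
  shows "ad_pow f n g \<in> free_weight (of_nat n *E \<mu> + \<nu>)"
proof (induction n)
  case (Suc n)
  have "f \<star> ad_pow f n g \<in> free_weight (\<mu> + (of_nat n *E \<mu> + \<nu>))"
    by (rule free_weight_mult[OF assms(1) Suc])
  then show ?case
    by (simp add: ad_pow_def E.scale_left_distrib add.assoc)
qed (use assms in \<open>simp add: ad_pow_def\<close>)

text \<open>The set of roots whose root space is covered by the generated subalgebra contains
  \<open>\<Pi> \<union> \<Pi>\<^sup>*\<close> and is stable under the reflections in its members, because root spaces are lines and
  reflections are effected by powers of root vectors.\<close>

lemma root_space_generated:
  assumes e: "chevalley_family e" and "\<mu> \<in> R_kg D"
  shows "RS \<mu> \<subseteq> alg_eval (gen_value e) ` free_weight \<mu>"
proof -
  let ?ev = "alg_eval (gen_value e)"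
  have line: "RS \<mu> \<subseteq> ?ev ` free_weight \<mu>"
    if real: "real_root \<mu>" and f: "f \<in> free_weight \<mu>" "?ev f \<in> RS \<mu>" "?ev f \<noteq> 0" for \<mu> f
  proof
    fix x assume "x \<in> RS \<mu>"
    then obtain c where "x = c *L ?ev f"
      using real_root_space_one_dim[OF real f(2,3)] by blast
    then show "x \<in> ?ev ` free_weight \<mu>"
      using free_weight_scale[OF f(1), of c] by (auto simp: alg_eval_scale intro!: image_eqI)
  qed
  have "real_root \<mu> \<and> RS \<mu> \<subseteq> ?ev ` free_weight \<mu>"
    using assms(2)
  proof (induction rule: R_kg_induct)
    case (base \<rho>)
    then have "\<rho> \<in> B_all D"
      by (rule B_plus_in_B_all)
    then show ?case
      using line[of \<rho> "gE \<rho>"] base B_plus_real_root free_weight_gE chevalley_family_RS[OF e]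
        chevalley_family_nonzero[OF e] by simp
  next
    case (reflect \<rho> \<nu>)
    have \<rho>: "\<rho> \<in> B_all D" "- \<rho> \<in> B_all D"
      using reflect(1) B_plus_in_B_all B_all_minus by blast+
    obtain v where v: "v \<in> RS \<nu>" "v \<noteq> 0"
      using real_root_nonzero[OF conjunct1[OF reflect(2)]] by blast
    then obtain f where f: "f \<in> free_weight \<nu>" "v = ?ev f"
      using conjunct2[OF reflect(2)] by blast
    obtain n g where g: "g = e \<rho> \<or> g = e (- \<rho>)"
        and w: "(br g ^^ n) v \<in> RS (reflection D \<rho> \<nu>)" "(br g ^^ n) v \<noteq> 0"
      by (rule reflected_weight_vector[OF chevalley_family_pair[OF e \<rho>(1)] v])
    obtain \<rho>' where \<rho>': "\<rho>' \<in> B_all D" "g = e \<rho>'"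
      using g \<rho> by blast
    define f' where "f' = ad_pow (gE \<rho>') n f"
    have ev: "?ev f' = (br g ^^ n) v"
      by (simp add: f'_def alg_eval_ad_pow f(2) \<rho>'(2))
    have "(br g ^^ n) v \<in> RS (of_nat n *E \<rho>' + \<nu>)"
      unfolding \<rho>'(2) by (intro RS_funpow chevalley_family_RS e \<rho>' v)
    then have "of_nat n *E \<rho>' + \<nu> = reflection D \<rho> \<nu>"
      using RS_weight_unique w by blast
    then have "f' \<in> free_weight (reflection D \<rho> \<nu>)"
      using free_weight_ad_pow[OF free_weight_gE[OF \<rho>'(1)] f(1), of n] by (simp add: f'_def)
    moreover have "J (reflection D \<rho> \<nu>) (reflection D \<rho> \<nu>) \<noteq> 0"
      using reflection_isometry[OF B_plus_norm[OF reflect(1)]] reflect by (simp add: real_root_def)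
    then have "real_root (reflection D \<rho> \<nu>)"
      using w by (rule real_rootI)
    ultimately show ?case
      using line w unfolding ev[symmetric] by blast
  qed
  then show ?thesis
    by blast
qed

abbreviation "cartan_relators \<equiv> {gh \<sigma> \<star> gh \<tau> | \<sigma> \<tau>. True} \<union>
     {gh \<sigma> \<star> gE \<mu> - e_form D \<sigma> \<mu> \<cdot>\<^sub>F gE \<mu> | \<sigma> \<mu>. \<mu> \<in> B_all D}"

text \<open>The relators say this for generators, and \<open>ad h\<^sub>\<sigma>\<close> is a derivation.\<close>

lemma monomial_weight_vector:
  assumes Rel: "cartan_relators \<subseteq> Rel"
  shows "leaves t \<subseteq> X \<Longrightarrow> gh \<sigma> \<star> monomial t -
    J \<sigma> (magma_weight t) \<cdot>\<^sub>F monomial t \<in> lie_ideal X (parity D) Rel"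
proof (induction t)
  case (Leaf x)
  show ?case
  proof (cases x)
    case (Gen_h \<tau>)
    have "gh \<sigma> \<star> gh \<tau> - 0 \<cdot>\<^sub>F gh \<tau> = gh \<sigma> \<star> gh \<tau>"
      by (rule poly_mapping_eqI) (simp add: lookup_minus)
    then show ?thesis
      using Rel Gen_h by (auto intro!: lie_ideal.relator simp: gen_elt_def)
  next
    case (Gen_E \<mu>)
    then have "\<mu> \<in> B_all D"
      using Leaf by (auto simp: generators_def)
    then show ?thesis
      using Rel Gen_E by (auto intro!: lie_ideal.relator simp: gen_elt_def)
  qed
next
  case (Br s t)
  let ?I = "lie_ideal X (parity D) Rel"
  let ?s = "monomial s" and ?t = "monomial t"
  have st: "monomial (Br s t) = ?s \<star> ?t"
    by (rule poly_mapping_eqI) (auto simp: lookup_single when_def split: magma.splits)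
  have free: "?s \<in> free_alg_on X" "?t \<in> free_alg_on X"
    using Br.prems by (auto simp: free_alg_on_def)
  have "homogeneous (parity D) False (gh \<sigma>)" "homogeneous (parity D) (odd_monomial (parity D) s) ?s"
    by (simp_all add: homogeneous_def gen_elt_def parity_def)
  then have jacobi: "gh \<sigma> \<star> (?s \<star> ?t) - (gh \<sigma> \<star> ?s) \<star> ?t -
      koszul_sign False (odd_monomial (parity D) s) \<cdot>\<^sub>F (?s \<star> (gh \<sigma> \<star> ?t)) \<in> ?I" (is "?jacobi \<in> _")
    by (rule lie_ideal.jacobi[OF gh_free free])
  have left: "(gh \<sigma> \<star> ?s - J \<sigma> (magma_weight s) \<cdot>\<^sub>F ?s) \<star> ?t \<in> ?I" (is "?left \<in> _")
    using Br free by (intro lie_ideal.mult_right) auto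
  have right: "?s \<star> (gh \<sigma> \<star> ?t - J \<sigma> (magma_weight t) \<cdot>\<^sub>F ?t) \<in> ?I" (is "?right \<in> _")
    using Br free by (intro lie_ideal.mult_left) auto
  have "gh \<sigma> \<star> (?s \<star> ?t) - J \<sigma> (magma_weight (Br s t)) \<cdot>\<^sub>F (?s \<star> ?t) = ?jacobi + (?left + ?right)"
    by (rule poly_mapping_eqI)
      (simp add: lookup_add lookup_minus koszul_sign_def J_add algebra_simps split: magma.splits)
  then show ?case
    unfolding st using jacobi left right by (metis lie_ideal.add)
qed

lemma free_weight_weight_vector:
  assumes Rel: "cartan_relators \<subseteq> Rel" and f: "f \<in> free_weight \<mu>"
  shows "gh \<sigma> \<star> f - J \<sigma> \<mu> \<cdot>\<^sub>F f \<in> lie_ideal X (parity D) Rel"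
proof -
  let ?I = "lie_ideal X (parity D) Rel"
  define P where "P g \<longleftrightarrow> gh \<sigma> \<star> g - J \<sigma> \<mu> \<cdot>\<^sub>F g \<in> ?I" for g
  have add: "P (c \<cdot>\<^sub>F h + g)" if "P g" "P h" for g h c
  proof -
    have "gh \<sigma> \<star> (c \<cdot>\<^sub>F h + g) - J \<sigma> \<mu> \<cdot>\<^sub>F (c \<cdot>\<^sub>F h + g) =
        (gh \<sigma> \<star> g - J \<sigma> \<mu> \<cdot>\<^sub>F g) + c \<cdot>\<^sub>F (gh \<sigma> \<star> h - J \<sigma> \<mu> \<cdot>\<^sub>F h)"
      by (rule poly_mapping_eqI)
        (simp add: lookup_add lookup_minus algebra_simps split: magma.splits)
    then show ?thesis
      using that unfolding P_def by (auto intro: lie_ideal.add lie_ideal.scale)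
  qed
  have zero: "P 0"
  proof -
    have "gh \<sigma> \<star> 0 - J \<sigma> \<mu> \<cdot>\<^sub>F 0 = 0"
      by (rule poly_mapping_eqI) (simp add: lookup_minus split: magma.splits)
    then show ?thesis
      by (simp add: P_def lie_ideal.zero)
  qed
  have "P (\<Sum>t\<in>K. coefficient f t \<cdot>\<^sub>F monomial t)"
    if "finite K" "K \<subseteq> monomials f" for K
    using that
  proof (induction rule: finite_induct)
    case (insert t K)
    have "P (monomial t)"
      using monomial_weight_vector[OF Rel, of t \<sigma>] f insert.prems
      by (auto simp: P_def free_weight_def free_alg_on_def)
    then show ?case
      using insert add by simp
  qed (simp add: zero)
  moreover have "(\<Sum>t\<in>monomials f. coefficient f t \<cdot>\<^sub>F monomial t) = f"
    by (rule poly_mapping_eqI)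
      (auto simp: lookup_sum lookup_single when_def in_keys_iff if_distrib cong: if_cong)
  ultimately show ?thesis
    by (metis P_def finite_keys order_refl)
qed

definition realises :: "('x, 'e generator) presented_superalgebra \<Rightarrow> bool" where
  "realises G \<longleftrightarrow> (\<exists>F. lie_superalgebra_hom G (purely_even L) F \<and>
     (\<forall>\<sigma>. F (sa_gen G (Gen_h \<sigma>)) = T \<sigma>) \<and> (\<forall>\<mu>\<in>R_kg D. F ` weight_space D G \<mu> = RS \<mu>))"

text \<open>This applies to every presentation that contains the relators of the Cartan part, in particular
  to \<open>\<gg>\<^sub>D\<close> and to \<open>\<gg>\<^sup>q\<^sub>D\<close>.\<close>

lemma realisation:
  assumes e: "chevalley_family e"
    and Rel: "Rel \<subseteq> free_alg_on X" "cartan_relators \<subseteq> Rel"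
    and rel: "\<And>f. f \<in> Rel \<Longrightarrow> alg_eval (gen_value e) f = 0"
  shows "realises (presented X (parity D) Rel)"
proof -
  let ?G = "presented X (parity D) Rel" and ?I = "lie_ideal X (parity D) Rel"
  let ?F = "coset_eval (gen_value e)" and ?ev = "alg_eval (gen_value e)"
  have F: "?F (coset ?I f) = ?ev f" for f
    by (rule coset_eval) (use generators_even rel in auto)
  have carrier: "sa_carrier ?G = coset ?I ` free_alg_on X"
    and gen: "sa_gen ?G x = coset ?I (gen_elt x)" for x
    by (simp_all add: presented_def Let_def)
  have bracket: "sa_bracket ?G (sa_gen ?G (Gen_h \<sigma>)) (coset ?I f) = sa_scale ?G (J \<sigma> \<mu>) (coset ?I f)
      \<longleftrightarrow> gh \<sigma> \<star> f - J \<sigma> \<mu> \<cdot>\<^sub>F f \<in> ?I" if "f \<in> free_alg_on X" for \<sigma> \<mu> f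
    using that by (simp add: gen presented_bracket_coset[OF gh_free that Rel(1)]
        presented_scale_coset coset_eq_iff)
  have "?F ` weight_space D ?G \<mu> = RS \<mu>" if \<mu>: "\<mu> \<in> R_kg D" for \<mu>
  proof
    show "?F ` weight_space D ?G \<mu> \<subseteq> RS \<mu>"
    proof
      fix x assume "x \<in> ?F ` weight_space D ?G \<mu>"
      then obtain f where f: "f \<in> free_alg_on X" "x = ?ev f"
          and ideal: "\<And>\<sigma>. gh \<sigma> \<star> f - J \<sigma> \<mu> \<cdot>\<^sub>F f \<in> ?I"
        using bracket by (auto simp: weight_space_def carrier F)
      have "br (T \<sigma>) (?ev f) = J \<sigma> \<mu> *L ?ev f" for \<sigma>
      proof -
        have "?ev (gh \<sigma> \<star> f - J \<sigma> \<mu> \<cdot>\<^sub>F f) = 0"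
          by (rule alg_eval_lie_ideal[OF _ _ ideal]) (use generators_even rel in auto)
        then show ?thesis
          by (simp add: alg_eval_diff alg_eval_mult alg_eval_scale)
      qed
      then show "x \<in> RS \<mu>"
        unfolding f(2) by (rule alg_eval_weight[OF e f(1)])
    qed
    show "RS \<mu> \<subseteq> ?F ` weight_space D ?G \<mu>"
    proof
      fix x assume "x \<in> RS \<mu>"
      then obtain f where f: "f \<in> free_weight \<mu>" "x = ?ev f"
        using root_space_generated[OF e \<mu>] by blast
      then have "f \<in> free_alg_on X"
        by (simp add: free_weight_def)
      then have "coset ?I f \<in> weight_space D ?G \<mu>"
        using bracket free_weight_weight_vector[OF Rel(2) f(1)] by (auto simp: weight_space_def carrier)
      then show "x \<in> ?F ` weight_space D ?G \<mu>"
        using f(2) F by (metis imageI)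
    qed
  qed
  moreover have "lie_superalgebra_hom ?G (purely_even L) ?F"
    by (rule presented_hom[OF _ Rel(1)]) (use generators_even rel in auto)
  moreover have "?F (sa_gen ?G (Gen_h \<sigma>)) = T \<sigma>" for \<sigma>
    by (simp add: gen F)
  ultimately show ?thesis
    unfolding realises_def by blast
qed

end

section \<open>The relations hold in the extended affine Lie algebra\<close>

lemma affine_gcm_A1_ends:
  assumes "2 \<le> l"
  shows "affine_gcm Aff_A1 l 0 l = - 1" "affine_gcm Aff_A1 l l 0 = - 1"
proof -
  have "map (bond_entry 0 l) (chain 0 l) = map (\<lambda>_. 0) (chain 0 l)"
      "map (bond_entry l 0) (chain 0 l) = map (\<lambda>_. 0) (chain 0 l)"
    using assms by (auto simp: set_chain bond_entry_def)
  moreover have "sum_list (map (\<lambda>_. 0 :: int) (chain 0 l)) = 0"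
    by (simp add: sum_list_0)
  ultimately show "affine_gcm Aff_A1 l 0 l = - 1" "affine_gcm Aff_A1 l l 0 = - 1"
    using assms by (simp_all add: affine_gcm_bond_entry bond_entry_def[of _ _] del: map_eq_conv)
qed

context realised_base_system
begin

lemma A_triple_B_plus:
  assumes "(\<beta>, \<gamma>, y) \<in> A_triples D"
  shows "\<beta> \<in> B_plus D" "\<gamma> \<in> B_plus D" "star D \<beta> \<in> B_plus D" "star D \<gamma> \<in> B_plus D"
  using assms by (auto simp: A_triples_def B_plus_def)

lemma root_vector_free:
  "\<mu> \<in> B_plus D \<Longrightarrow> gE \<mu> \<in> free_alg_on X" "\<mu> \<in> B_plus D \<Longrightarrow> gE (- \<mu>) \<in> free_alg_on X"
  using gE_free B_plus_in_B_all B_all_minus by blast+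

lemma A_triple_vectors_free:
  assumes "(\<beta>, \<gamma>, y) \<in> A_triples D"
  shows "gE \<beta> \<in> free_alg_on X \<and> gE (- \<beta>) \<in> free_alg_on X \<and>
    gE \<gamma> \<in> free_alg_on X \<and> gE (- \<gamma>) \<in> free_alg_on X \<and>
    gE (star D \<beta>) \<in> free_alg_on X \<and> gE (- star D \<beta>) \<in> free_alg_on X \<and>
    gE (star D \<gamma>) \<in> free_alg_on X \<and> gE (- star D \<gamma>) \<in> free_alg_on X"
  using A_triple_B_plus[OF assms] root_vector_free by simp

lemma common_relators_free: "common_relators D \<subseteq> free_alg_on X"
  unfolding common_relators_def
  by (auto intro!: free_alg_on_add free_alg_on_diff free_alg_on_scale free_alg_on_mult ad_pow_free
      intro: gE_free root_vector_free dest!: A_triple_vectors_free)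

lemma linking_relators_free:
  assumes "S \<subseteq> A_triples D"
  shows "linking_relators D S \<subseteq> free_alg_on X"
  unfolding linking_relators_def
  by (auto intro!: free_alg_on_diff free_alg_on_scale ad_pow_free
      dest!: assms[THEN subsetD, THEN A_triple_vectors_free])

lemma common_relators_vanish:
  assumes e: "chevalley_family e" and f: "f \<in> common_relators D"
  shows "alg_eval (gen_value e) f = 0"
proof -
  note ev = alg_eval_add alg_eval_diff alg_eval_scale alg_eval_mult alg_eval_ad_pow
  have "br (e \<mu>) (e (- \<mu>)) = T (coroot D \<mu>)" if "\<mu> \<in> B_plus D" for \<mu>
    using chevalley_pair_sl2[OF chevalley_family_pair[OF e B_plus_in_B_all[OF that]]]
    by (simp add: sl2_triple_def)
  moreover have "br (T \<sigma>) (T \<tau>) = 0" for \<sigma> \<tau>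
    by (rule cartan_commute[OF T_cartan T_cartan])
  moreover have "br (T \<sigma>) (e \<mu>) = J \<sigma> \<mu> *L e \<mu>" if "\<mu> \<in> B_all D" for \<sigma> \<mu>
    by (rule T_bracket[OF chevalley_family_RS[OF e that]])
  ultimately show ?thesis
    using f unfolding common_relators_def
    by (elim UnE) (auto simp: ev T_linear serre_relation[OF e] inner_relation[OF e])
qed

lemma linking_relators_vanish:
  assumes "\<And>\<beta> \<gamma> y. (\<beta>, \<gamma>, y) \<in> S \<Longrightarrow> linked e \<beta> \<gamma> y"
    and "f \<in> linking_relators D S"
  shows "alg_eval (gen_value e) f = 0"
  using assms unfolding linking_relators_def
  by (auto simp: alg_eval_diff alg_eval_scale alg_eval_ad_pow linked_def link_left_def
      link_right_def neg_link_left_def neg_link_right_def)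

lemma cartan_relators_common: "cartan_relators \<subseteq> common_relators D"
  unfolding common_relators_def by blast

lemma A_triple_indices:
  assumes "(\<beta>, \<gamma>, y) \<in> A_triples D"
  obtains i j where "i \<le> l" "j \<le> l" "\<beta> = \<alpha> i" "\<gamma> = \<alpha> j"
  using A_triple[OF assms] by metis

lemma realisation_tree:
  assumes "e_type D \<noteq> Aff_A1"
  shows "realises (g_alg D)"
proof -
  obtain e where e: "chevalley_family e"
    and link: "\<And>i j y. joined i j \<Longrightarrow> (\<alpha> i, \<alpha> j, y) \<in> A_triples D \<Longrightarrow> linked e (\<alpha> i) (\<alpha> j) y"
    using normalised_family_exists by blast
  have links: "linked e \<beta> \<gamma> y" if A: "(\<beta>, \<gamma>, y) \<in> A_triples D" for \<beta> \<gamma> y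
  proof -
    obtain i j where ij: "i \<le> l" "j \<le> l" "\<beta> = \<alpha> i" "\<gamma> = \<alpha> j"
      by (rule A_triple_indices[OF A])
    then show ?thesis
      using A_triple_bond[of i j y] link[of i j y] A assms by (auto simp: joined_def tree_bonds_def)
  qed
  show ?thesis
    unfolding g_alg_def
  proof (rule realisation[OF e])
    show "common_relators D \<union> linking_relators D (A_triples D) \<subseteq> free_alg_on X"
      using common_relators_free linking_relators_free by blast
    show "cartan_relators \<subseteq> common_relators D \<union> linking_relators D (A_triples D)"
      using cartan_relators_common by blast
    show "alg_eval (gen_value e) f = 0"
      if "f \<in> common_relators D \<union> linking_relators D (A_triples D)" for f
      using that common_relators_vanish[OF e] linking_relators_vanish[OF links] by blast
  qed
qed

text \<open>The relations are normalised along the chain from \<open>0\<close> to \<open>l\<close>; the factor of the bond that closes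
  the cycle is \<open>q\<close>.\<close>

lemma realisation_cycle:
  assumes type: "e_type D = Aff_A1"
  shows "\<exists>q. q \<noteq> 0 \<and> realises (gq_alg D q)"
proof -
  obtain e where e: "chevalley_family e"
    and link: "\<And>i j y. joined i j \<Longrightarrow> (\<alpha> i, \<alpha> j, y) \<in> A_triples D \<Longrightarrow> linked e (\<alpha> i) (\<alpha> j) y"
    using normalised_family_exists by blast
  have l2: "2 \<le> l"
    using rank type by simp
  have gcm: "gcm 0 l = - 1" "gcm l 0 = - 1"
    using affine_gcm_A1_ends[OF l2] type by simp_all
  have J: "J (coroot D (\<alpha> 0)) (\<alpha> l) = - 1" "J (coroot D (\<alpha> l)) (\<alpha> 0) = - 1"
    using J_coroot_simple[of 0 l] J_coroot_simple[of l 0] by (simp_all add: gcm)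
  have ne: "\<alpha> 0 \<noteq> \<alpha> l"
    using simple_inj[of 0 l] l2 by simp
  have simple: "\<alpha> 0 \<in> simple_roots D" "\<alpha> l \<in> simple_roots D"
    by (auto simp: simple_root_cases)
  have "J (\<alpha> l) (\<alpha> 0) \<noteq> 0"
    using J(2) by (auto simp: J_coroot)
  then have "\<alpha> l \<in> connected_to D (\<alpha> 0)"
    using ne simple by (auto simp: connected_to_def)
  then have "of_nat (k l) / of_nat (k 0) \<in> (\<int> :: complex set) \<and>
      J (coroot D (\<alpha> 0)) (\<alpha> l) * (of_nat (k 0) / of_nat (k l)) \<in> \<int>"
    using qebs simple(1) J(2) unfolding qebs_def by blast
  then have "k 0 dvd k l" "k l dvd k 0"
    using k_pos[of 0] k_pos[of l] by (auto simp: J(1) intro!: of_nat_divide_Ints)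
  then have k: "k l = k 0"
    by (simp add: dvd_antisym)
  have A: "(\<alpha> 0, \<alpha> l, 1) \<in> A_triples D" "(\<alpha> l, \<alpha> 0, 1) \<in> A_triples D"
    using simple ne J k J_sym by (auto simp: A_triples_def)
  have c: "c 0 = 1"
    using A_triple[OF A(2)] simple_inj by metis
  obtain q where q: "q \<noteq> 0" "link_right e (\<alpha> 0) (\<alpha> l) 1 = q *L link_left e (\<alpha> 0) (\<alpha> l) 1"
      "neg_link_left e (\<alpha> 0) (\<alpha> l) 1 = q *L neg_link_right e (\<alpha> 0) (\<alpha> l) 1"
    using link_ratio[OF e A(1)] by blast
  define S where "S = A_triples D - {(\<alpha> 0, \<alpha> l, 1), (\<alpha> l, \<alpha> 0, 1)}"
  have links: "linked e \<beta> \<gamma> y" if S: "(\<beta>, \<gamma>, y) \<in> S" for \<beta> \<gamma> y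
  proof -
    have A': "(\<beta>, \<gamma>, y) \<in> A_triples D"
      using S by (simp add: S_def)
    obtain i j where ij: "i \<le> l" "j \<le> l" "\<beta> = \<alpha> i" "\<gamma> = \<alpha> j"
      by (rule A_triple_indices[OF A'])
    have "y = 1" if "{i, j} = {0, l}"
    proof -
      have "k i * y = k j"
        using A' ij by (simp add: A_triples_def)
      moreover have "k i = k j" "0 < k i"
        using that k k_pos[OF ij(1)] by (auto simp: doubleton_eq_iff)
      ultimately show ?thesis
        by simp
    qed
    moreover have "y \<noteq> 1" if "i = 0 \<and> j = l \<or> i = l \<and> j = 0"
      using S that unfolding ij(3,4) S_def by blast
    ultimately have "{i, j} \<noteq> {0, l}"
      by (metis doubleton_eq_iff)
    then show ?thesis
      using A_triple_bond[of i j y] link[of i j y] A' ij type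
      by (auto simp: joined_def tree_bonds_def doubleton_eq_iff)
  qed
  let ?closing = "{q \<cdot>\<^sub>F (gE (star D (\<alpha> 0)) \<star> gE (\<alpha> l)) - gE (\<alpha> 0) \<star> gE (star D (\<alpha> l)),
      inverse q \<cdot>\<^sub>F (gE (- star D (\<alpha> 0)) \<star> gE (- \<alpha> l)) - gE (- \<alpha> 0) \<star> gE (- star D (\<alpha> l))}"
  have gq: "gq_alg D q = presented X (parity D)
      (common_relators D \<union> linking_relators D S \<union> ?closing)"
    by (simp add: gq_alg_def S_def Let_def)
  have "realises (gq_alg D q)"
    unfolding gq
  proof (rule realisation[OF e])
    have "?closing \<subseteq> free_alg_on X"
      using A_triple_B_plus[OF A(1)] root_vector_free
      by (auto intro!: free_alg_on_diff free_alg_on_scale free_alg_on_mult)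
    then show "common_relators D \<union> linking_relators D S \<union> ?closing \<subseteq> free_alg_on X"
      using common_relators_free linking_relators_free[of S] by (auto simp: S_def)
    show "cartan_relators \<subseteq> common_relators D \<union> linking_relators D S \<union> ?closing"
      using cartan_relators_common by blast
    have "alg_eval (gen_value e) f = 0" if "f \<in> ?closing" for f
      using that q c by (auto simp: alg_eval_diff alg_eval_scale alg_eval_mult link_left_def
          link_right_def neg_link_left_def neg_link_right_def)
    then show "alg_eval (gen_value e) f = 0"
      if "f \<in> common_relators D \<union> linking_relators D S \<union> ?closing" for f
      using that common_relators_vanish[OF e] linking_relators_vanish[OF links] by blast
  qed
  with q(1) show ?thesis
    by blast
qed

end

theorem theorem5p3:
  fixes D :: "'e::ab_group_add base_system"
    and L :: "'l::ab_group_add lie_triple"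
    and \<phi> :: "'e \<Rightarrow> 'l \<Rightarrow> complex"
  assumes "qebs D"
    and "\<forall>\<alpha>\<in>simple_roots D. e_g D \<alpha> = {} \<or> e_g D \<alpha> = {n. odd n}"
    and "eala L"
    and "isometric_monomorphism D L \<phi>"
    and "\<phi> ` R_kg D = nonisotropic_roots L"
  shows "\<exists>G. (if e_type D = Aff_A1 then \<exists>q. q \<noteq> 0 \<and> G = gq_alg D q else G = g_alg D) \<and>
    (\<exists>F. lie_superalgebra_hom G (purely_even L) F \<and>
      (\<forall>\<sigma>. F (sa_gen G (Gen_h \<sigma>)) = t_vec L (\<phi> \<sigma>)) \<and>
      (\<forall>\<mu>\<in>R_kg D. F ` weight_space D G \<mu> = root_space L (\<phi> \<mu>)))"
proof -
  interpret qebs_odd D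
    using assms(1,2) by (intro qebs_odd.intro qebs_base.intro qebs_odd_axioms.intro) auto
  interpret realised_base_system L D \<phi>
    by (intro realised_base_system.intro eala_weights.intro extended_affine_lie_algebra.intro
        eala_weights_axioms.intro realised_base_system_axioms.intro assms(3-5)
        qebs_odd_axioms bilinear_base_axioms)
  show ?thesis
    using realisation_tree realisation_cycle unfolding realises_def
    by (cases "e_type D = Aff_A1") auto
qed

end
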